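(* Let $X(t)=\sum_{k=1}^{N(t)}W(k)-\lambda t\,\mathbb E W(1)$ be a one-dimensional compensated compound Poisson process with positive jumps such that $x\mapsto\mathbb P(X(1)>x)$ is regularly varying at infinity with index $-\beta<-1$, and let $\bar X_n(t)=X(nt)/n$, $t\in[0,1]$. Let $A\subseteq\mathbb D$ be a Borel measurable set such that $l^*=\min\{l\in\mathbb Z_+:\mathbb D_l\cap A\ne\emptyset\}$ exists, $A$ is bounded away from $\mathbb D_{<l^*}$, and $C_{l^*}(A^\circ)>0$. Fix $w\in(0,1)$. Set $A_n=\{\bar X_n\in A\}$ and, for $\gamma>0$, $B_n^\gamma=\{\bar X_n\in B^\gamma\}$ with $B^\gamma=\{\xi\in\mathbb D:\#\{t:\xi(t)-\xi(t^-)>\gamma\}\ge l^*\}$. Then there exists $\gamma>0$ such that the estimator $$Z_n=\frac{\mathbf 1_{A_n}}{w+\frac{1-w}{\mathbb P(B_n^\gamma)}\mathbf 1_{B_n^\gamma}},$$ sampled under $\mathbb Q_{\gamma,w}(\cdot)=w\,\mathbb P(\cdot)+(1-w)\,\mathbb P(\cdot\mid B_n^\gamma)$, is strongly efficient for estimating $\mathbb P(A_n)$, i.e. $\mathbb E^{\mathbb Q_{\gamma,w}}[Z_n^2]=\mathcal O(\mathbb P(A_n)^2)$ as $n\to\infty$.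
   Context: $\mathbb D$ is the space of real-valued càdlàg functions on $[0,1]$ with the Skorokhod $J_1$ metric $d(x,y)=\inf_{\lambda}\|\lambda-\mathrm{id}\|_\infty\vee\|x\circ\lambda-y\|_\infty$ (infimum over increasing continuous bijections $\lambda$ of $[0,1]$). $A$ is bounded away from $S$ if $\inf_{x\in A,y\in S}d(x,y)>0$ (with $\inf\emptyset=\infty$). $A^\circ$ is the interior of $A$. $\mathbb Z_+=\{0,1,2,\dots\}$. $N$ is a Poisson process with rate $\lambda>0$, independent of the i.i.d. positive jump sizes $W(k)$, $k\ge1$. $\mathbb D_l$: the set of non-decreasing step functions in $\mathbb D$ vanishing at time $0$ with exactly $l$ jumps; $\mathbb D_{<l^*}=\bigcup_{l\le l^*-1}\mathbb D_l$ (empty if $l^*=0$). With $\nu_\beta(x,\infty)=x^{-\beta}$, let $\nu_\beta^l$ be the restriction of the $l$-fold product measure of $\nu_\beta$ to $\{x\in\mathbb R_+^l:x_1\ge\cdots\ge x_l\}$; for $l\ge1$, $C_l(\cdot)=\mathbb E\big[\nu_\beta^l\{y\in(0,\infty)^l:\sum_{i=1}^l y_i\mathbf 1_{[U_i,1]}\in\cdot\}\big]$ with $U_i$ i.i.d. uniform on $[0,1]$; $C_0$ is the Dirac measure at the zero function. *)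

theory Defs
  imports "HOL-Probability.Probability" "HOL-Library.Landau_Symbols"
begin

section \<open>The Skorokhod space of real cadlag paths on the unit interval\<close>

definition cadlag :: "(real \<Rightarrow> real) \<Rightarrow> bool" where
  "cadlag f \<longleftrightarrow>
     (\<forall>t\<in>{0..<1}. (f \<longlongrightarrow> f t) (at_right t)) \<and>
     (\<forall>t\<in>{0<..1}. \<exists>l. (f \<longlongrightarrow> l) (at_left t))"

lemma cadlag_cong:
  assumes "\<And>t. t \<in> {0..1} \<Longrightarrow> f t = g t"
  shows "cadlag f \<longleftrightarrow> cadlag g"
proof -
  have 1: "(f \<longlongrightarrow> f t) (at_right t) \<longleftrightarrow> (g \<longlongrightarrow> g t) (at_right t)" if "t \<in> {0..<1}" for t
  proof -
    have "\<forall>\<^sub>F s in at_right t. f s = g s"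
      using that assms by (auto simp: eventually_at_right[of t 1] intro!: exI[of _ 1])
    moreover have "f t = g t" using that assms by auto
    ultimately show ?thesis using tendsto_cong by metis
  qed
  have 2: "(f \<longlongrightarrow> l) (at_left t) \<longleftrightarrow> (g \<longlongrightarrow> l) (at_left t)" if "t \<in> {0<..1}" for t l
  proof -
    have "\<forall>\<^sub>F s in at_left t. f s = g s"
      using that assms by (auto simp: eventually_at_left[of 0 t] intro!: exI[of _ 0])
    then show ?thesis by (rule tendsto_cong)
  qed
  show ?thesis unfolding cadlag_def using 1 2 by auto
qed

text \<open>Paths are normalised to vanish outside the unit interval, so that equality of elements of
  the type is equality of functions on \<open>[0,1]\<close>.\<close>

typedef skorokhod = "{f :: real \<Rightarrow> real. cadlag f \<and> (\<forall>t. t \<notin> {0..1} \<longrightarrow> f t = 0)}"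
  morphisms traj Abs_skorokhod
proof
  show "(\<lambda>_. 0) \<in> {f :: real \<Rightarrow> real. cadlag f \<and> (\<forall>t. t \<notin> {0..1} \<longrightarrow> f t = 0)}"
    by (auto simp: cadlag_def)
qed

definition to_skorokhod :: "(real \<Rightarrow> real) \<Rightarrow> skorokhod" where
  "to_skorokhod f = Abs_skorokhod (\<lambda>t. if t \<in> {0..1} then f t else 0)"

lemma traj_to_skorokhod:
  assumes "cadlag f"
  shows "traj (to_skorokhod f) t = (if t \<in> {0..1} then f t else 0)"
proof -
  have "cadlag (\<lambda>t. if t \<in> {0..1} then f t else 0)"
    by (rule cadlag_cong[THEN iffD1, OF _ assms]) auto
  then show ?thesis
    unfolding to_skorokhod_def by (subst Abs_skorokhod_inverse) auto
qed

lemma cadlag_traj: "cadlag (traj x)"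
  using traj[of x] by auto

lemma skorokhod_eqI:
  assumes "\<And>t. t \<in> {0..1} \<Longrightarrow> traj x t = traj y t"
  shows "x = y"
proof -
  have "traj x t = traj y t" for t
    using traj[of x] traj[of y] assms by (cases "t \<in> {0..1}") auto
  then show ?thesis by (metis ext traj_inject)
qed

lemma cadlag_local:
  assumes "cadlag f" "e > 0" "t \<in> {0..1}"
  shows "\<exists>d>0. \<exists>l. (\<forall>s\<in>{0..1}. t \<le> s \<and> s < t + d \<longrightarrow> \<bar>f s - f t\<bar> < e) \<and>
                  (\<forall>s\<in>{0..1}. t - d < s \<and> s < t \<longrightarrow> \<bar>f s - l\<bar> < e)"
proof -
  have R: "\<exists>d>0. \<forall>s\<in>{0..1}. t \<le> s \<and> s < t + d \<longrightarrow> \<bar>f s - f t\<bar> < e"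
  proof (cases "t < 1")
    case True
    then have "(f \<longlongrightarrow> f t) (at_right t)" using assms by (auto simp: cadlag_def)
    then have "\<forall>\<^sub>F s in at_right t. dist (f s) (f t) < e" using assms(2) by (rule tendstoD)
    then obtain b where b: "b > t" "\<And>s. t < s \<Longrightarrow> s < b \<Longrightarrow> dist (f s) (f t) < e"
      by (auto simp: eventually_at_right[OF True])
    have "\<bar>f s - f t\<bar> < e" if "t \<le> s" "s < b" for s
      using b(2)[of s] that assms(2) by (cases "s = t") (auto simp: dist_real_def)
    with b(1) show ?thesis by (intro exI[of _ "b - t"]) auto
  next
    case False
    then show ?thesis using assms by (intro exI[of _ 1]) force
  qed
  have L: "\<exists>d>0. \<exists>l. \<forall>s\<in>{0..1}. t - d < s \<and> s < t \<longrightarrow> \<bar>f s - l\<bar> < e"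
  proof (cases "0 < t")
    case True
    then have "t \<in> {0<..1}" using assms by auto
    then obtain l where "(f \<longlongrightarrow> l) (at_left t)" using assms(1) unfolding cadlag_def by blast
    then have "\<forall>\<^sub>F s in at_left t. dist (f s) l < e" using assms(2) by (rule tendstoD)
    then obtain b where b: "b < t" "\<And>s. b < s \<Longrightarrow> s < t \<Longrightarrow> dist (f s) l < e"
      by (auto simp: eventually_at_left[OF True])
    then show ?thesis by (intro exI[of _ "t - b"] conjI exI[of _ l]) (auto simp: dist_real_def)
  next
    case False
    then show ?thesis using assms by (intro exI[of _ 1]) force
  qed
  from R L obtain d1 d2 l where "d1 > 0" "d2 > 0"
    "\<forall>s\<in>{0..1}. t \<le> s \<and> s < t + d1 \<longrightarrow> \<bar>f s - f t\<bar> < e"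
    "\<forall>s\<in>{0..1}. t - d2 < s \<and> s < t \<longrightarrow> \<bar>f s - l\<bar> < e" by blast
  then show ?thesis by (intro exI[of _ "min d1 d2"] conjI exI[of _ l]) auto
qed

lemma cadlag_bounded:
  assumes "cadlag f"
  shows "\<exists>B. \<forall>t\<in>{0..1}. \<bar>f t\<bar> \<le> B"
proof -
  define P where "P = (\<lambda>a b::real. \<exists>B. \<forall>t\<in>{a..b} \<inter> {0..1}. \<bar>f t\<bar> \<le> B)"
  have "(0::real) \<le> 1" by simp
  then have "P 0 1"
  proof (induction rule: Bolzano)
    case (trans a b c)
    then obtain B1 B2 where B: "\<forall>t\<in>{a..b} \<inter> {0..1}. \<bar>f t\<bar> \<le> B1" "\<forall>t\<in>{b..c} \<inter> {0..1}. \<bar>f t\<bar> \<le> B2"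
      unfolding P_def by blast
    have "\<bar>f t\<bar> \<le> max B1 B2" if "t \<in> {a..c} \<inter> {0..1}" for t
      using B that by (cases "t \<le> b") (force simp: le_max_iff_disj)+
    then show ?case unfolding P_def by blast
  next
    case (local x)
    then obtain d l where d: "d > 0"
      "\<forall>s\<in>{0..1}. x \<le> s \<and> s < x + d \<longrightarrow> \<bar>f s - f x\<bar> < 1"
      "\<forall>s\<in>{0..1}. x - d < s \<and> s < x \<longrightarrow> \<bar>f s - l\<bar> < 1"
      using cadlag_local[OF assms, of 1 x] by auto
    have "P a b" if "a \<le> x" "x \<le> b" "b - a < d" for a b
      unfolding P_def
    proof (intro exI ballI)
      fix t assume t: "t \<in> {a..b} \<inter> {0..1}"
      show "\<bar>f t\<bar> \<le> \<bar>f x\<bar> + \<bar>l\<bar> + 1"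
      proof (cases "x \<le> t")
        case True
        then have "\<bar>f t - f x\<bar> < 1" using d t that by auto
        then show ?thesis by linarith
      next
        case False
        then have "\<bar>f t - l\<bar> < 1" using d t that by auto
        then show ?thesis by linarith
      qed
    qed
    with d(1) show ?case by blast
  qed
  then show ?thesis by (auto simp: P_def)
qed

definition time_changes :: "(real \<Rightarrow> real) set" where
  "time_changes = {\<tau>. strict_mono_on {0..1} \<tau> \<and> continuous_on {0..1} \<tau> \<and> bij_betw \<tau> {0..1} {0..1}}"

definition sup_dist :: "(real \<Rightarrow> real) \<Rightarrow> (real \<Rightarrow> real) \<Rightarrow> real" where
  "sup_dist f g = (SUP t\<in>{0..1}. \<bar>f t - g t\<bar>)"

lemma sup_dist_le:
  assumes "\<And>t. t \<in> {0..1} \<Longrightarrow> \<bar>f t - g t\<bar> \<le> e"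
  shows "sup_dist f g \<le> e"
  unfolding sup_dist_def using assms by (intro cSUP_least) auto

lemma sup_dist_upper:
  assumes "\<And>t. t \<in> {0..1} \<Longrightarrow> \<bar>f t - g t\<bar> \<le> B" "t \<in> {0..1}"
  shows "\<bar>f t - g t\<bar> \<le> sup_dist f g"
  unfolding sup_dist_def using assms by (intro cSUP_upper bdd_aboveI2[of _ _ B]) auto

lemma time_changes_range: "\<tau> \<in> time_changes \<Longrightarrow> t \<in> {0..1} \<Longrightarrow> \<tau> t \<in> {0..1}"
  by (auto simp: time_changes_def bij_betw_def)

lemma time_changes_one:
  assumes "\<tau> \<in> time_changes"
  shows "\<tau> 1 = 1"
proof -
  from assms have "1 \<in> \<tau> ` {0..1}" by (auto simp: time_changes_def bij_betw_def)
  then obtain s where s: "s \<in> {0..1}" "\<tau> s = 1" by auto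
  have "mono_on {0..1} \<tau>" using assms by (auto simp: time_changes_def strict_mono_on_imp_mono_on)
  then have "\<tau> s \<le> \<tau> 1" using s by (intro mono_onD[of "{0..1}" \<tau>]) auto
  with s time_changes_range[OF assms, of 1] show ?thesis by auto
qed

lemma id_time_changes: "(\<lambda>t. t) \<in> time_changes"
  by (auto simp: time_changes_def strict_mono_on_ident bij_betw_def)

lemma comp_inv_time_changes:
  assumes "\<tau> \<in> time_changes" "\<mu> \<in> time_changes"
  shows "(\<lambda>t. \<tau> (inv_into {0..1} \<mu> t)) \<in> time_changes"
proof -
  let ?i = "inv_into {0..1} \<mu>"
  from assms(2) have m: "strict_mono_on {0..1} \<mu>" "continuous_on {0..1} \<mu>" "bij_betw \<mu> {0..1} {0..1}"
    by (auto simp: time_changes_def)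
  have ib: "bij_betw ?i {0..1} {0..1}" using m(3) by (rule bij_betw_inv_into)
  have img: "\<mu> ` {0..1} = {0..1}" using m(3) by (simp add: bij_betw_def)
  have ic: "continuous_on {0..1} ?i"
    using continuous_on_inv[OF m(2), of ?i] m(3) img by (auto simp: bij_betw_def)
  have im: "?i s < ?i t" if "s \<in> {0..1}" "t \<in> {0..1}" "s < t" for s t
  proof (rule ccontr)
    assume "\<not> ?i s < ?i t"
    then have "?i t \<le> ?i s" by simp
    moreover have "?i s \<in> {0..1}" "?i t \<in> {0..1}" using ib that by (auto dest: bij_betwE)
    ultimately have "\<mu> (?i t) \<le> \<mu> (?i s)"
      using strict_mono_on_imp_mono_on[OF m(1)] by (auto simp: mono_on_def)
    then show False using that f_inv_into_f[of _ \<mu> "{0..1}"] img by auto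
  qed
  from assms(1) have l: "strict_mono_on {0..1} \<tau>" "continuous_on {0..1} \<tau>" "bij_betw \<tau> {0..1} {0..1}"
    by (auto simp: time_changes_def)
  have "strict_mono_on {0..1} (\<lambda>t. \<tau> (?i t))"
    using im l(1) bij_betwE[OF ib] by (auto intro!: strict_mono_onI elim!: strict_mono_onD)
  moreover have "continuous_on {0..1} (\<lambda>t. \<tau> (?i t))"
    using bij_betw_imp_surj_on[OF ib] by (intro continuous_on_compose2[OF l(2) ic]) auto
  moreover have "bij_betw (\<lambda>t. \<tau> (?i t)) {0..1} {0..1}"
    using bij_betw_trans[OF ib l(3)] by (simp add: comp_def)
  ultimately show ?thesis by (simp add: time_changes_def)
qed

instantiation skorokhod :: metric_space
begin

definition dist_skorokhod_def:
  "dist x y = (INF \<tau>\<in>time_changes. max (sup_dist \<tau> (\<lambda>t. t)) (sup_dist (traj x \<circ> \<tau>) (traj y)))"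

definition uniformity_skorokhod_def:
  "(uniformity :: (skorokhod \<times> skorokhod) filter) = (INF e\<in>{0<..}. principal {(x, y). dist x y < e})"

definition open_skorokhod_def:
  "open (U :: skorokhod set) \<longleftrightarrow> (\<forall>x\<in>U. \<forall>\<^sub>F (x', y) in uniformity. x' = x \<longrightarrow> y \<in> U)"

lemma sup_dist_nonneg_time:
  assumes "\<tau> \<in> time_changes"
  shows "0 \<le> sup_dist \<tau> (\<lambda>t. t)"
proof -
  have "\<bar>\<tau> 0 - 0\<bar> \<le> sup_dist \<tau> (\<lambda>t. t)"
    using time_changes_range[OF assms] by (intro sup_dist_upper[where B = 2]) force+
  then show ?thesis by linarith
qed

lemma dist_skorokhod_le:
  assumes "\<tau> \<in> time_changes" "\<And>t. t \<in> {0..1} \<Longrightarrow> \<bar>\<tau> t - t\<bar> \<le> e"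
    "\<And>t. t \<in> {0..1} \<Longrightarrow> \<bar>traj x (\<tau> t) - traj y t\<bar> \<le> e"
  shows "dist x y \<le> e"
proof -
  have "dist x y \<le> max (sup_dist \<tau> (\<lambda>t. t)) (sup_dist (traj x \<circ> \<tau>) (traj y))"
    unfolding dist_skorokhod_def
    by (intro cINF_lower assms bdd_belowI2[of _ 0]) (auto intro: sup_dist_nonneg_time simp: le_max_iff_disj)
  also have "\<dots> \<le> e" using assms(2,3) by (auto intro!: sup_dist_le)
  finally show ?thesis .
qed

lemma dist_skorokhod_less:
  assumes "dist x y < e"
  obtains \<tau> where "\<tau> \<in> time_changes" "\<And>t. t \<in> {0..1} \<Longrightarrow> \<bar>\<tau> t - t\<bar> < e"
    "\<And>t. t \<in> {0..1} \<Longrightarrow> \<bar>traj x (\<tau> t) - traj y t\<bar> < e"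
proof -
  from assms obtain \<tau> where l: "\<tau> \<in> time_changes"
    "max (sup_dist \<tau> (\<lambda>t. t)) (sup_dist (traj x \<circ> \<tau>) (traj y)) < e"
    unfolding dist_skorokhod_def using id_time_changes
    by (subst (asm) cINF_less_iff) (auto intro!: bdd_belowI2[of _ 0] intro: sup_dist_nonneg_time simp: le_max_iff_disj)
  obtain B1 B2 where B: "\<forall>t\<in>{0..1}. \<bar>traj x t\<bar> \<le> B1" "\<forall>t\<in>{0..1}. \<bar>traj y t\<bar> \<le> B2"
    using cadlag_bounded[OF cadlag_traj] by meson
  have "\<bar>\<tau> t - t\<bar> < e" if "t \<in> {0..1}" for t
  proof -
    have "\<bar>\<tau> t - t\<bar> \<le> sup_dist \<tau> (\<lambda>t. t)"
      using that time_changes_range[OF l(1)] by (intro sup_dist_upper[where B = 2]) force+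
    with l(2) show ?thesis by simp
  qed
  moreover have "\<bar>traj x (\<tau> t) - traj y t\<bar> < e" if "t \<in> {0..1}" for t
  proof -
    have "\<bar>(traj x \<circ> \<tau>) s - traj y s\<bar> \<le> B1 + B2" if "s \<in> {0..1}" for s
      using B(1)[rule_format, OF time_changes_range[OF l(1) that]] B(2)[rule_format, OF that]
      by simp
    then have "\<bar>(traj x \<circ> \<tau>) t - traj y t\<bar> \<le> sup_dist (traj x \<circ> \<tau>) (traj y)"
      using that by (rule sup_dist_upper)
    with l(2) show ?thesis by simp
  qed
  ultimately show ?thesis using that l(1) by blast
qed

instance
proof
  fix x y z :: skorokhod
  show "(uniformity :: (skorokhod \<times> skorokhod) filter) = (INF e\<in>{0<..}. principal {(x, y). dist x y < e})"
    by (fact uniformity_skorokhod_def)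
  show "open U = (\<forall>x\<in>U. \<forall>\<^sub>F (x', y) in uniformity. x' = x \<longrightarrow> y \<in> U)" for U :: "skorokhod set"
    by (fact open_skorokhod_def)
  show "dist x y = 0 \<longleftrightarrow> x = y"
  proof
    assume "x = y"
    have "0 \<le> dist x y"
      unfolding dist_skorokhod_def using id_time_changes
      by (intro cINF_greatest) (auto intro: sup_dist_nonneg_time simp: le_max_iff_disj)
    moreover have "dist x y \<le> 0"
      using \<open>x = y\<close> by (intro dist_skorokhod_le[OF id_time_changes]) auto
    ultimately show "dist x y = 0" by simp
  next
    assume *: "dist x y = 0"
    show "x = y"
    proof (rule skorokhod_eqI)
      fix t :: real assume t: "t \<in> {0..1}"
      have "\<bar>traj x t - traj y t\<bar> \<le> 3 * e" if "e > 0" for e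
      proof (cases "t = 1")
        case True
        obtain \<tau> where "\<tau> \<in> time_changes" "\<And>t. t \<in> {0..1} \<Longrightarrow> \<bar>traj x (\<tau> t) - traj y t\<bar> < e"
          using dist_skorokhod_less[of x y e] * \<open>e > 0\<close> by metis
        from this(1) this(2)[of 1] show ?thesis using True \<open>e > 0\<close> by (simp add: time_changes_one)
      next
        case False
        obtain d1 where d1: "d1 > 0" "\<forall>s\<in>{0..1}. t \<le> s \<and> s < t + d1 \<longrightarrow> \<bar>traj x s - traj x t\<bar> < e"
          using cadlag_local[OF cadlag_traj \<open>e > 0\<close> t] by metis
        obtain d2 where d2: "d2 > 0" "\<forall>s\<in>{0..1}. t \<le> s \<and> s < t + d2 \<longrightarrow> \<bar>traj y s - traj y t\<bar> < e"
          using cadlag_local[OF cadlag_traj \<open>e > 0\<close> t] by metis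
        define d where "d = min (1 - t) (min d1 d2)"
        have d: "d > 0" "d \<le> 1 - t" "d \<le> d1" "d \<le> d2" using d1 d2 t False by (auto simp: d_def)
        define s where "s = t + d / 2"
        have s: "s \<in> {0..1}" "t \<le> s" "s < t + d2" using d t by (auto simp: s_def)
        have "dist x y < min e (d / 4)" using * d \<open>e > 0\<close> by simp
        then obtain \<tau> where l: "\<tau> \<in> time_changes"
          "\<And>t. t \<in> {0..1} \<Longrightarrow> \<bar>\<tau> t - t\<bar> < min e (d / 4)"
          "\<And>t. t \<in> {0..1} \<Longrightarrow> \<bar>traj x (\<tau> t) - traj y t\<bar> < min e (d / 4)"
          by (rule dist_skorokhod_less) blast
        have "t \<le> \<tau> s" "\<tau> s < t + d1" using l(2)[OF s(1)] d by (auto simp: s_def abs_if split: if_splits)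
        then have "\<bar>traj x (\<tau> s) - traj x t\<bar> < e" using d1 time_changes_range[OF l(1) s(1)] by auto
        moreover have "\<bar>traj y s - traj y t\<bar> < e" using d2 s by auto
        moreover have "\<bar>traj x (\<tau> s) - traj y s\<bar> < e" using l(3)[OF s(1)] by simp
        ultimately show ?thesis by linarith
      qed
      from this[of "\<bar>traj x t - traj y t\<bar> / 4"] show "traj x t = traj y t" by (cases "traj x t = traj y t") auto
    qed
  qed
  show "dist x y \<le> dist x z + dist y z"
  proof (rule field_le_epsilon)
    fix e :: real assume "e > 0"
    have "dist x z < dist x z + e / 2" "dist y z < dist y z + e / 2" using \<open>e > 0\<close> by auto
    obtain \<tau> where l: "\<tau> \<in> time_changes" "\<And>t. t \<in> {0..1} \<Longrightarrow> \<bar>\<tau> t - t\<bar> < dist x z + e / 2"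
      "\<And>t. t \<in> {0..1} \<Longrightarrow> \<bar>traj x (\<tau> t) - traj z t\<bar> < dist x z + e / 2"
      using dist_skorokhod_less[of x z "dist x z + e / 2"] \<open>e > 0\<close> by auto
    obtain \<mu> where m: "\<mu> \<in> time_changes" "\<And>t. t \<in> {0..1} \<Longrightarrow> \<bar>\<mu> t - t\<bar> < dist y z + e / 2"
      "\<And>t. t \<in> {0..1} \<Longrightarrow> \<bar>traj y (\<mu> t) - traj z t\<bar> < dist y z + e / 2"
      using dist_skorokhod_less[of y z "dist y z + e / 2"] \<open>e > 0\<close> by auto
    have img: "\<mu> ` {0..1} = {0..1}" using m(1) by (simp add: time_changes_def bij_betw_def)
    show "dist x y \<le> dist x z + dist y z + e"
    proof (rule dist_skorokhod_le[OF comp_inv_time_changes[OF l(1) m(1)]])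
      fix t :: real assume t: "t \<in> {0..1}"
      define s where "s = inv_into {0..1} \<mu> t"
      have s: "s \<in> {0..1}" "\<mu> s = t"
        using t img inv_into_into[of t \<mu> "{0..1}"] f_inv_into_f[of t \<mu> "{0..1}"] by (auto simp: s_def)
      show "\<bar>\<tau> (inv_into {0..1} \<mu> t) - t\<bar> \<le> dist x z + dist y z + e"
        using l(2)[OF s(1)] m(2)[OF s(1)] s(2) unfolding s_def[symmetric] by linarith
      show "\<bar>traj x (\<tau> (inv_into {0..1} \<mu> t)) - traj y t\<bar> \<le> dist x z + dist y z + e"
        using l(3)[OF s(1)] m(3)[OF s(1)] s(2) unfolding s_def[symmetric] by auto
    qed
  qed
qed

end

lemma cadlag_const: "cadlag (\<lambda>_. c)"
  by (auto simp: cadlag_def)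

lemma cadlag_add: "cadlag f \<Longrightarrow> cadlag g \<Longrightarrow> cadlag (\<lambda>t. f t + g t)"
  unfolding cadlag_def by (blast intro: tendsto_add)

lemma cadlag_cmult: "cadlag f \<Longrightarrow> cadlag (\<lambda>t. c * f t)"
  unfolding cadlag_def by (blast intro: tendsto_mult_left)

lemma cadlag_sum: "(\<And>i. i \<in> I \<Longrightarrow> cadlag (f i)) \<Longrightarrow> cadlag (\<lambda>t. \<Sum>i\<in>I. f i t)"
  by (induction I rule: infinite_finite_induct) (auto intro: cadlag_const cadlag_add)

lemma cadlag_indicator: "cadlag (indicator {u..1})"
proof -
  have "(indicator {u..1} \<longlongrightarrow> (indicator {u..1} t :: real)) (at_right t)" if "t \<in> {0..<1}" for t
  proof (rule tendsto_eventually)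
    have "\<forall>s>t. s < (if u \<le> t then 1 else min u 1) \<longrightarrow> (indicator {u..1} s :: real) = indicator {u..1} t"
      using that by (auto simp: indicator_def)
    moreover have "(if u \<le> t then 1 else min u 1) > t" using that by auto
    ultimately show "\<forall>\<^sub>F s in at_right t. (indicator {u..1} s :: real) = indicator {u..1} t"
      using that by (subst eventually_at_right[of t 1]) auto
  qed
  moreover have "(indicator {u..1} \<longlongrightarrow> (if u < t then 1 else 0 :: real)) (at_left t)"
    if "t \<in> {0<..1}" for t
  proof (rule tendsto_eventually)
    have "\<forall>s>(if u < t then u else 0). s < t \<longrightarrow> (indicator {u..1} s :: real) = (if u < t then 1 else 0)"
      using that by (auto simp: indicator_def)
    moreover have "(if u < t then u else 0) < t" using that by auto
    ultimately show "\<forall>\<^sub>F s in at_left t. (indicator {u..1} s :: real) = (if u < t then 1 else 0)"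
      using that by (subst eventually_at_left[of 0 t]) auto
  qed
  ultimately show ?thesis unfolding cadlag_def by blast
qed

text \<open>The infima are taken in the extended reals, so that \<open>inf {} = \<infinity>\<close>.\<close>

definition bounded_away :: "skorokhod set \<Rightarrow> skorokhod set \<Rightarrow> bool" where
  "bounded_away A S \<longleftrightarrow> 0 < (INF x\<in>A. INF y\<in>S. ereal (dist x y))"

definition jump :: "skorokhod \<Rightarrow> real \<Rightarrow> real" where
  "jump x t = traj x t - Lim (at_left t) (traj x)"

lemma finite_large_jumps:
  assumes "\<gamma> > 0"
  shows "finite {t \<in> {0<..1}. jump x t > \<gamma>}"
proof -
  define P where "P = (\<lambda>a b::real. finite {t \<in> {a..b} \<inter> {0<..1}. jump x t > \<gamma>})"
  have "(0::real) \<le> 1" by simp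
  then have "P 0 1"
  proof (induction rule: Bolzano)
    case (trans a b c)
    have "{t \<in> {a..c} \<inter> {0<..1}. jump x t > \<gamma>} \<subseteq>
        {t \<in> {a..b} \<inter> {0<..1}. jump x t > \<gamma>} \<union> {t \<in> {b..c} \<inter> {0<..1}. jump x t > \<gamma>}" by auto
    moreover have "finite ({t \<in> {a..b} \<inter> {0<..1}. jump x t > \<gamma>} \<union> {t \<in> {b..c} \<inter> {0<..1}. jump x t > \<gamma>})"
      using trans(1,2) unfolding P_def by (rule finite_UnI)
    ultimately show ?case unfolding P_def by (rule finite_subset)
  next
    case (local r)
    then have "r \<in> {0..1}" by simp
    then obtain d l where d: "d > 0"
      "\<forall>s\<in>{0..1}. r \<le> s \<and> s < r + d \<longrightarrow> \<bar>traj x s - traj x r\<bar> < \<gamma> / 2"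
      "\<forall>s\<in>{0..1}. r - d < s \<and> s < r \<longrightarrow> \<bar>traj x s - l\<bar> < \<gamma> / 2"
      using cadlag_local[OF cadlag_traj half_gt_zero[OF assms], of r x] by metis
    have small: "jump x t \<le> \<gamma>"
      if "t \<in> {0<..1}" "a < t" "0 \<le> a" "\<forall>s. a < s \<and> s \<le> t \<longrightarrow> \<bar>traj x s - c\<bar> < \<gamma> / 2" for t a c
    proof -
      have "\<forall>t\<in>{0<..1}. \<exists>k. (traj x \<longlongrightarrow> k) (at_left t)"
        using cadlag_traj[of x, unfolded cadlag_def] by (rule conjunct2)
      from bspec[OF this that(1)] obtain k where k: "(traj x \<longlongrightarrow> k) (at_left t)" ..
      have "\<forall>s>a. s < t \<longrightarrow> c - \<gamma> / 2 \<le> traj x s"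
      proof (intro allI impI)
        fix s assume "a < s" "s < t"
        then have "\<bar>traj x s - c\<bar> < \<gamma> / 2" using that(4) by simp
        then show "c - \<gamma> / 2 \<le> traj x s" by linarith
      qed
      then have "\<forall>\<^sub>F s in at_left t. c - \<gamma> / 2 \<le> traj x s"
        using that(2) by (subst eventually_at_left[of a t]) blast+
      then have "c - \<gamma> / 2 \<le> k"
        by (rule tendsto_lowerbound[OF k]) simp
      moreover have "jump x t = traj x t - k"
        unfolding jump_def using tendsto_Lim[OF _ k] by simp
      moreover have "\<bar>traj x t - c\<bar> < \<gamma> / 2" using that by auto
      ultimately show ?thesis by linarith
    qed
    have "P a b" if ab: "a \<le> r" "r \<le> b" "b - a < d" for a b
    proof -
      have le: "jump x t \<le> \<gamma>" if t: "t \<in> {a..b} \<inter> {0<..1}" "t \<noteq> r" for t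
      proof (cases "r < t")
        case True
        show ?thesis
        proof (rule small[of t r "traj x r"])
          show "\<forall>s. r < s \<and> s \<le> t \<longrightarrow> \<bar>traj x s - traj x r\<bar> < \<gamma> / 2"
          proof (intro allI impI)
            fix s assume "r < s \<and> s \<le> t"
            then have "s \<in> {0..1}" "r \<le> s" "s < r + d" using t ab \<open>r \<in> {0..1}\<close> by auto
            then show "\<bar>traj x s - traj x r\<bar> < \<gamma> / 2" using d(2) by blast
          qed
        qed (use t True \<open>r \<in> {0..1}\<close> in auto)
      next
        case False
        with t have "t < r" by simp
        show ?thesis
        proof (rule small[of t "max 0 (r - d)" l])
          show "\<forall>s. max 0 (r - d) < s \<and> s \<le> t \<longrightarrow> \<bar>traj x s - l\<bar> < \<gamma> / 2"
          proof (intro allI impI)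
            fix s assume "max 0 (r - d) < s \<and> s \<le> t"
            then have "s \<in> {0..1}" "r - d < s" "s < r" using \<open>t < r\<close> t by auto
            then show "\<bar>traj x s - l\<bar> < \<gamma> / 2" using d(3) by blast
          qed
          show "max 0 (r - d) < t" using t ab by auto
        qed (use t in auto)
      qed
      have "{t \<in> {a..b} \<inter> {0<..1}. jump x t > \<gamma>} \<subseteq> {r}"
      proof
        fix t assume "t \<in> {t \<in> {a..b} \<inter> {0<..1}. jump x t > \<gamma>}"
        then show "t \<in> {r}" using le[of t] by (cases "t = r") auto
      qed
      then show ?thesis unfolding P_def by (rule finite_subset) simp
    qed
    with d(1) show ?case by blast
  qed
  moreover have "{t \<in> {0..1} \<inter> {0<..1}. jump x t > \<gamma>} = {t \<in> {0<..1}. jump x t > \<gamma>}" by auto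
  ultimately show ?thesis by (simp add: P_def)
qed

text \<open>A path has no jump at time \<open>0\<close> (the convention \<open>\<xi>(0-) = \<xi>(0)\<close>).  The cardinalities
  below are those of finite sets, by \<open>finite_large_jumps\<close> and \<open>step_path_finite_jumps\<close>.\<close>

definition many_large_jumps :: "real \<Rightarrow> nat \<Rightarrow> skorokhod set" where
  "many_large_jumps \<gamma> l = {x. l \<le> card {t \<in> {0<..1}. jump x t > \<gamma>}}"

text \<open>Step paths are constant between consecutive points of a finite set of times.\<close>

definition step_path :: "skorokhod \<Rightarrow> bool" where
  "step_path x \<longleftrightarrow>
     (\<exists>F. finite F \<and> (\<forall>s t. 0 \<le> s \<and> s < t \<and> t \<le> 1 \<and> {s<..t} \<inter> F = {} \<longrightarrow> traj x s = traj x t))"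

definition step_paths :: "nat \<Rightarrow> skorokhod set" where
  "step_paths l =
     {x. mono_on {0..1} (traj x) \<and> step_path x \<and> traj x 0 = 0 \<and> card {t \<in> {0<..1}. jump x t \<noteq> 0} = l}"

lemma step_path_finite_jumps:
  assumes "step_path x"
  shows "finite {t \<in> {0<..1}. jump x t \<noteq> 0}"
proof -
  obtain F where F: "finite F"
    "\<And>s t. 0 \<le> s \<Longrightarrow> s < t \<Longrightarrow> t \<le> 1 \<Longrightarrow> {s<..t} \<inter> F = {} \<Longrightarrow> traj x s = traj x t"
    using assms unfolding step_path_def by blast
  have "jump x t = 0" if t: "t \<in> {0<..1}" "t \<notin> F" for t
  proof -
    define a where "a = Max (insert 0 (F \<inter> {..<t}))"
    have a: "0 \<le> a" "a < t" "\<And>s. s \<in> F \<Longrightarrow> s < t \<Longrightarrow> s \<le> a"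
      using F(1) t by (auto simp: a_def)
    have "\<forall>s. a < s \<and> s < t \<longrightarrow> traj x s = traj x t"
    proof (intro allI impI)
      fix s assume s: "a < s \<and> s < t"
      have "{s<..t} \<inter> F = {}"
      proof (rule ccontr)
        assume "{s<..t} \<inter> F \<noteq> {}"
        then obtain q where "q \<in> F" "s < q" "q \<le> t" by auto
        moreover from this t have "q < t" by (cases "q = t") auto
        ultimately show False using a(3)[of q] s by simp
      qed
      moreover have "0 \<le> s" "t \<le> 1" using s a(1) t by auto
      ultimately show "traj x s = traj x t" using F(2)[of s t] s by blast
    qed
    then have "\<forall>\<^sub>F s in at_left t. traj x s = traj x t"
      using a by (subst eventually_at_left[of a t]) auto
    then have "(traj x \<longlongrightarrow> traj x t) (at_left t)" by (rule tendsto_eventually)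
    then have "Lim (at_left t) (traj x) = traj x t" by (intro tendsto_Lim) auto
    then show ?thesis by (simp add: jump_def)
  qed
  then have "{t \<in> {0<..1}. jump x t \<noteq> 0} \<subseteq> F" by blast
  then show ?thesis using F(1) by (rule finite_subset)
qed

section \<open>The limit measures\<close>

text \<open>The measure on the positive half-line with tail \<open>x\<^sup>-\<^sup>\<beta>\<close>; the lemma below identifies it.\<close>

definition nu :: "real \<Rightarrow> real measure" where
  "nu \<beta> = density lborel (\<lambda>x. ennreal (\<beta> * x powr (-\<beta> - 1)) * indicator {0<..} x)"

lemma sets_nu [simp, measurable_cong]: "sets (nu \<beta>) = sets borel"
  by (simp add: nu_def)

lemma emeasure_nu_greaterThan:
  assumes "\<beta> > 0" "x > 0"
  shows "emeasure (nu \<beta>) {x<..} = ennreal (x powr (-\<beta>))"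
proof -
  have "emeasure (nu \<beta>) {x<..} =
      (\<integral>\<^sup>+y. ennreal (\<beta> * y powr (-\<beta> - 1)) * indicator {0<..} y * indicator {x<..} y \<partial>lborel)"
    unfolding nu_def by (subst emeasure_density) auto
  also have "\<dots> = (\<integral>\<^sup>+y. ennreal (\<beta> * y powr (-\<beta> - 1)) * indicator {x..} y \<partial>lborel)"
  proof (rule nn_integral_cong_AE)
    have "AE y in lborel. y \<noteq> x" by (rule AE_lborel_singleton)
    then show "AE y in lborel. ennreal (\<beta> * y powr (-\<beta> - 1)) * indicator {0<..} y * indicator {x<..} y =
        ennreal (\<beta> * y powr (-\<beta> - 1)) * indicator {x..} y"
    proof eventually_elim
      case (elim y)
      then show ?case using assms by (auto simp: indicator_def)
    qed
  qed
  also have "\<dots> = ennreal (0 - (- (x powr (-\<beta>))))"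
  proof (rule nn_integral_FTC_atLeast)
    show "DERIV (\<lambda>y. - (y powr (-\<beta>))) y :> \<beta> * y powr (-\<beta> - 1)" if "x \<le> y" for y
      using that assms by (auto intro!: derivative_eq_intros)
    have "((\<lambda>y. y powr (-\<beta>)) \<longlongrightarrow> 0) at_top"
      using assms by (intro tendsto_neg_powr filterlim_ident) auto
    then show "((\<lambda>y. - (y powr (-\<beta>))) \<longlongrightarrow> 0) at_top"
      using tendsto_minus by fastforce
  qed (use assms in auto)
  finally show ?thesis by simp
qed

lemma emeasure_nu_nonpos: "emeasure (nu \<beta>) {..0} = 0"
proof -
  have "emeasure (nu \<beta>) {..0} =
      (\<integral>\<^sup>+y. ennreal (\<beta> * y powr (-\<beta> - 1)) * indicator {0<..} y * indicator {..0} y \<partial>lborel)"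
    unfolding nu_def by (subst emeasure_density) auto
  also have "\<dots> = (\<integral>\<^sup>+(y::real). 0 \<partial>lborel)"
    by (intro nn_integral_cong) (auto simp: indicator_def)
  finally show ?thesis by simp
qed

definition nu_ordered :: "real \<Rightarrow> nat \<Rightarrow> (nat \<Rightarrow> real) measure" where
  "nu_ordered \<beta> l = restrict_space (\<Pi>\<^sub>M i\<in>{1..l}. nu \<beta>)
     {x. (\<forall>i\<in>{1..l}. 0 \<le> x i) \<and> (\<forall>i\<in>{1..<l}. x (Suc i) \<le> x i)}"

text \<open>The joint law of independent uniform times \<open>U\<^sub>1, \<dots>, U\<^sub>l\<close>.\<close>

definition uniform_times :: "nat \<Rightarrow> (nat \<Rightarrow> real) measure" where
  "uniform_times l = (\<Pi>\<^sub>M i\<in>{1..l}. uniform_measure lborel {0..1})"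

definition step_sum :: "nat \<Rightarrow> (nat \<Rightarrow> real) \<Rightarrow> (nat \<Rightarrow> real) \<Rightarrow> skorokhod" where
  "step_sum l y u = to_skorokhod (\<lambda>t. \<Sum>i=1..l. y i * indicator {u i..1} t)"

lemma traj_step_sum:
  assumes "t \<in> {0..1}"
  shows "traj (step_sum l y u) t = (\<Sum>i=1..l. y i * indicator {u i..1} t)"
proof -
  have "cadlag (\<lambda>t. \<Sum>i=1..l. y i * indicator {u i..1} t)"
    by (intro cadlag_sum cadlag_cmult cadlag_indicator)
  from traj_to_skorokhod[OF this, of t] show ?thesis
    using assms by (simp add: step_sum_def)
qed

definition limit_measure :: "real \<Rightarrow> nat \<Rightarrow> skorokhod set \<Rightarrow> ennreal" where
  "limit_measure \<beta> l E =
     (if l = 0 then emeasure (return borel (to_skorokhod (\<lambda>_. 0))) E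
      else (\<integral>\<^sup>+u. emeasure (nu_ordered \<beta> l)
              {y \<in> space (nu_ordered \<beta> l). (\<forall>i\<in>{1..l}. 0 < y i) \<and> step_sum l y u \<in> E}
            \<partial>uniform_times l))"

section \<open>The compensated compound Poisson process\<close>

definition regularly_varying :: "(real \<Rightarrow> real) \<Rightarrow> real \<Rightarrow> bool" where
  "regularly_varying f \<rho> \<longleftrightarrow>
     f \<in> borel_measurable borel \<and> (\<forall>\<^sub>F x in at_top. 0 < f x) \<and>
     (\<forall>c>0. ((\<lambda>x. f (c * x) / f x) \<longlongrightarrow> c powr \<rho>) at_top)"

definition poisson_process :: "'a measure \<Rightarrow> real \<Rightarrow> (real \<Rightarrow> 'a \<Rightarrow> nat) \<Rightarrow> bool" where
  "poisson_process M r N \<longleftrightarrow>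
     0 < r \<and>
     (\<forall>t\<ge>0. N t \<in> measurable M (count_space UNIV)) \<and>
     (\<forall>\<omega>\<in>space M. N 0 \<omega> = 0 \<and> mono_on {0..} (\<lambda>t. N t \<omega>) \<and>
        (\<forall>t\<ge>0. continuous (at_right t) (\<lambda>t. real (N t \<omega>)))) \<and>
     (\<forall>s t. 0 \<le> s \<and> s < t \<longrightarrow>
        distr M (count_space UNIV) (\<lambda>\<omega>. N t \<omega> - N s \<omega>) = measure_pmf (poisson_pmf (r * (t - s)))) \<and>
     (\<forall>k (\<tau> :: nat \<Rightarrow> real). 0 \<le> \<tau> 0 \<and> (\<forall>i<k. \<tau> i \<le> \<tau> (Suc i)) \<longrightarrow>
        prob_space.indep_vars M (\<lambda>_. count_space UNIV)
          (\<lambda>i \<omega>. N (\<tau> (Suc i)) \<omega> - N (\<tau> i) \<omega>) {..<k})"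

definition compensated_process ::
  "'a measure \<Rightarrow> real \<Rightarrow> (real \<Rightarrow> 'a \<Rightarrow> nat) \<Rightarrow> (nat \<Rightarrow> 'a \<Rightarrow> real) \<Rightarrow> real \<Rightarrow> 'a \<Rightarrow> real" where
  "compensated_process M r N W t \<omega> = (\<Sum>k=1..N t \<omega>. W k \<omega>) - r * t * (\<integral>\<omega>. W 1 \<omega> \<partial>M)"

definition scaled_process :: "(real \<Rightarrow> 'a \<Rightarrow> real) \<Rightarrow> nat \<Rightarrow> 'a \<Rightarrow> skorokhod" where
  "scaled_process X n \<omega> = to_skorokhod (\<lambda>t. X (real n * t) \<omega> / real n)"

lemma cadlag_counting:
  fixes g :: "real \<Rightarrow> nat" and h :: "nat \<Rightarrow> real"
  assumes "mono_on {0..} g" "\<And>t. t \<ge> 0 \<Longrightarrow> continuous (at_right t) (\<lambda>t. real (g t))" "c > 0"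
  shows "cadlag (\<lambda>t. h (g (c * t)))"
proof -
  have "((\<lambda>t. h (g (c * t))) \<longlongrightarrow> h (g (c * t))) (at_right t)" if t: "t \<in> {0..<1}" for t
  proof (rule tendsto_eventually)
    have "((\<lambda>s. real (g s)) \<longlongrightarrow> real (g (c * t))) (at_right (c * t))"
      using assms(2)[of "c * t"] t assms(3) by (simp add: continuous_within)
    then have "\<forall>\<^sub>F s in at_right (c * t). dist (real (g s)) (real (g (c * t))) < 1"
      by (rule tendstoD) simp
    then obtain b where b: "b > c * t" "\<forall>s>c * t. s < b \<longrightarrow> dist (real (g s)) (real (g (c * t))) < 1"
      by (subst (asm) eventually_at_right[of "c * t" "c * t + 1"]) auto
    have "g (c * s) = g (c * t)" if "t < s" "s < b / c" for s
    proof -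
      have "c * t < c * s" "c * s < b" using that assms(3) by (auto simp: field_simps)
      then have "dist (real (g (c * s))) (real (g (c * t))) < 1" using b by blast
      then show ?thesis by (auto simp: dist_real_def)
    qed
    moreover have "b / c > t" using b assms(3) by (simp add: field_simps)
    ultimately show "\<forall>\<^sub>F s in at_right t. h (g (c * s)) = h (g (c * t))"
      by (subst eventually_at_right[of t "t + 1"]) auto
  qed
  moreover have "\<exists>l. ((\<lambda>t. h (g (c * t))) \<longlongrightarrow> l) (at_left t)" if t: "t \<in> {0<..1}" for t
  proof -
    let ?S = "(\<lambda>s. g (c * s)) ` {0..<t}"
    have mono: "g (c * s) \<le> g (c * s')" if "0 \<le> s" "s \<le> s'" for s s'
      using that assms(3) by (intro mono_onD[OF assms(1)]) auto
    have "?S \<subseteq> {..g (c * t)}" using mono by auto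
    then have fin: "finite ?S" by (rule finite_subset) simp
    moreover have "?S \<noteq> {}" using t by auto
    ultimately have "Max ?S \<in> ?S" by (rule Max_in)
    then obtain s0 where s0: "0 \<le> s0" "s0 < t" "g (c * s0) = Max ?S" by auto
    have "g (c * s) = g (c * s0)" if "s0 < s" "s < t" for s
    proof (rule antisym)
      show "g (c * s) \<le> g (c * s0)" unfolding s0(3) using fin s0 that by (intro Max_ge) auto
      show "g (c * s0) \<le> g (c * s)" using s0 that by (intro mono) auto
    qed
    then have "\<forall>\<^sub>F s in at_left t. h (g (c * s)) = h (g (c * s0))"
      using s0 by (subst eventually_at_left[of s0 t]) auto
    then have "((\<lambda>t. h (g (c * t))) \<longlongrightarrow> h (g (c * s0))) (at_left t)" by (rule tendsto_eventually)
    then show ?thesis by blast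
  qed
  ultimately show ?thesis unfolding cadlag_def by blast
qed

lemma traj_scaled_process:
  assumes "poisson_process M r N" "\<omega> \<in> space M" "n > 0" "t \<in> {0..1}"
  shows "traj (scaled_process (compensated_process M r N W) n \<omega>) t =
    compensated_process M r N W (real n * t) \<omega> / real n"
proof -
  have N: "mono_on {0..} (\<lambda>t. N t \<omega>)" "\<And>t. t \<ge> 0 \<Longrightarrow> continuous (at_right t) (\<lambda>t. real (N t \<omega>))"
    using assms(1,2) unfolding poisson_process_def by auto
  have lin: "cadlag (\<lambda>t. a * t)" for a :: real
    by (auto simp: cadlag_def intro!: tendsto_intros exI)
  have "cadlag (\<lambda>t. 1 / real n * ((\<Sum>k=1..N (real n * t) \<omega>. W k \<omega>) + (- r * real n * (\<integral>\<omega>. W 1 \<omega> \<partial>M)) * t))"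
    using assms(3)
    by (intro cadlag_cmult cadlag_add lin cadlag_counting[OF N, where h = "\<lambda>m. \<Sum>k=1..m. W k \<omega>"]) auto
  then have "cadlag (\<lambda>t. compensated_process M r N W (real n * t) \<omega> / real n)"
    by (simp add: compensated_process_def field_simps)
  then show ?thesis unfolding scaled_process_def using assms(4) by (simp add: traj_to_skorokhod)
qed

section \<open>The importance sampling scheme\<close>

definition mixture :: "real \<Rightarrow> 'a measure \<Rightarrow> 'a measure \<Rightarrow> 'a measure" where
  "mixture w P Q = measure_of (space P) (sets P)
     (\<lambda>E. ennreal w * emeasure P E + ennreal (1 - w) * emeasure Q E)"

lemma emeasure_mixture:
  assumes "sets Q = sets P" "E \<in> sets P"
  shows "emeasure (mixture w P Q) E = ennreal w * emeasure P E + ennreal (1 - w) * emeasure Q E"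
proof (rule emeasure_measure_of[OF mixture_def])
  show "countably_additive (sets (mixture w P Q))
      (\<lambda>E. ennreal w * emeasure P E + ennreal (1 - w) * emeasure Q E)"
    unfolding countably_additive_def
  proof (intro allI impI)
    fix F :: "nat \<Rightarrow> 'a set"
    assume F: "range F \<subseteq> sets (mixture w P Q)" "disjoint_family F" "\<Union> (range F) \<in> sets (mixture w P Q)"
    then have "range F \<subseteq> sets P" by (simp add: mixture_def)
    then show "(\<Sum>i. ennreal w * emeasure P (F i) + ennreal (1 - w) * emeasure Q (F i)) =
        ennreal w * emeasure P (\<Union> (range F)) + ennreal (1 - w) * emeasure Q (\<Union> (range F))"
      using F(2) assms(1) suminf_emeasure[of F P] suminf_emeasure[of F Q]
      by (simp add: suminf_add[symmetric] ennreal_suminf_cmult)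
  qed
qed (use assms in \<open>auto simp: positive_def mixture_def sets.space_closed\<close>)

definition is_estimator :: "real \<Rightarrow> 'a measure \<Rightarrow> 'a set \<Rightarrow> 'a set \<Rightarrow> 'a \<Rightarrow> real" where
  "is_estimator w P A B \<omega> = indicator A \<omega> / (w + (1 - w) / measure P B * indicator B \<omega>)"

end

theory Submission
  imports Defs "HOL-Real_Asymp.Real_Asymp"
begin

text \<open>Write \<open>f x = P(X(1) > x)\<close> and \<open>l = l\<^sup>*\<close>.  The likelihood ratio is at least \<open>w\<close> off \<open>B\<^sub>n\<close> and at
  least \<open>(1 - w) / P(B\<^sub>n)\<close> on \<open>B\<^sub>n\<close>, so the second moment of \<open>Z\<^sub>n\<close> is at most
  \<open>P(A\<^sub>n - B\<^sub>n) / w + P(B\<^sub>n)\<^sup>2 / (1 - w)\<^sup>2\<close>.  Three estimates suffice.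

  \<^item> \<open>P(B\<^sub>n) = O((n f(n))\<^sup>l)\<close>: a union bound over the \<open>l\<close>-subsets of the \<open>O(n)\<close> jumps.

  \<^item> \<open>P(A\<^sub>n - B\<^sub>n) = O(n\<^sup>-\<^sup>K)\<close> for any prescribed \<open>K\<close>, if \<open>\<gamma>\<close> is small: with fewer than \<open>l\<close> jumps above
    \<open>\<gamma>\<close> the path can be far from the step paths with fewer than \<open>l\<close> jumps only if the sum of the jumps
    truncated at \<open>n \<gamma>\<close> deviates linearly from its mean, which a Chernoff bound with parameter of order
    \<open>ln n / n\<close> excludes.  Since \<open>f\<close> decays polynomially, this is \<open>O((n f(n))\<^sup>2\<^sup>l)\<close>.

  \<^item> \<open>P(A\<^sub>n) \<ge> c (n f(n))\<^sup>l\<close>: the interior of \<open>A\<close> contains a step path with \<open>l\<close> distinct jump times in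
    \<open>(0,1)\<close>.  The number of arrivals is nearly linear in time, so it is enough that one jump with index
    in each of \<open>l\<close> disjoint windows of length of order \<open>n\<close> has nearly the right size while the
    remaining jumps behave; a time change then aligns the jump times.\<close>

section \<open>The Skorokhod topology\<close>

text \<open>Efficiency asks for bounds up to constants only, so every probability is compared with a
  power of \<open>n * f n\<close>, and the limit measure enters through its positivity, which
  produces one step path in the interior. Two obstacles shape the details. The hypothesis concerns
  the tail of X(1), whereas the estimates concern single jumps. By independence of N and W the tail
  of W is quickly bounded above by \<open>f\<close>, but the lower bound needs the mass of narrow
  windows, hence the converse fact that a large X(1) stems from one large jump. Moreover \<beta> may
  be below 2, so jumps may have infinite variance and the exponential inequality has to work with a
  moment of order q in (1,2]. Its correction term contains
  \<open>exp (\<theta> * n * \<gamma>)\<close>, a power of n when \<theta> is of order K ln n / n,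
  and is controlled only for \<gamma> of order 1/K; hence K is fixed before \<gamma>. Path
  properties are proved for a deterministic counting function and applied at a fixed \<omega>;
  simultaneous arrivals, which would merge jumps, are excluded almost surely.\<close>

text \<open>The identity is perturbed by tents of height \<open>v s - s\<close> and radius
  \<open>\<rho>\<close>. By the separation, each tent vanishes at the other points of
  \<open>F\<close> and at 0 and 1. The perturbation has Lipschitz constant at most
  \<open>card F * e / \<rho> < 1\<close>, so strict monotonicity survives. Tents may overlap, whence
  the factor \<open>card F\<close> in the bound.\<close>

lemma time_change_exists:
  fixes F :: "real set" and v :: "real \<Rightarrow> real"
  assumes F: "finite F" and rho: "\<rho> > 0"
    and sep: "\<And>s t. s \<in> F \<Longrightarrow> t \<in> F \<Longrightarrow> s \<noteq> t \<Longrightarrow> \<rho> \<le> \<bar>s - t\<bar>"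
    and ends: "\<And>s. s \<in> F \<Longrightarrow> \<rho> \<le> s \<and> s \<le> 1 - \<rho>"
    and near: "\<And>s. s \<in> F \<Longrightarrow> \<bar>v s - s\<bar> \<le> e"
    and small: "real (card F) * e < \<rho>"
  obtains \<tau> where "\<tau> \<in> time_changes" "\<And>s. s \<in> F \<Longrightarrow> \<tau> s = v s"
    "\<And>t. \<bar>\<tau> t - t\<bar> \<le> real (card F) * e"
proof -
  define hat where "hat = (\<lambda>s t::real. max 0 (1 - \<bar>t - s\<bar> / \<rho>))"
  define \<tau> where "\<tau> = (\<lambda>t. t + (\<Sum>s\<in>F. (v s - s) * hat s t))"
  have hat_le: "0 \<le> hat s t" "hat s t \<le> 1" for s t using rho by (auto simp: hat_def)
  have hat_self: "hat s s = 1" for s by (simp add: hat_def)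
  have hat_0: "hat s t = 0" if "\<rho> \<le> \<bar>t - s\<bar>" for s t
    using that rho by (auto simp: hat_def field_simps)
  have lip: "\<bar>hat s t - hat s t'\<bar> \<le> \<bar>t - t'\<bar> / \<rho>" for s t t'
  proof -
    have "\<bar>hat s t - hat s t'\<bar> \<le> \<bar>\<bar>t - s\<bar> / \<rho> - \<bar>t' - s\<bar> / \<rho>\<bar>" unfolding hat_def by linarith
    also have "\<dots> = \<bar>\<bar>t - s\<bar> - \<bar>t' - s\<bar>\<bar> / \<rho>" using rho
      by (metis abs_divide abs_of_pos diff_divide_distrib)
    also have "\<dots> \<le> \<bar>t - t'\<bar> / \<rho>" using rho by (intro divide_right_mono) linarith+
    finally show ?thesis .
  qed
  have at: "\<tau> s = v s" if "s \<in> F" for s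
  proof -
    have "(\<Sum>r\<in>F. (v r - r) * hat r s) = (\<Sum>r\<in>F. if r = s then v s - s else 0)"
      using sep that by (intro sum.cong) (auto simp: hat_self intro!: hat_0)
    then show ?thesis using that F by (simp add: \<tau>_def)
  qed
  have dev: "\<bar>\<tau> t - t\<bar> \<le> real (card F) * e" for t
  proof -
    have "\<bar>\<tau> t - t\<bar> \<le> (\<Sum>s\<in>F. \<bar>(v s - s) * hat s t\<bar>)" by (simp add: \<tau>_def sum_abs)
    also have "\<dots> \<le> (\<Sum>s\<in>F. e)"
    proof (intro sum_mono)
      fix s assume s: "s \<in> F"
      have "\<bar>v s - s\<bar> * \<bar>hat s t\<bar> \<le> e * 1"
        using near[OF s] hat_le[of s t] by (intro mult_mono) linarith+
      then show "\<bar>(v s - s) * hat s t\<bar> \<le> e" by (simp add: abs_mult)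
    qed
    finally show ?thesis by simp
  qed
  have less: "\<tau> t < \<tau> t'" if "t < t'" for t t'
  proof -
    have "\<bar>(\<Sum>s\<in>F. (v s - s) * hat s t') - (\<Sum>s\<in>F. (v s - s) * hat s t)\<bar>
        = \<bar>\<Sum>s\<in>F. (v s - s) * (hat s t' - hat s t)\<bar>"
      by (simp add: sum_subtractf right_diff_distrib)
    also have "\<dots> \<le> (\<Sum>s\<in>F. \<bar>(v s - s) * (hat s t' - hat s t)\<bar>)" by (rule sum_abs)
    also have "\<dots> \<le> (\<Sum>s\<in>F. e * ((t' - t) / \<rho>))"
    proof (intro sum_mono)
      fix s assume s: "s \<in> F"
      have "\<bar>v s - s\<bar> * \<bar>hat s t' - hat s t\<bar> \<le> e * ((t' - t) / \<rho>)"
        using near[OF s] lip[of s t' t] that by (intro mult_mono) auto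
      then show "\<bar>(v s - s) * (hat s t' - hat s t)\<bar> \<le> e * ((t' - t) / \<rho>)" by (simp add: abs_mult)
    qed
    also have "\<dots> = (real (card F) * e) * (t' - t) / \<rho>" by simp
    also have "\<dots> < \<rho> * (t' - t) / \<rho>"
      using small that rho by (intro divide_strict_right_mono mult_strict_right_mono) auto
    also have "\<dots> = t' - t" using rho by simp
    finally show ?thesis unfolding \<tau>_def by linarith
  qed
  have zero: "\<tau> 0 = 0" "\<tau> 1 = 1"
    unfolding \<tau>_def using ends rho by (auto intro!: sum.neutral hat_0)
      (smt (verit) ends hat_0)+
  have cont: "continuous_on {0..1} \<tau>"
    unfolding \<tau>_def hat_def using rho by (intro continuous_intros) auto
  have "\<tau> ` {0..1} = {0..1}"
  proof
    show "\<tau> ` {0..1} \<subseteq> {0..1}"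
    proof
      fix y assume "y \<in> \<tau> ` {0..1}"
      then obtain t where t: "t \<in> {0..1}" "y = \<tau> t" by auto
      have "\<tau> 0 \<le> \<tau> t" "\<tau> t \<le> \<tau> 1" using less[of 0 t] less[of t 1] t by (force simp: less_eq_real_def)+
      then show "y \<in> {0..1}" using zero t by auto
    qed
    show "{0..1} \<subseteq> \<tau> ` {0..1}"
    proof
      fix y :: real assume "y \<in> {0..1}"
      then have "\<exists>x\<ge>0. x \<le> 1 \<and> \<tau> x = y" using zero cont by (intro IVT') auto
      then show "y \<in> \<tau> ` {0..1}" by auto
    qed
  qed
  moreover have "inj_on \<tau> {0..1}"
    by (rule inj_onI) (metis less linorder_less_linear order_less_irrefl)
  ultimately have "\<tau> \<in> time_changes"
    unfolding time_changes_def using cont less by (auto simp: bij_betw_def intro!: strict_mono_onI)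
  then show thesis using that at dev by blast
qed

lemma finite_separation:
  fixes F :: "real set"
  assumes "finite F" "F \<subseteq> {0<..<1}"
  obtains \<rho> where "\<rho> > 0" "\<And>s t. s \<in> F \<Longrightarrow> t \<in> F \<Longrightarrow> s \<noteq> t \<Longrightarrow> \<rho> \<le> \<bar>s - t\<bar>"
    "\<And>s. s \<in> F \<Longrightarrow> \<rho> \<le> s \<and> s \<le> 1 - \<rho>"
proof -
  define D where "D = insert 1 ((\<lambda>(s, t). \<bar>s - t\<bar>) ` {p \<in> F \<times> F. fst p \<noteq> snd p} \<union> F \<union> (\<lambda>s. 1 - s) ` F)"
  have fin: "finite D" using assms(1) unfolding D_def
    by (auto intro!: finite_imageI intro: finite_subset[of _ "F \<times> F"])
  have pos: "\<forall>d\<in>D. d > 0" using assms(2) by (auto simp: D_def)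
  have le: "Min D \<le> d" if "d \<in> D" for d using fin that by simp
  show thesis
  proof (rule that[of "Min D"])
    have "D \<noteq> {}" by (auto simp: D_def)
    then show "Min D > 0" using fin pos by (subst Min_gr_iff) auto
    show "Min D \<le> \<bar>s - t\<bar>" if "s \<in> F" "t \<in> F" "s \<noteq> t" for s t
      using that by (intro le) (force simp: D_def)
    show "Min D \<le> s \<and> s \<le> 1 - Min D" if "s \<in> F" for s
      using that le[of s] le[of "1 - s"] by (force simp: D_def)
  qed
qed

text \<open>Bisection: the property passes to concatenated intervals, with the common endpoint added
  to \<open>F\<close>, and holds near each point by the one-sided limits there. The interval
  \<open>{s<..t}\<close> omits \<open>s\<close> because right continuity allows a piece to start at
  a point of \<open>F\<close>.\<close>

lemma cadlag_oscillation_partition: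
  assumes "cadlag f" "e > 0"
  obtains F where "finite F"
    "\<And>s t. 0 \<le> s \<Longrightarrow> s \<le> t \<Longrightarrow> t \<le> 1 \<Longrightarrow> {s<..t} \<inter> F = {} \<Longrightarrow> \<bar>f s - f t\<bar> < e"
proof -
  define P where "P = (\<lambda>a b::real. \<exists>F. finite F \<and>
    (\<forall>s t. max a 0 \<le> s \<longrightarrow> s \<le> t \<longrightarrow> t \<le> min b 1 \<longrightarrow> {s<..t} \<inter> F = {} \<longrightarrow> \<bar>f s - f t\<bar> < e))"
  have "(0::real) \<le> 1" by simp
  then have "P 0 1"
  proof (induction rule: Bolzano)
    case (trans a b c)
    then obtain F1 F2 where F: "finite F1" "finite F2"
      "\<forall>s t. max a 0 \<le> s \<longrightarrow> s \<le> t \<longrightarrow> t \<le> min b 1 \<longrightarrow> {s<..t} \<inter> F1 = {} \<longrightarrow> \<bar>f s - f t\<bar> < e"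
      "\<forall>s t. max b 0 \<le> s \<longrightarrow> s \<le> t \<longrightarrow> t \<le> min c 1 \<longrightarrow> {s<..t} \<inter> F2 = {} \<longrightarrow> \<bar>f s - f t\<bar> < e"
      unfolding P_def by blast
    show ?case unfolding P_def
    proof (intro exI[of _ "insert b (F1 \<union> F2)"] conjI allI impI)
      fix s t assume st: "max a 0 \<le> s" "s \<le> t" "t \<le> min c 1" "{s<..t} \<inter> insert b (F1 \<union> F2) = {}"
      then have dis: "{s<..t} \<inter> F1 = {}" "{s<..t} \<inter> F2 = {}" and b: "b \<le> s \<or> t < b" by auto
      show "\<bar>f s - f t\<bar> < e"
        using b
      proof
        assume "b \<le> s" then show ?thesis using F(4)[rule_format, of s t] st dis by auto
      next
        assume "t < b" then show ?thesis using F(3)[rule_format, of s t] st dis by auto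
      qed
    qed (use F in auto)
  next
    case (local x)
    then obtain d l where d: "d > 0"
      "\<forall>s\<in>{0..1}. x \<le> s \<and> s < x + d \<longrightarrow> \<bar>f s - f x\<bar> < e / 2"
      "\<forall>s\<in>{0..1}. x - d < s \<and> s < x \<longrightarrow> \<bar>f s - l\<bar> < e / 2"
      using cadlag_local[OF assms(1) half_gt_zero[OF assms(2)], of x] by auto
    have "P a b" if ab: "a \<le> x" "x \<le> b" "b - a < d" for a b
      unfolding P_def
    proof (intro exI[of _ "{x}"] conjI allI impI)
      fix s t assume st: "max a 0 \<le> s" "s \<le> t" "t \<le> min b 1" "{s<..t} \<inter> {x} = {}"
      then have "x \<le> s \<or> t < x" by auto
      then show "\<bar>f s - f t\<bar> < e"
      proof
        assume "x \<le> s"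
        then have "\<bar>f s - f x\<bar> < e / 2" "\<bar>f t - f x\<bar> < e / 2" using d(2) st ab by auto
        then show ?thesis by linarith
      next
        assume "t < x"
        then have "\<bar>f s - l\<bar> < e / 2" "\<bar>f t - l\<bar> < e / 2" using d(3) st ab by auto
        then show ?thesis by linarith
      qed
    qed auto
    with d(1) show ?case by blast
  qed
  then show thesis using that by (auto simp: P_def)
qed

section \<open>Approximation on grids and Borel measurability\<close>

lemma floor_grid_le:
  fixes m :: nat and t :: real
  assumes "m > 0" "0 \<le> t" "t \<le> 1"
  shows "0 \<le> \<lfloor>t * m\<rfloor> / real m" "\<lfloor>t * m\<rfloor> / real m \<le> t" "\<lfloor>t * m\<rfloor> / real m \<le> 1"
proof -
  show "0 \<le> \<lfloor>t * m\<rfloor> / real m" using assms by simp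
  have "real_of_int \<lfloor>t * m\<rfloor> \<le> t * m" by simp
  then show "\<lfloor>t * m\<rfloor> / real m \<le> t" using assms by (simp add: field_simps)
  then show "\<lfloor>t * m\<rfloor> / real m \<le> 1" using assms(3) by (rule order_trans)
qed

lemma cadlag_floor_step:
  fixes a :: "nat \<Rightarrow> real"
  assumes "m > 0"
  shows "cadlag (\<lambda>t. a (nat \<lfloor>t * real m\<rfloor>))"
proof -
  have "((\<lambda>s. a (nat \<lfloor>s * real m\<rfloor>)) \<longlongrightarrow> a (nat \<lfloor>t * real m\<rfloor>)) (at_right t)" for t
  proof (rule tendsto_eventually)
    let ?b = "(\<lfloor>t * m\<rfloor> + 1) / m"
    have "t * m < \<lfloor>t * m\<rfloor> + 1" by linarith
    then have b: "t < ?b" using assms by (simp add: field_simps)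
    have "\<lfloor>s * m\<rfloor> = \<lfloor>t * m\<rfloor>" if "t < s" "s < ?b" for s
    proof (rule floor_unique)
      have "t * m < s * m" using that assms by simp
      then show "real_of_int \<lfloor>t * m\<rfloor> \<le> s * m" by linarith
      show "s * m < real_of_int \<lfloor>t * m\<rfloor> + 1" using that assms by (simp add: field_simps)
    qed
    then show "\<forall>\<^sub>F s in at_right t. a (nat \<lfloor>s * real m\<rfloor>) = a (nat \<lfloor>t * real m\<rfloor>)"
      using b by (subst eventually_at_right[OF b]) auto
  qed
  moreover have "\<exists>l. ((\<lambda>s. a (nat \<lfloor>s * real m\<rfloor>)) \<longlongrightarrow> l) (at_left t)" for t
  proof -
    \<comment> \<open>The value of the floor just to the left of \<open>t\<close>, whether or not
      \<open>t * m\<close> is an integer.\<close>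
    let ?k = "\<lceil>t * m\<rceil> - 1"
    have "?k < t * m" by linarith
    then have b: "?k / m < t" using assms by (simp add: field_simps)
    have "\<lfloor>s * m\<rfloor> = ?k" if "?k / m < s" "s < t" for s :: real
    proof (rule floor_unique)
      have "s * m < t * m" using that assms by simp
      then show "s * m < real_of_int ?k + 1" by linarith
      show "real_of_int ?k \<le> s * m" using that assms by (simp add: field_simps)
    qed
    then have "\<forall>\<^sub>F s in at_left t. a (nat \<lfloor>s * real m\<rfloor>) = a (nat ?k)"
      using b by (subst eventually_at_left[OF b]) auto
    then show ?thesis by (blast intro: tendsto_eventually)
  qed
  ultimately show ?thesis unfolding cadlag_def by blast
qed

text \<open>The values form an arbitrary sequence, so that \<open>grid_path m\<close> is a map on
  the product space \<open>nat \<Rightarrow> real\<close>, where continuity and measurability can be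
  checked by coordinates.\<close>

definition grid_path :: "nat \<Rightarrow> (nat \<Rightarrow> real) \<Rightarrow> skorokhod" where
  "grid_path m a = to_skorokhod (\<lambda>t. a (nat \<lfloor>t * real m\<rfloor>))"

lemma traj_grid_path:
  "m > 0 \<Longrightarrow> t \<in> {0..1} \<Longrightarrow> traj (grid_path m a) t = a (nat \<lfloor>t * real m\<rfloor>)"
  unfolding grid_path_def by (subst traj_to_skorokhod[OF cadlag_floor_step]) auto

text \<open>The grid path notices a jump at \<open>s\<close> only from the next grid point on. The
  time change therefore moves each partition point \<open>s\<close> to
  \<open>\<lceil>s * m\<rceil> / m\<close>. Then \<open>r\<close> and the grid point
  \<open>g\<close> below \<open>\<tau> r\<close> lie on the same side of every partition point, so
  the oscillation bound applies between them.\<close>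

lemma grid_path_LIMSEQ:
  "(\<lambda>m. grid_path (Suc m) (\<lambda>i. traj x (real i / real (Suc m)))) \<longlonglongrightarrow> x"
proof (rule metric_LIMSEQ_I)
  fix e :: real assume e: "e > 0"
  obtain F0 where F0: "finite F0"
    "\<And>s t. 0 \<le> s \<Longrightarrow> s \<le> t \<Longrightarrow> t \<le> 1 \<Longrightarrow> {s<..t} \<inter> F0 = {} \<Longrightarrow> \<bar>traj x s - traj x t\<bar> < e / 2"
    using cadlag_oscillation_partition[OF cadlag_traj half_gt_zero[OF e]] by metis
  define F where "F = F0 \<inter> {0<..<1}"
  have F: "finite F" "F \<subseteq> {0<..<1}" using F0 by (auto simp: F_def)
  obtain \<rho> where rho: "\<rho> > 0" "\<And>s t. s \<in> F \<Longrightarrow> t \<in> F \<Longrightarrow> s \<noteq> t \<Longrightarrow> \<rho> \<le> \<bar>s - t\<bar>"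
    "\<And>s. s \<in> F \<Longrightarrow> \<rho> \<le> s \<and> s \<le> 1 - \<rho>"
    by (rule finite_separation[OF F]) blast
  define d where "d = min \<rho> (e / 2)"
  have d: "d > 0" "d \<le> \<rho>" "d \<le> e / 2" using rho e by (auto simp: d_def)
  have "(\<lambda>m. real (card F) * inverse (real (Suc m))) \<longlonglongrightarrow> real (card F) * 0"
    by (intro tendsto_mult tendsto_const LIMSEQ_inverse_real_of_nat)
  then have "\<forall>\<^sub>F m in sequentially. real (card F) * inverse (real (Suc m)) < d"
    using d by (intro order_tendstoD) auto
  then obtain m0 where m0: "\<And>m. m \<ge> m0 \<Longrightarrow> real (card F) * inverse (real (Suc m)) < d"
    by (auto simp: eventually_sequentially)
  show "\<exists>no. \<forall>n\<ge>no. dist (grid_path (Suc n) (\<lambda>i. traj x (real i / real (Suc n)))) x < e"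
  proof (intro exI allI impI)
    fix n assume n: "m0 \<le> n"
    define m where "m = Suc n"
    have m: "m > 0" "real (card F) * (1 / real m) < d" using m0[OF n] by (auto simp: m_def inverse_eq_divide)
    have cl: "\<bar>\<lceil>s * m\<rceil> / real m - s\<bar> \<le> 1 / real m" for s :: real
    proof -
      have "\<bar>\<lceil>s * m\<rceil> - s * m\<bar> \<le> 1" by linarith
      then have "\<bar>\<lceil>s * m\<rceil> - s * m\<bar> / m \<le> 1 / real m" using m(1) by (intro divide_right_mono) auto
      moreover have "\<bar>\<lceil>s * m\<rceil> - s * m\<bar> / m = \<bar>(\<lceil>s * m\<rceil> - s * m) / m\<bar>" using m(1) by simp
      ultimately show ?thesis using m(1) by (simp add: diff_divide_distrib)
    qed
    have sm: "real (card F) * (1 / real m) < \<rho>" using m d by simp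
    have "\<exists>\<tau>\<in>time_changes. (\<forall>s\<in>F. \<tau> s = \<lceil>s * m\<rceil> / real m) \<and>
        (\<forall>t. \<bar>\<tau> t - t\<bar> \<le> real (card F) * (1 / real m))"
      by (rule time_change_exists[OF F(1) rho cl sm]) (assumption | blast)+
    then obtain \<tau> where t: "\<tau> \<in> time_changes" "\<And>s. s \<in> F \<Longrightarrow> \<tau> s = \<lceil>s * real m\<rceil> / real m"
      "\<And>t. \<bar>\<tau> t - t\<bar> \<le> real (card F) * (1 / real m)" by blast
    have "dist (grid_path m (\<lambda>i. traj x (real i / real m))) x \<le> e / 2"
    proof (rule dist_skorokhod_le[OF t(1)])
      show "\<bar>\<tau> r - r\<bar> \<le> e / 2" for r using t(3)[of r] m d by linarith
      fix r :: real assume r: "r \<in> {0..1}"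
      let ?q = "\<tau> r"
      define g where "g = \<lfloor>?q * m\<rfloor> / real m"
      have q: "0 \<le> ?q" "?q \<le> 1" using time_changes_range[OF t(1) r] by auto
      note fl = floor_grid_le[OF m(1) q, folded g_def]
      have "real (nat \<lfloor>?q * m\<rfloor>) / real m = g" using q by (simp add: g_def)
      then have tr: "traj (grid_path m (\<lambda>i. traj x (real i / real m))) ?q = traj x g"
        using traj_grid_path[OF m(1), of ?q] q by simp
      have "\<bar>traj x g - traj x r\<bar> \<le> e / 2"
      proof (cases "r = 1")
        case True
        then have "?q = 1" using time_changes_one[OF t(1)] by simp
        then show ?thesis using True e m by (simp add: g_def)
      next
        case False
        then have r1: "r < 1" using r by auto
        have smono: "strict_mono_on {0..1} \<tau>" using t(1) by (simp add: time_changes_def)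
        have "?q < \<tau> 1" using r r1 by (intro strict_mono_onD[OF smono]) auto
        then have q1: "?q < 1" using time_changes_one[OF t(1)] by simp
        have iff: "s \<le> r \<longleftrightarrow> s \<le> g" if s: "s \<in> F" for s
        proof -
          have "s \<in> {0..1}" using s F by auto
          then have "s \<le> r \<longleftrightarrow> \<tau> s \<le> ?q" using strict_mono_on_leD[OF smono] strict_mono_onD[OF smono] r
            by (metis linorder_not_le)
          also have "\<dots> \<longleftrightarrow> \<lceil>s * m\<rceil> \<le> ?q * m"
            unfolding t(2)[OF s] using m(1) by (simp add: pos_divide_le_eq)
          also have "\<dots> \<longleftrightarrow> \<lceil>s * m\<rceil> \<le> \<lfloor>?q * m\<rfloor>" by linarith
          also have "\<dots> \<longleftrightarrow> s * m \<le> \<lfloor>?q * m\<rfloor>" by linarith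
          also have "\<dots> \<longleftrightarrow> s \<le> g" using m(1) by (simp add: g_def field_simps)
          finally show ?thesis .
        qed
        have F01: "z \<in> F" if "z \<in> F0" "0 < z" "z < 1" for z using that by (simp add: F_def)
        show ?thesis
        proof (cases "g \<le> r")
          case True
          have "{g<..r} \<inter> F0 = {}" using iff F01 fl r1 by fastforce
          then show ?thesis using F0(2)[of g r] fl True r by auto
        next
          case False
          have "{r<..g} \<inter> F0 = {}" using iff F01 fl r q1 by fastforce
          then have "\<bar>traj x r - traj x g\<bar> < e / 2" using False r fl by (intro F0(2)) auto
          then show ?thesis by linarith
        qed
      qed
      then show "\<bar>traj (grid_path m (\<lambda>i. traj x (real i / real m))) ?q - traj x r\<bar> \<le> e / 2"
        using tr by simp
    qed
    then show "dist (grid_path (Suc n) (\<lambda>i. traj x (real i / real (Suc n)))) x < e"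
      using e by (simp add: m_def)
  qed
qed

lemma continuous_grid_path: "m > 0 \<Longrightarrow> continuous_on UNIV (grid_path m)"
  unfolding continuous_on_def
proof
  fix a :: "nat \<Rightarrow> real" assume m: "m > 0"
  have le: "dist (grid_path m b) (grid_path m a) \<le> (\<Sum>i\<le>m. \<bar>b i - a i\<bar>)" for b
  proof (rule dist_skorokhod_le[OF id_time_changes])
    show "\<bar>t - t\<bar> \<le> (\<Sum>i\<le>m. \<bar>b i - a i\<bar>)" for t :: real by (simp add: sum_nonneg)
    fix t :: real assume t: "t \<in> {0..1}"
    have "t * real m \<le> 1 * real m" using t m by (intro mult_right_mono) auto
    then have "nat \<lfloor>t * m\<rfloor> \<le> m" by linarith
    then have "\<bar>b (nat \<lfloor>t * m\<rfloor>) - a (nat \<lfloor>t * m\<rfloor>)\<bar> \<le> (\<Sum>i\<le>m. \<bar>b i - a i\<bar>)"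
      by (intro member_le_sum[where f = "\<lambda>i. \<bar>b i - a i\<bar>"]) auto
    then show "\<bar>traj (grid_path m b) t - traj (grid_path m a) t\<bar> \<le> (\<Sum>i\<le>m. \<bar>b i - a i\<bar>)"
      using t m by (simp add: traj_grid_path)
  qed
  have coord: "((\<lambda>b. b i) \<longlongrightarrow> a i) (at a)" for i
    using continuous_on_product_coordinates[of i, where 'b = real] by (simp add: continuous_on_def)
  have "((\<lambda>b. \<Sum>i\<le>m. \<bar>b i - a i\<bar>) \<longlongrightarrow> (\<Sum>i\<le>m. \<bar>a i - a i\<bar>)) (at a)"
    by (intro tendsto_sum tendsto_rabs tendsto_diff tendsto_const coord)
  then have "((\<lambda>b. \<Sum>i\<le>m. \<bar>b i - a i\<bar>) \<longlongrightarrow> 0) (at a)" by simp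
  then show "(grid_path m \<longlongrightarrow> grid_path m a) (at a)"
    by (rule metric_tendsto_imp_tendsto) (use le in \<open>auto simp: dist_real_def\<close>)
qed

text \<open>The Borel sets of the Skorokhod topology are generated by the coordinates, since every
  path is the limit of its values on finer and finer grids.\<close>

lemma measurable_skorokhodI:
  assumes "\<And>t. t \<in> {0..1} \<Longrightarrow> (\<lambda>\<omega>. traj (X \<omega>) t) \<in> borel_measurable M"
  shows "X \<in> borel_measurable M"
proof (rule borel_measurable_LIMSEQ_metric[where
      f = "\<lambda>m \<omega>. grid_path (Suc m) (\<lambda>i. traj (X \<omega>) (real i / real (Suc m)))"])
  fix m :: nat
  \<comment> \<open>Coordinates beyond \<open>Suc m\<close> belong to times outside the unit
    interval, about which nothing is assumed; the grid path does not read them, so they are set to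
    0.\<close>
  let ?a = "\<lambda>\<omega> i. if i \<le> Suc m then traj (X \<omega>) (real i / real (Suc m)) else 0"
  have "grid_path (Suc m) \<in> borel_measurable borel"
    by (intro borel_measurable_continuous_onI continuous_grid_path) simp
  moreover have "(\<lambda>\<omega>. ?a \<omega> i) \<in> borel_measurable M" for i
    using assms[of "real i / real (Suc m)"] by (cases "i \<le> Suc m") auto
  then have "?a \<in> borel_measurable M"
    by (rule measurable_coordinatewise_then_product)
  ultimately have "(\<lambda>\<omega>. grid_path (Suc m) (?a \<omega>)) \<in> borel_measurable M"
    by (rule measurable_compose_rev)
  moreover have "grid_path (Suc m) (?a \<omega>) = grid_path (Suc m) (\<lambda>i. traj (X \<omega>) (real i / real (Suc m)))" for \<omega>
  proof (rule skorokhod_eqI)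
    fix t :: real assume t: "t \<in> {0..1}"
    then have "t * real (Suc m) \<le> 1 * real (Suc m)" by (intro mult_right_mono) auto
    then have "t * real (Suc m) < real_of_int (int (Suc m)) + 1"
      unfolding of_int_of_nat_eq mult_1 by (rule le_less_trans) simp
    then have "nat \<lfloor>t * real (Suc m)\<rfloor> \<le> Suc m" by (simp only: nat_le_iff floor_le_iff)
    then show "traj (grid_path (Suc m) (?a \<omega>)) t = traj (grid_path (Suc m) (\<lambda>i. traj (X \<omega>) (real i / real (Suc m)))) t"
      using t by (simp add: traj_grid_path del: of_nat_Suc)
  qed
  ultimately show "(\<lambda>\<omega>. grid_path (Suc m) (\<lambda>i. traj (X \<omega>) (real i / real (Suc m)))) \<in> borel_measurable M"
    by simp
qed (rule grid_path_LIMSEQ)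

section \<open>Jumps under small perturbations\<close>

lemma left_limit_traj:
  assumes "t \<in> {0<..1}"
  shows "(traj x \<longlongrightarrow> traj x t - jump x t) (at_left t)"
proof -
  obtain k where k: "(traj x \<longlongrightarrow> k) (at_left t)"
    using cadlag_traj[of x] assms unfolding cadlag_def by blast
  then have "Lim (at_left t) (traj x) = k" by (intro tendsto_Lim) auto
  with k show ?thesis by (simp add: jump_def)
qed

text \<open>The function \<open>h\<close> absorbs a continuous part such as the drift, so the jump
  of a step function plus a drift is read off from the step function.\<close>

lemma jump_eqI:
  assumes "a < t" "\<And>s. a < s \<Longrightarrow> s < t \<Longrightarrow> traj x s = traj x t - c + h s" "(h \<longlongrightarrow> 0) (at_left t)"
  shows "jump x t = c"
proof -
  have "((\<lambda>s. traj x t - c + h s) \<longlongrightarrow> traj x t - c + 0) (at_left t)"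
    using assms(3) by (intro tendsto_intros)
  moreover have "\<forall>\<^sub>F s in at_left t. traj x t - c + h s = traj x s"
    using assms(1,2) by (subst eventually_at_left[OF assms(1)]) (auto intro!: exI[of _ a])
  ultimately have "(traj x \<longlongrightarrow> traj x t - c) (at_left t)" using tendsto_cong by fastforce
  then have "Lim (at_left t) (traj x) = traj x t - c" by (intro tendsto_Lim) auto
  then show ?thesis by (simp add: jump_def)
qed

lemma time_change_less_iff:
  assumes "\<tau> \<in> time_changes" "s \<in> {0..1}" "t \<in> {0..1}"
  shows "\<tau> s < \<tau> t \<longleftrightarrow> s < t"
proof -
  have m: "strict_mono_on {0..1} \<tau>" using assms(1) by (simp add: time_changes_def)
  show ?thesis using strict_mono_onD[OF m assms(2,3)] strict_mono_on_leD[OF m assms(3,2)] by force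
qed

lemma filterlim_time_change_at_left:
  assumes "\<tau> \<in> time_changes" "t \<in> {0<..1}"
  shows "filterlim \<tau> (at_left (\<tau> t)) (at_left t)"
proof -
  have "continuous_on {0..t} \<tau>"
    using assms by (auto simp: time_changes_def elim: continuous_on_subset)
  then have "(\<tau> \<longlongrightarrow> \<tau> t) (at_left t)" using assms by (intro continuous_on_Icc_at_leftD) auto
  moreover have "\<forall>\<^sub>F s in at_left t. \<tau> s \<in> {..<\<tau> t} - {\<tau> t}"
    using assms time_change_less_iff[OF assms(1)]
    by (subst eventually_at_left[of 0]) (auto intro!: exI[of _ 0])
  ultimately show ?thesis by (subst filterlim_at) (auto elim: eventually_mono)
qed

text \<open>A time change maps left neighbourhoods to left neighbourhoods, so the left limit of
  \<open>y\<close> at \<open>\<tau> t\<close> is the left limit of the composed path at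
  \<open>t\<close>. The value and the left limit each differ from those of \<open>x\<close> by at
  most \<open>e\<close>, which gives the loss \<open>2 * e\<close>.\<close>

lemma jump_time_change:
  assumes \<tau>: "\<tau> \<in> time_changes" and close: "\<And>s. s \<in> {0..1} \<Longrightarrow> \<bar>traj y (\<tau> s) - traj x s\<bar> < e"
    and t: "t \<in> {0<..1}"
  shows "\<tau> t \<in> {0<..1}" "jump y (\<tau> t) > jump x t - 2 * e"
proof -
  have "0 \<le> \<tau> 0" using time_changes_range[OF \<tau>, of 0] by simp
  moreover have "\<tau> 0 < \<tau> t" using time_change_less_iff[OF \<tau>, of 0 t] t by auto
  ultimately show \<tau>t: "\<tau> t \<in> {0<..1}" using time_changes_range[OF \<tau>, of t] t by auto
  have "((\<lambda>s. traj y (\<tau> s)) \<longlongrightarrow> traj y (\<tau> t) - jump y (\<tau> t)) (at_left t)"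
    by (rule filterlim_compose[OF left_limit_traj[OF \<tau>t] filterlim_time_change_at_left[OF \<tau> t]])
  then have "((\<lambda>s. traj y (\<tau> s) - traj x s) \<longlongrightarrow>
      (traj y (\<tau> t) - jump y (\<tau> t)) - (traj x t - jump x t)) (at_left t)"
    by (intro tendsto_diff left_limit_traj t)
  moreover have "\<forall>\<^sub>F s in at_left t. traj y (\<tau> s) - traj x s \<le> e"
  proof -
    have "traj y (\<tau> s) - traj x s \<le> e" if "0 < s" "s < t" for s
      using close[of s] that t by auto
    then show ?thesis using t by (subst eventually_at_left[of 0 t]) auto
  qed
  ultimately have "(traj y (\<tau> t) - jump y (\<tau> t)) - (traj x t - jump x t) \<le> e"
    by (intro tendsto_upperbound) auto
  moreover have "\<bar>traj y (\<tau> t) - traj x t\<bar> < e" using close t by auto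
  ultimately show "jump y (\<tau> t) > jump x t - 2 * e" by linarith
qed

text \<open>Finitely many jumps exceed \<open>\<gamma>\<close>, each by a positive margin, and all
  of them survive in nearby paths. Openness is what makes the event defining the sampling measure
  Borel.\<close>

lemma open_many_large_jumps:
  assumes "\<gamma> > 0"
  shows "open (many_large_jumps \<gamma> l)"
  unfolding open_dist
proof
  fix x assume x: "x \<in> many_large_jumps \<gamma> l"
  define J where "J = {t \<in> {0<..1}. jump x t > \<gamma>}"
  have J: "finite J" "l \<le> card J"
    using finite_large_jumps[OF assms] x by (auto simp: J_def many_large_jumps_def)
  \<comment> \<open>Half the smallest margin, because \<open>jump_time_change\<close> costs
    \<open>2 * e\<close>; the inserted 1 covers the case \<open>J = {}\<close>.\<close>
  define e where "e = Min (insert 1 ((\<lambda>t. (jump x t - \<gamma>) / 2) ` J))"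
  have "\<forall>t\<in>J. 0 < jump x t - \<gamma>" by (simp add: J_def)
  then have e: "e > 0" unfolding e_def using J(1) by auto
  have e_le: "e \<le> (jump x t - \<gamma>) / 2" if "t \<in> J" for t
    unfolding e_def using J(1) that by (intro Min_le) auto
  show "\<exists>e>0. \<forall>y. dist y x < e \<longrightarrow> y \<in> many_large_jumps \<gamma> l"
  proof (intro exI[of _ e] conjI allI impI e)
    fix y assume "dist y x < e"
    then obtain \<tau> where \<tau>: "\<tau> \<in> time_changes"
      "\<And>t. t \<in> {0..1} \<Longrightarrow> \<bar>traj y (\<tau> t) - traj x t\<bar> < e" by (rule dist_skorokhod_less) blast
    have "\<tau> ` J \<subseteq> {t \<in> {0<..1}. jump y t > \<gamma>}"
    proof
      fix s assume "s \<in> \<tau> ` J"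
      then obtain t where t: "t \<in> J" "s = \<tau> t" by auto
      have "t \<in> {0<..1}" using t by (simp add: J_def)
      from jump_time_change[OF \<tau> this] e_le[OF t(1)]
      show "s \<in> {t \<in> {0<..1}. jump y t > \<gamma>}" using t(2) by auto
    qed
    then have "card (\<tau> ` J) \<le> card {t \<in> {0<..1}. jump y t > \<gamma>}"
      by (intro card_mono finite_large_jumps assms)
    moreover have "inj_on \<tau> J"
      using \<tau>(1) by (auto simp: time_changes_def bij_betw_def J_def elim!: inj_on_subset)
    ultimately show "y \<in> many_large_jumps \<gamma> l"
      using J by (simp add: many_large_jumps_def card_image)
  qed
qed

section \<open>Step paths and the interior of the target set\<close>

text \<open>Equal times merge jumps, and zero weights or times after 1 remove them, so only an upper
  bound for the number of jumps is claimed. This suffices to place a path among those with fewer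
  than \<open>l\<close> jumps.\<close>

lemma sum_of_steps_in_step_paths:
  assumes I: "finite I" and y: "\<And>i. i \<in> I \<Longrightarrow> 0 \<le> y i" and u: "\<And>i. i \<in> I \<Longrightarrow> 0 < u i"
    and x: "\<And>t. t \<in> {0..1} \<Longrightarrow> traj x t = (\<Sum>i\<in>I. y i * indicator {u i..1} t)"
  shows "\<exists>k\<le>card (u ` I). x \<in> step_paths k"
proof -
  let ?F = "u ` I"
  have const: "traj x s = traj x t" if "0 \<le> s" "s < t" "t \<le> 1" "{s<..t} \<inter> ?F = {}" for s t
  proof -
    have "indicator {u i..1} s = (indicator {u i..1} t :: real)" if "i \<in> I" for i
    proof -
      have "\<not> (s < u i \<and> u i \<le> t)" using \<open>{s<..t} \<inter> ?F = {}\<close> \<open>i \<in> I\<close> by auto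
      then show ?thesis using \<open>s < t\<close> \<open>t \<le> 1\<close> by (auto simp: indicator_def)
    qed
    then show ?thesis using that x by simp
  qed
  then have "step_path x" unfolding step_path_def using I by (intro exI[of _ ?F]) auto
  moreover have "mono_on {0..1} (traj x)"
  proof (rule mono_onI)
    fix s t :: real assume st: "s \<in> {0..1}" "t \<in> {0..1}" "s \<le> t"
    have "(\<Sum>i\<in>I. y i * indicator {u i..1} s) \<le> (\<Sum>i\<in>I. y i * indicator {u i..1} t)"
      using y st by (intro sum_mono mult_left_mono) (auto simp: indicator_def)
    then show "traj x s \<le> traj x t" using x st by simp
  qed
  moreover have "traj x 0 = 0" using u x by (force simp: indicator_def intro!: sum.neutral)
  moreover have "{t \<in> {0<..1}. jump x t \<noteq> 0} \<subseteq> ?F"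
  proof (rule ccontr)
    assume "\<not> ?thesis"
    then obtain t where t: "t \<in> {0<..1}" "jump x t \<noteq> 0" "t \<notin> ?F" by auto
    define a where "a = Max (insert 0 (?F \<inter> {..<t}))"
    have a: "0 \<le> a" "a < t" "\<And>s. s \<in> ?F \<Longrightarrow> s < t \<Longrightarrow> s \<le> a"
      using I t by (auto simp: a_def)
    have "jump x t = 0"
    proof (rule jump_eqI[where h = "\<lambda>_. 0" and a = a])
      fix s assume s: "a < s" "s < t"
      have "{s<..t} \<inter> ?F = {}"
      proof (intro equals0I)
        fix q assume q: "q \<in> {s<..t} \<inter> ?F"
        then have "q < t" using t(3) by (cases "q = t") auto
        then show False using a(3)[of q] q s by auto
      qed
      then show "traj x s = traj x t - 0 + 0" using const[of s t] a s t by auto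
    qed (use a in auto)
    with t show False by simp
  qed
  then have "card {t \<in> {0<..1}. jump x t \<noteq> 0} \<le> card ?F" using I by (intro card_mono) auto
  ultimately show ?thesis unfolding step_paths_def by blast
qed

lemma bounded_away_dist:
  assumes "bounded_away A S"
  obtains \<delta> where "\<delta> > 0" "\<And>x y. x \<in> A \<Longrightarrow> y \<in> S \<Longrightarrow> \<delta> \<le> dist x y"
proof -
  from assms obtain \<delta> where d: "0 < ereal \<delta>" "ereal \<delta> < (INF x\<in>A. INF y\<in>S. ereal (dist x y))"
    unfolding bounded_away_def using ereal_dense2 by blast
  have "\<delta> \<le> dist x y" if "x \<in> A" "y \<in> S" for x y
  proof -
    have "(INF x\<in>A. INF y\<in>S. ereal (dist x y)) \<le> ereal (dist x y)"
      using that by (meson INF_lower2 order_refl)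
    from less_le_trans[OF d(2) this] show ?thesis by simp
  qed
  then show thesis using that d(1) by simp
qed

text \<open>Ties among the jump times would put the path into a space with fewer jumps, from which
  \<open>A\<close> is bounded away.\<close>

lemma step_sum_in_interior:
  assumes pos: "limit_measure \<beta> l (interior A) > 0"
    and away: "bounded_away A (\<Union>k<l. step_paths k)"
  obtains y u \<eta> where "\<eta> > 0" "inj_on u {1..l}" "\<And>i. i \<in> {1..l} \<Longrightarrow> u i \<in> {0<..<1}"
    "\<And>i. i \<in> {1..l} \<Longrightarrow> 0 < y i" "\<And>x. dist x (step_sum l y u) < \<eta> \<Longrightarrow> x \<in> A"
proof -
  have "\<exists>y u. (\<forall>i\<in>{1..l}. 0 < u i \<and> u i < 1) \<and> (\<forall>i\<in>{1..l}. 0 < y i) \<and> step_sum l y u \<in> interior A"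
  proof (cases "l = 0")
    case True
    then have "indicator (interior A) (to_skorokhod (\<lambda>_. 0)) > (0 :: ennreal)"
      using pos by (simp add: limit_measure_def emeasure_return)
    then have "to_skorokhod (\<lambda>_. 0) \<in> interior A" by (auto simp: indicator_def of_bool_def split: if_splits)
    then show ?thesis using True by (simp add: step_sum_def)
  next
    case False
    let ?E = "\<lambda>u. {y \<in> space (nu_ordered \<beta> l). (\<forall>i\<in>{1..l}. 0 < y i) \<and> step_sum l y u \<in> interior A}"
    let ?U = "uniform_measure lborel {0..1::real}"
    have U: "prob_space ?U" by (rule prob_space_uniform_measure) auto
    show ?thesis
    proof (rule ccontr)
      \<comment> \<open>Without such a pair the set \<open>?E u\<close> is empty whenever all times
        lie in the open unit interval. Uniform times do so almost surely, and the integral defining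
        \<open>limit_measure\<close> would vanish.\<close>
      assume no: "\<not> ?thesis"
      have ae: "AE x in ?U. 0 < x \<and> x < 1"
      proof (rule AE_uniform_measureI)
        have "AE x in lborel. x \<noteq> (0::real) \<and> x \<noteq> 1"
          using AE_lborel_singleton[of "0::real"] AE_lborel_singleton[of "1::real"] by eventually_elim auto
        then show "AE x in lborel. x \<in> {0..1} \<longrightarrow> 0 < x \<and> x < (1::real)"
          by eventually_elim auto
      qed auto
      have "AE u in uniform_times l. 0 < u i \<and> u i < 1" if "i \<in> {1..l}" for i
        unfolding uniform_times_def using that U ae by (intro AE_PiM_component) auto
      then have "AE u in uniform_times l. \<forall>i\<in>{1..l}. 0 < u i \<and> u i < 1"
        by (intro AE_finite_allI) auto
      then have "AE u in uniform_times l. emeasure (nu_ordered \<beta> l) (?E u) = 0"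
      proof eventually_elim
        case (elim u)
        then have E: "?E u = {}" using no by blast
        show ?case unfolding E by (rule emeasure_empty)
      qed
      then have "(\<integral>\<^sup>+u. emeasure (nu_ordered \<beta> l) (?E u) \<partial>uniform_times l) = (\<integral>\<^sup>+u. 0 \<partial>uniform_times l)"
        by (rule nn_integral_cong_AE)
      then show False using pos False by (simp add: limit_measure_def)
    qed
  qed
  then obtain y u where yu0: "\<forall>i\<in>{1..l}. 0 < u i \<and> u i < 1" "\<forall>i\<in>{1..l}. 0 < y i"
    and yu_int: "step_sum l y u \<in> interior A" by blast
  have yu: "u i \<in> {0<..<1}" "0 < y i" if "i \<in> {1..l}" for i using yu0 that by auto
  obtain \<delta> where \<delta>: "\<delta> > 0" "\<And>x z. x \<in> A \<Longrightarrow> z \<in> (\<Union>k<l. step_paths k) \<Longrightarrow> \<delta> \<le> dist x z"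
    using bounded_away_dist[OF away] by blast
  have "inj_on u {1..l}"
  proof (rule ccontr)
    assume "\<not> inj_on u {1..l}"
    then have "card (u ` {1..l}) < l"
      using card_image_le[of "{1..l}" u] by (force simp: inj_on_iff_eq_card)
    moreover have "\<exists>k\<le>card (u ` {1..l}). step_sum l y u \<in> step_paths k"
      using yu by (intro sum_of_steps_in_step_paths[where y = y] traj_step_sum) (auto intro: less_imp_le)
    ultimately have "step_sum l y u \<in> (\<Union>k<l. step_paths k)" by (auto intro: le_less_trans)
    moreover have "step_sum l y u \<in> A" using yu_int interior_subset by blast
    ultimately show False using \<delta>(1) \<delta>(2)[of "step_sum l y u" "step_sum l y u"] by simp
  qed
  moreover obtain \<eta> where "\<eta> > 0" "ball (step_sum l y u) \<eta> \<subseteq> A"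
    using yu_int mem_interior by blast
  ultimately show thesis using that yu by (auto simp: dist_commute subset_iff)
qed

section \<open>Paths driven by a counting function\<close>

definition arrival :: "(real \<Rightarrow> nat) \<Rightarrow> nat \<Rightarrow> real" where
  "arrival g k = Inf {t. 0 \<le> t \<and> k \<le> g t}"

text \<open>Large values are replaced by 0 rather than capped, so that a sum minus its truncated sum
  is exactly the sum of the large terms.\<close>

definition truncate :: "real \<Rightarrow> real \<Rightarrow> real" where
  "truncate a x = (if x \<le> a then x else 0)"

text \<open>A single sample path of the Poisson process. Arrivals may still coincide here; their
  simplicity is the separate property \<open>simple_until\<close>, which holds only almost
  surely.\<close>

locale counting_path =
  fixes g :: "real \<Rightarrow> nat"
  assumes mono_g: "mono_on {0..} g"
    and right_cont_g: "\<And>t. t \<ge> 0 \<Longrightarrow> continuous (at_right t) (\<lambda>t. real (g t))"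
    and g_0: "g 0 = 0"
begin

lemma g_mono: "0 \<le> s \<Longrightarrow> s \<le> t \<Longrightarrow> g s \<le> g t"
  using mono_g by (auto intro: mono_onD)

text \<open>Right continuity of the integer-valued \<open>g\<close> makes the infimum a minimum,
  which turns the comparison of \<open>k\<close> with \<open>g t\<close> into a comparison of times.
  Positivity follows from \<open>g 0 = 0\<close>.\<close>

lemma arrival:
  assumes "1 \<le> k" "k \<le> g s" "0 \<le> s"
  shows arrival_pos: "0 < arrival g k" and arrival_le: "arrival g k \<le> s"
    and arrival_le_iff: "\<And>t. 0 \<le> t \<Longrightarrow> k \<le> g t \<longleftrightarrow> arrival g k \<le> t"
proof -
  let ?S = "{t. 0 \<le> t \<and> k \<le> g t}" and ?T = "arrival g k"
  have S: "s \<in> ?S" "bdd_below ?S" using assms by (auto intro: bdd_belowI[of _ 0])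
  have le: "?T \<le> t" if "t \<in> ?S" for t unfolding arrival_def using that S by (intro cInf_lower) auto
  have T0: "0 \<le> ?T" unfolding arrival_def using S by (intro cInf_greatest) auto
  have gT: "k \<le> g ?T"
  proof -
    have "((\<lambda>t. real (g t)) \<longlongrightarrow> real (g ?T)) (at_right ?T)"
      using right_cont_g[OF T0] by (simp add: continuous_within)
    then have "\<forall>\<^sub>F t in at_right ?T. dist (real (g t)) (real (g ?T)) < 1" by (rule tendstoD) simp
    then obtain b where b: "?T < b" "\<And>t. ?T < t \<Longrightarrow> t < b \<Longrightarrow> dist (real (g t)) (real (g ?T)) < 1"
      by (subst (asm) eventually_at_right[of ?T "?T + 1"]) auto
    obtain t where t: "t \<in> ?S" "t < b"
      using b(1) S unfolding arrival_def by (subst (asm) cInf_less_iff) auto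
    show ?thesis
    proof (cases "t = ?T")
      case True then show ?thesis using t by auto
    next
      case False
      then have "dist (real (g t)) (real (g ?T)) < 1" using le[OF t(1)] t by (intro b(2)) auto
      then have "g t = g ?T" by (auto simp: dist_real_def)
      then show ?thesis using t by auto
    qed
  qed
  have "?T \<noteq> 0" using gT g_0 assms(1) by (metis le_zero_eq not_one_le_zero)
  then show "0 < ?T" using T0 by simp
  show "?T \<le> s" using le S by simp
  show "k \<le> g t \<longleftrightarrow> ?T \<le> t" if "0 \<le> t" for t
    using le[of t] that gT g_mono[OF T0, of t] by auto
qed

text \<open>The scaled compensated path as a deterministic function of the jump sizes
  \<open>w\<close>; the drift rate \<open>b\<close> will be \<open>r * mean\<close>.\<close>

definition driven_path :: "skorokhod \<Rightarrow> real \<Rightarrow> (nat \<Rightarrow> real) \<Rightarrow> real \<Rightarrow> bool" where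
  "driven_path x n w b \<longleftrightarrow> n > 0 \<and> (\<forall>t\<in>{0..1}. traj x t = (\<Sum>k=1..g (n * t). w k) / n - b * t)"

text \<open>No two arrivals coincide up to time \<open>n\<close>, stated without left limits: by
  monotonicity, one earlier time with count at least \<open>g s - 1\<close> bounds the height of the
  jump at \<open>s\<close> by one.\<close>

definition simple_until :: "real \<Rightarrow> bool" where
  "simple_until n \<longleftrightarrow> (\<forall>s\<in>{0<..n}. \<exists>s'\<in>{0..<s}. g s \<le> Suc (g s'))"

text \<open>If \<open>g\<close> attains \<open>g s\<close> before \<open>s\<close>, it is constant
  from then on. Otherwise it stays below \<open>g s\<close>, and simplicity forces the value
  \<open>g s - 1\<close> close to \<open>s\<close>.\<close>

lemma left_neighbourhood:
  assumes "simple_until n" "s \<in> {0<..n}"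
  obtains (no_jump) s' where "0 \<le> s'" "s' < s" "\<And>q. s' < q \<Longrightarrow> q < s \<Longrightarrow> g q = g s"
  | (jump) s' where "0 \<le> s'" "s' < s" "\<And>q. s' < q \<Longrightarrow> q < s \<Longrightarrow> Suc (g q) = g s"
proof -
  obtain s' where s': "0 \<le> s'" "s' < s" "g s \<le> Suc (g s')"
    using assms unfolding simple_until_def by fastforce
  show thesis
  proof (cases "\<exists>p. s' \<le> p \<and> p < s \<and> g p = g s")
    case True
    then obtain p where p: "s' \<le> p" "p < s" "g p = g s" by blast
    show thesis
    proof (rule no_jump[of p])
      fix q assume "p < q" "q < s"
      then show "g q = g s" using g_mono[of p q] g_mono[of q s] p s' by auto
    qed (use p s' in auto)
  next
    case False
    show thesis
    proof (rule jump[of s'])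
      fix q assume "s' < q" "q < s"
      then have "g s' \<le> g q" "g q \<le> g s" "g q \<noteq> g s"
        using g_mono[of s' q] g_mono[of q s] False s' by auto
      then show "Suc (g q) = g s" using s'(3) by linarith
    qed (use s' in auto)
  qed
qed

lemma jump_driven_path:
  assumes x: "driven_path x n w b" and t: "t \<in> {0<..1}"
    and a: "0 \<le> a" "a < n * t" "\<And>q. a < q \<Longrightarrow> q < n * t \<Longrightarrow> g q = m"
  shows "jump x t = ((\<Sum>k=1..g (n * t). w k) - (\<Sum>k=1..m. w k)) / n"
proof (rule jump_eqI[where a = "a / n" and h = "\<lambda>s. b * t - b * s"])
  have n: "n > 0" using x by (simp add: driven_path_def)
  show "a / n < t" using a n by (simp add: field_simps)
  show "((\<lambda>s. b * t - b * s) \<longlongrightarrow> 0) (at_left t)" by (auto intro!: tendsto_eq_intros)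
  fix s assume s: "a / n < s" "s < t"
  then have "a < n * s" "n * s < n * t" using n by (auto simp: field_simps)
  moreover have "s \<in> {0..1}" using s a(1) n t
    by (auto intro: order_trans less_imp_le[of "a / n"] divide_nonneg_pos)
  ultimately show "traj x s = traj x t - ((\<Sum>k=1..g (n * t). w k) - (\<Sum>k=1..m. w k)) / n + (b * t - b * s)"
    using x t a(3)[of "n * s"] by (simp add: driven_path_def diff_divide_distrib)
qed

text \<open>The map from a jump time \<open>t\<close> to \<open>g (n * t)\<close> gives the index of
  the summand that arrives then. It is injective because \<open>g\<close> strictly increases at a
  jump, and \<open>arrival g k / n\<close> is the preimage of \<open>k\<close>. Simplicity ensures
  that the jump is a single summand and not a sum of several.\<close>

lemma card_large_jumps:
  assumes x: "driven_path x n w b" and simple: "simple_until n" and \<gamma>: "\<gamma> > 0"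
  shows "card {t \<in> {0<..1}. jump x t > \<gamma>} = card {k \<in> {1..g n}. w k > n * \<gamma>}"
    (is "card ?J = card ?K")
proof (rule bij_betw_same_card[of "\<lambda>t. g (n * t)"], unfold bij_betw_def, intro conjI)
  have n: "n > 0" using x by (simp add: driven_path_def)
  have nt: "n * t \<in> {0<..n}" if "t \<in> {0<..1}" for t using that n by auto
  have jmp: "w (g (n * t)) > n * \<gamma> \<and> 1 \<le> g (n * t) \<and> (\<forall>q. 0 \<le> q \<longrightarrow> q < n * t \<longrightarrow> g q < g (n * t))"
    if t: "t \<in> ?J" for t
  proof -
    have t1: "t \<in> {0<..1}" "jump x t > \<gamma>" using t by auto
    from simple nt[OF t1(1)] show ?thesis
    proof (cases rule: left_neighbourhood)
      case (no_jump s')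
      have "jump x t = 0" using jump_driven_path[OF x t1(1) no_jump] by simp
      then show ?thesis using t1 \<gamma> by simp
    next
      case (jump s')
      define p where "p = (s' + n * t) / 2"
      have p: "s' < p" "p < n * t" using jump by (auto simp: p_def)
      have gp: "Suc (g p) = g (n * t)" using jump p by simp
      have "g q = g p" if "s' < q" "q < n * t" for q using jump(3)[OF that] gp by simp
      then have "jump x t = ((\<Sum>k=1..g (n * t). w k) - (\<Sum>k=1..g p. w k)) / n"
        by (rule jump_driven_path[OF x t1(1) jump(1,2)])
      then have "jump x t = w (g (n * t)) / n" by (simp add: gp[symmetric])
      then have "w (g (n * t)) = n * jump x t" using n by simp
      then have "w (g (n * t)) > n * \<gamma>" using t1 n by simp
      moreover have "g q < g (n * t)" if "0 \<le> q" "q < n * t" for q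
      proof (cases "s' < q")
        case True then show ?thesis using jump(3)[of q] that by simp
      next
        case False
        then have "g q \<le> g p" using that p by (intro g_mono) auto
        then show ?thesis using gp by simp
      qed
      ultimately show ?thesis using gp by auto
    qed
  qed
  show "inj_on (\<lambda>t. g (n * t)) ?J"
  proof (rule linorder_inj_onI')
    fix s t assume st: "s \<in> ?J" "t \<in> ?J" "s < t"
    then have "0 \<le> n * s" "n * s < n * t" using n by auto
    with jmp[OF st(2)] show "g (n * s) \<noteq> g (n * t)" by force
  qed
  show "(\<lambda>t. g (n * t)) ` ?J = ?K"
  proof
    show "(\<lambda>t. g (n * t)) ` ?J \<subseteq> ?K"
    proof
      fix k assume "k \<in> (\<lambda>t. g (n * t)) ` ?J"
      then obtain t where t: "t \<in> ?J" "k = g (n * t)" by auto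
      have "g (n * t) \<le> g n" using t n by (intro g_mono) auto
      then show "k \<in> ?K" using jmp[OF t(1)] t by auto
    qed
    show "?K \<subseteq> (\<lambda>t. g (n * t)) ` ?J"
    proof
      fix k assume "k \<in> ?K"
      then have k: "1 \<le> k" "k \<le> g n" "w k > n * \<gamma>" by auto
      let ?T = "arrival g k"
      note T = arrival_pos[OF k(1,2)] arrival_le[OF k(1,2)] arrival_le_iff[OF k(1,2)]
      have T0: "0 < ?T" "?T \<le> n" using T n by auto
      define t where "t = ?T / n"
      have t: "t \<in> {0<..1}" "n * t = ?T" using T0 n by (auto simp: t_def)
      have kT: "k \<le> g ?T" using T(3)[of ?T] T0 n by auto
      have less: "g q < k" if "0 \<le> q" "q < ?T" for q using T(3)[of q] that n by auto
      from simple nt[OF t(1)] show "k \<in> (\<lambda>t. g (n * t)) ` ?J"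
      proof (cases rule: left_neighbourhood)
        case (no_jump s')
        define p where "p = (s' + ?T) / 2"
        have "s' < p" "p < ?T" using no_jump t by (auto simp: p_def)
        then have "g p = g ?T" "g p < k" using no_jump(1) no_jump(3)[of p] less[of p] t by simp_all
        then show ?thesis using kT by simp
      next
        case (jump s')
        define p where "p = (s' + ?T) / 2"
        have p: "s' < p" "p < ?T" using jump t by (auto simp: p_def)
        have gp: "Suc (g p) = g ?T" using jump p t by simp
        then have gk: "g ?T = k" using less[of p] p jump kT by auto
        have "g q = g p" if "s' < q" "q < n * t" for q using jump(3)[OF that] gp t by simp
        then have "jump x t = ((\<Sum>k=1..g (n * t). w k) - (\<Sum>k=1..g p. w k)) / n"
          by (rule jump_driven_path[OF x t(1) jump(1,2)])
        moreover have "k = Suc (g p)" using gk gp by simp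
        ultimately have "jump x t = w k / n" unfolding t(2) gk by simp
        then have "jump x t > \<gamma>" using k(3) n by (simp add: pos_less_divide_eq mult.commute)
        then have "t \<in> ?J" using t by simp
        then show ?thesis using gk t by (intro image_eqI[of _ _ t]) auto
      qed
    qed
  qed
qed

text \<open>Keeping only the large jumps, at their own times, gives a step path \<open>z\<close>
  with fewer than \<open>l\<close> jumps. Under the identity time change, \<open>x\<close> differs
  from \<open>z\<close> by the compensated truncated sum divided by \<open>n\<close>; were this at
  most \<open>\<delta> / 2\<close> throughout, \<open>x\<close> would be too close to
  \<open>z\<close>.\<close>

lemma driven_path_far_from_steps:
  assumes x: "driven_path x n w b" and \<gamma>: "\<gamma> > 0" and \<delta>: "\<delta> > 0"
    and few: "card {k \<in> {1..g n}. w k > n * \<gamma>} < l"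
    and far: "\<And>z. z \<in> (\<Union>k<l. step_paths k) \<Longrightarrow> \<delta> \<le> dist x z"
  shows "\<exists>t\<in>{0..1}. \<bar>(\<Sum>k=1..g (n * t). truncate (n * \<gamma>) (w k)) - n * b * t\<bar> > n * (\<delta> / 2)"
proof (rule ccontr)
  assume "\<not> ?thesis"
  then have close: "\<bar>(\<Sum>k=1..g (n * t). truncate (n * \<gamma>) (w k)) - n * b * t\<bar> \<le> n * (\<delta> / 2)"
    if "t \<in> {0..1}" for t using that by force
  have n: "n > 0" using x by (simp add: driven_path_def)
  let ?K = "{k \<in> {1..g n}. w k > n * \<gamma>}"
  define u where "u = (\<lambda>k. arrival g k / n)"
  have u0: "0 < u k" if "k \<in> ?K" for k
    using arrival_pos[of k n] that n by (auto simp: u_def)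
  have w0: "0 < w k" if "k \<in> ?K" for k
    using that mult_pos_pos[OF n \<gamma>] by auto
  define z where "z = to_skorokhod (\<lambda>t. \<Sum>k\<in>?K. (w k / n) * indicator {u k..1} t)"
  have z: "traj z t = (\<Sum>k\<in>?K. (w k / n) * indicator {u k..1} t)" if "t \<in> {0..1}" for t
  proof -
    have "cadlag (\<lambda>t. \<Sum>k\<in>?K. (w k / n) * indicator {u k..1} t)"
      by (intro cadlag_sum cadlag_cmult cadlag_indicator)
    from traj_to_skorokhod[OF this, of t] show ?thesis using that by (simp add: z_def)
  qed
  have "\<exists>j\<le>card (u ` ?K). z \<in> step_paths j"
    using w0 u0 n by (intro sum_of_steps_in_step_paths[OF _ _ _ z]) (auto intro: less_imp_le)
  then obtain j where j: "j \<le> card (u ` ?K)" "z \<in> step_paths j" by blast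
  have "card (u ` ?K) \<le> card ?K" by (rule card_image_le) simp
  then have "\<delta> \<le> dist x z" using j few by (intro far UN_I[of j]) auto
  also have "dist x z \<le> \<delta> / 2"
  proof (rule dist_skorokhod_le[OF id_time_changes])
    fix t :: real assume t: "t \<in> {0..1}"
    have nt: "0 \<le> n * t" "n * t \<le> n" using t n by auto
    have "traj z t = (\<Sum>k\<in>?K. if k \<le> g (n * t) then w k / n else 0)"
      unfolding z[OF t]
    proof (intro sum.cong refl)
      fix k assume k: "k \<in> ?K"
      have "k \<le> g (n * t) \<longleftrightarrow> u k \<le> t"
        using arrival_le_iff[of k n "n * t"] k n nt by (simp add: u_def field_simps)
      then show "(w k / n) * indicator {u k..1} t = (if k \<le> g (n * t) then w k / n else 0)"
        using t by (auto simp: indicator_def)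
    qed
    also have "\<dots> = (\<Sum>k\<in>{k \<in> ?K. k \<le> g (n * t)}. w k / n)" by (rule sum.inter_filter[symmetric]) simp
    also have "{k \<in> ?K. k \<le> g (n * t)} = {k \<in> {1..g (n * t)}. w k > n * \<gamma>}"
      using g_mono[OF nt] by auto
    also have "(\<Sum>k\<in>{k \<in> {1..g (n * t)}. w k > n * \<gamma>}. w k / n) =
        (\<Sum>k=1..g (n * t). if w k > n * \<gamma> then w k / n else 0)"
      by (subst sum.inter_filter) auto
    finally have "traj x t - traj z t =
        (\<Sum>k=1..g (n * t). w k / n - (if w k > n * \<gamma> then w k / n else 0)) - b * t"
      using x t by (simp add: driven_path_def sum_divide_distrib sum_subtractf)
    also have "(\<Sum>k=1..g (n * t). w k / n - (if w k > n * \<gamma> then w k / n else 0)) =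
        (\<Sum>k=1..g (n * t). truncate (n * \<gamma>) (w k) / n)"
      by (intro sum.cong) (auto simp: truncate_def)
    also have "\<dots> - b * t = ((\<Sum>k=1..g (n * t). truncate (n * \<gamma>) (w k)) - n * b * t) / n"
      using n by (simp add: sum_divide_distrib diff_divide_distrib)
    finally have "\<bar>traj x t - traj z t\<bar> =
        \<bar>(\<Sum>k=1..g (n * t). truncate (n * \<gamma>) (w k)) - n * b * t\<bar> / n"
      using n by simp
    also have "\<dots> \<le> (n * (\<delta> / 2)) / n" using close[OF t] n by (intro divide_right_mono) auto
    also have "\<dots> = \<delta> / 2" using n by simp
    finally show "\<bar>traj x t - traj z t\<bar> \<le> \<delta> / 2" .
  qed (use \<delta> in auto)
  finally show False using \<delta> by simp
qed

text \<open>A time change sends \<open>u i\<close> to the scaled arrival time of jump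
  \<open>\<kappa> i\<close>, so that the selected jumps and those of the step path are switched on
  at the same instants. The error then splits into the \<open>l\<close> differences of sizes and the
  compensated sum of the other jumps, each at most \<open>\<eta> / 2\<close>.\<close>

lemma driven_path_near_step_sum:
  assumes x: "driven_path x n w b"
    and inj: "inj_on u {1..l}" and u: "\<And>i. i \<in> {1..l} \<Longrightarrow> u i \<in> {0<..<1}"
    and sep: "\<rho> > 0" "\<And>s t. s \<in> u ` {1..l} \<Longrightarrow> t \<in> u ` {1..l} \<Longrightarrow> s \<noteq> t \<Longrightarrow> \<rho> \<le> \<bar>s - t\<bar>"
      "\<And>s. s \<in> u ` {1..l} \<Longrightarrow> \<rho> \<le> s \<and> s \<le> 1 - \<rho>"
    and e: "real l * e < \<rho>" "real l * e \<le> \<eta>"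
    and K: "inj_on \<kappa> {1..l}" "\<And>i. i \<in> {1..l} \<Longrightarrow> 1 \<le> \<kappa> i \<and> \<kappa> i \<le> g n"
    and near_t: "\<And>i. i \<in> {1..l} \<Longrightarrow> \<bar>arrival g (\<kappa> i) / n - u i\<bar> \<le> e"
    and near_y: "\<And>i. i \<in> {1..l} \<Longrightarrow> \<bar>w (\<kappa> i) / n - y i\<bar> \<le> e'" and e': "real l * e' \<le> \<eta> / 2"
    and rest: "\<And>t. t \<in> {0..1} \<Longrightarrow> \<bar>(\<Sum>k\<in>{1..g (n * t)} - \<kappa> ` {1..l}. w k) - n * b * t\<bar> \<le> n * (\<eta> / 2)"
  shows "dist x (step_sum l y u) \<le> \<eta>"
proof -
  have n: "n > 0" using x by (simp add: driven_path_def)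
  let ?I = "{1..l}"
  \<comment> \<open>\<open>time_change_exists\<close> prescribes values at points, not at indices;
    injectivity of \<open>u\<close> recovers the index from the point.\<close>
  define v where "v = (\<lambda>s. arrival g (\<kappa> (the_inv_into ?I u s)) / n)"
  have v: "v (u i) = arrival g (\<kappa> i) / n" if "i \<in> ?I" for i
    using that inj by (simp add: v_def the_inv_into_f_f)
  have card: "card (u ` ?I) = l" using inj by (simp add: card_image)
  have near: "\<bar>v s - s\<bar> \<le> e" if "s \<in> u ` ?I" for s using that v near_t by auto
  have small: "real (card (u ` ?I)) * e < \<rho>" using e card by simp
  have "\<exists>\<tau>\<in>time_changes. (\<forall>s\<in>u ` ?I. \<tau> s = v s) \<and> (\<forall>t. \<bar>\<tau> t - t\<bar> \<le> real (card (u ` ?I)) * e)"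
    by (rule time_change_exists[OF _ sep near small]) (assumption | simp | blast)+
  then obtain \<tau> where \<tau>: "\<tau> \<in> time_changes" "\<And>s. s \<in> u ` ?I \<Longrightarrow> \<tau> s = v s"
    "\<And>t. \<bar>\<tau> t - t\<bar> \<le> real l * e" unfolding card by blast
  show ?thesis
  proof (rule dist_skorokhod_le[OF \<tau>(1)])
    show "\<bar>\<tau> t - t\<bar> \<le> \<eta>" for t using \<tau>(3)[of t] e by linarith
    fix t :: real assume t: "t \<in> {0..1}"
    define q where "q = \<tau> t"
    have q: "q \<in> {0..1}" unfolding q_def using time_changes_range[OF \<tau>(1) t] .
    have nq: "0 \<le> n * q" using q n by auto
    have iff: "\<kappa> i \<le> g (n * q) \<longleftrightarrow> u i \<le> t" if i: "i \<in> ?I" for i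
    proof -
      have "\<kappa> i \<le> g (n * q) \<longleftrightarrow> arrival g (\<kappa> i) \<le> n * q"
        using K(2)[OF i] n nq by (intro arrival_le_iff[of _ n]) auto
      also have "\<dots> \<longleftrightarrow> \<tau> (u i) \<le> q"
        using \<tau>(2)[of "u i"] v[OF i] i n by (simp add: pos_divide_le_eq mult.commute)
      also have "\<dots> \<longleftrightarrow> u i \<le> t"
        using time_change_less_iff[OF \<tau>(1) t, of "u i"] u[OF i] by (auto simp: q_def)
      finally show ?thesis .
    qed
    have "(\<Sum>k=1..g (n * q). w k) =
        (\<Sum>k\<in>{1..g (n * q)} - \<kappa> ` ?I. w k) + (\<Sum>k\<in>{1..g (n * q)} \<inter> \<kappa> ` ?I. w k)"
      by (subst sum.Int_Diff[of _ _ "\<kappa> ` ?I"]) auto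
    also have "{1..g (n * q)} \<inter> \<kappa> ` ?I = \<kappa> ` {i \<in> ?I. u i \<le> t}" using iff K(2) by auto
    also have "(\<Sum>k\<in>\<kappa> ` {i \<in> ?I. u i \<le> t}. w k) = (\<Sum>i\<in>{i \<in> ?I. u i \<le> t}. w (\<kappa> i))"
      by (subst sum.reindex) (auto intro: inj_on_subset[OF K(1)])
    also have "\<dots> = (\<Sum>i\<in>?I. if u i \<le> t then w (\<kappa> i) else 0)" by (subst sum.inter_filter) auto
    finally have S: "(\<Sum>k=1..g (n * q). w k) = (\<Sum>k\<in>{1..g (n * q)} - \<kappa> ` ?I. w k) +
        (\<Sum>i\<in>?I. if u i \<le> t then w (\<kappa> i) else 0)" .
    have xi: "traj (step_sum l y u) t = (\<Sum>i\<in>?I. if u i \<le> t then y i else 0)"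
      unfolding traj_step_sum[OF t] using t by (intro sum.cong) (auto simp: indicator_def)
    let ?r = "((\<Sum>k\<in>{1..g (n * q)} - \<kappa> ` ?I. w k) - n * b * q) / n"
    have tri: "a = p + z \<Longrightarrow> \<bar>z\<bar> \<le> E \<Longrightarrow> \<bar>p\<bar> \<le> \<eta> / 2 \<Longrightarrow> E \<le> \<eta> / 2 \<Longrightarrow> \<bar>a\<bar> \<le> \<eta>"
      for a p z E :: real by linarith
    have "traj x q - traj (step_sum l y u) t = ?r +
        (\<Sum>i\<in>?I. (if u i \<le> t then w (\<kappa> i) else 0) / n - (if u i \<le> t then y i else 0))"
      using x q n unfolding driven_path_def
      by (simp only: xi S sum_subtractf sum_divide_distrib[symmetric]) (simp add: field_simps)
    moreover have "\<bar>\<Sum>i\<in>?I. (if u i \<le> t then w (\<kappa> i) else 0) / n - (if u i \<le> t then y i else 0)\<bar>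
        \<le> (\<Sum>i\<in>?I. e')"
    proof (intro order_trans[OF sum_abs] sum_mono)
      fix i assume i: "i \<in> ?I"
      show "\<bar>(if u i \<le> t then w (\<kappa> i) else 0) / n - (if u i \<le> t then y i else 0)\<bar> \<le> e'"
        using near_y[OF i] by auto
    qed
    moreover have "\<bar>?r\<bar> \<le> \<eta> / 2"
      using rest[OF q] n by (simp add: field_simps)
    moreover have "(\<Sum>i\<in>?I. e') \<le> \<eta> / 2" using e' by simp
    ultimately have "\<bar>traj x q - traj (step_sum l y u) t\<bar> \<le> \<eta>" by (rule tri)
    then show "\<bar>traj x (\<tau> t) - traj (step_sum l y u) t\<bar> \<le> \<eta>" by (simp add: q_def)
  qed
qed

end

declare One_nat_def [simp del]

section \<open>Truncated sums of independent heavy-tailed variables\<close>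

text \<open>After multiplication by \<open>1 + x\<close> the right side becomes
  \<open>1 + x^3\<close>, while the left side is at most 1.\<close>

lemma exp_minus_le_quadratic:
  fixes x :: real
  assumes "0 \<le> x"
  shows "exp (- x) \<le> 1 - x + x\<^sup>2"
proof -
  have "(1 + x) * exp (- x) \<le> exp x * exp (- x)"
    by (intro mult_right_mono exp_ge_add_one_self) auto
  also have "\<dots> \<le> (1 + x) * (1 - x + x\<^sup>2)"
    using assms by (simp add: exp_minus_inverse algebra_simps power2_eq_square)
  finally show ?thesis by (rule mult_left_le_imp_le) (use assms in simp)
qed

text \<open>Taylor bounds whose remainder carries the exponent \<open>q \<le> 2\<close>, suited to
  variables with a finite moment of order \<open>q\<close> only. For \<open>x \<le> 1\<close> the
  square is below \<open>x powr q\<close>; for \<open>x > 1\<close> the remainder alone dominates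
  \<open>exp x\<close> and \<open>x\<close>.\<close>

lemma exp_le_powr_correction:
  fixes x q :: real
  assumes "0 \<le> x" "1 \<le> q" "q \<le> 2"
  shows "exp x \<le> 1 + x + x powr q * exp x" and "exp (- x) \<le> 1 - x + x powr q * exp x"
proof -
  have sq: "x\<^sup>2 \<le> x powr q * exp x" if "x \<le> 1"
  proof (cases "x = 0")
    case False
    have "x\<^sup>2 = x powr 2" using assms by simp
    also have "\<dots> \<le> x powr q" using assms that by (intro powr_mono') auto
    also have "\<dots> \<le> x powr q * exp x" using assms by (simp add: mult_le_cancel_left1)
    finally show ?thesis .
  qed auto
  have big: "1 \<le> x powr q" "x \<le> x powr q" if "x > 1"
  proof -
    show "1 \<le> x powr q" using that assms by (intro ge_one_powr_ge_zero) auto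
    have "x powr 1 \<le> x powr q" using that assms by (intro powr_mono) auto
    then show "x \<le> x powr q" using that by simp
  qed
  show "exp x \<le> 1 + x + x powr q * exp x"
  proof (cases "x \<le> 1")
    case True
    then have "exp x \<le> 1 + x + x\<^sup>2" using assms by (intro exp_bound)
    then show ?thesis using sq[OF True] by simp
  next
    case False
    then have "1 * exp x \<le> x powr q * exp x" using big by (intro mult_right_mono) auto
    then show ?thesis using assms(1) by linarith
  qed
  show "exp (- x) \<le> 1 - x + x powr q * exp x"
  proof (cases "x \<le> 1")
    case True
    have "exp (- x) \<le> 1 - x + x\<^sup>2" using assms(1) by (rule exp_minus_le_quadratic)
    then show ?thesis using sq[OF True] by simp
  next
    case False
    have "exp (- x) \<le> 1" using assms by simp
    moreover have "x * 1 \<le> x powr q * exp x" using big False assms by (intro mult_mono) auto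
    ultimately show ?thesis by linarith
  qed
qed

lemma truncate_le_self: "0 \<le> x \<Longrightarrow> truncate a x \<le> x"
  by (simp add: truncate_def)

lemma measurable_truncate [measurable]: "truncate a \<in> borel_measurable borel"
  unfolding truncate_def by measurable

locale iid_positive = prob_space M for M :: "'a measure" +
  fixes W :: "nat \<Rightarrow> 'a \<Rightarrow> real"
  assumes W_indep: "indep_vars (\<lambda>_. borel) W {1..}"
    and W_ident: "\<forall>k\<ge>1. distr M borel (W k) = distr M borel (W 1)"
    and W_pos: "\<forall>k\<ge>1. AE \<omega> in M. 0 < W k \<omega>"
    and W_integrable: "integrable M (W 1)"
begin

definition mean :: real where "mean = expectation (W 1)"

definition tail_prob :: "real \<Rightarrow> real" where "tail_prob x = prob {\<omega> \<in> space M. x < W 1 \<omega>}"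

definition trunc_sum :: "real \<Rightarrow> nat \<Rightarrow> 'a \<Rightarrow> real" where
  "trunc_sum a m \<omega> = (\<Sum>k=1..m. truncate a (W k \<omega>))"

lemma W_measurable [measurable]: "1 \<le> k \<Longrightarrow> W k \<in> borel_measurable M"
  using W_indep by (auto simp: indep_vars_def2)

lemma trunc_sum_measurable [measurable]: "trunc_sum a m \<in> borel_measurable M"
  unfolding trunc_sum_def by measurable

lemma distr_W: "1 \<le> k \<Longrightarrow> distr M borel (W k) = distr M borel (W 1)"
  using W_ident by blast

lemma nn_integral_W:
  assumes "1 \<le> k" "h \<in> borel_measurable borel"
  shows "(\<integral>\<^sup>+\<omega>. h (W k \<omega>) \<partial>M) = (\<integral>\<^sup>+\<omega>. h (W 1 \<omega>) \<partial>M)"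
proof -
  have "(\<integral>\<^sup>+\<omega>. h (W j \<omega>) \<partial>M) = (\<integral>\<^sup>+x. h x \<partial>distr M borel (W j))" if "1 \<le> j" for j
    using that assms by (subst nn_integral_distr) auto
  from this[OF assms(1)] this[of 1] show ?thesis unfolding distr_W[OF assms(1)] by simp
qed

lemma prob_W:
  assumes "1 \<le> k" "B \<in> sets borel"
  shows "prob {\<omega> \<in> space M. W k \<omega> \<in> B} = prob {\<omega> \<in> space M. W 1 \<omega> \<in> B}"
proof -
  have "prob {\<omega> \<in> space M. W j \<omega> \<in> B} = measure (distr M borel (W j)) B" if "1 \<le> j" for j
    using that assms by (subst measure_distr) (auto simp: vimage_def Int_def conj_commute)
  from this[OF assms(1)] this[of 1] show ?thesis unfolding distr_W[OF assms(1)] by simp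
qed

lemma W_pos_all: "AE \<omega> in M. \<forall>k\<ge>1. 0 < W k \<omega>"
proof -
  have "AE \<omega> in M. \<forall>k. 1 \<le> k \<longrightarrow> 0 < W k \<omega>" using W_pos by (subst AE_all_countable) auto
  then show ?thesis by simp
qed

lemma tail_prob_nonneg: "0 \<le> tail_prob x" by (simp add: tail_prob_def)

text \<open>The range above \<open>a\<close> is cut into dyadic layers. On the layer above
  \<open>a * 2 ^ k\<close> the variable is at most \<open>a * 2 ^ Suc k\<close>, and the tail bound
  makes the resulting series geometric with ratio \<open>2 powr (q - s) < 1\<close>.\<close>

lemma moment_from_tail:
  assumes tail: "\<And>x. x \<ge> x0 \<Longrightarrow> tail_prob x \<le> C * x powr (- s)" and q: "0 \<le> q" "q < s"
  shows "integrable M (\<lambda>\<omega>. W 1 \<omega> powr q)"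
proof -
  define a where "a = max 1 x0"
  have a: "a \<ge> 1" "a \<ge> x0" by (auto simp: a_def)
  \<comment> \<open>The sign of \<open>C\<close> is not assumed; it follows because \<open>C\<close>
    bounds a probability.\<close>
  have "0 \<le> tail_prob a" by (rule tail_prob_nonneg)
  also have "tail_prob a \<le> C * a powr (- s)" using tail a by simp
  finally have C: "0 \<le> C" using a by (simp add: zero_le_mult_iff)
  let ?c = "\<lambda>k::nat. (a * 2 ^ Suc k) powr q"
  let ?E = "\<lambda>k::nat. {\<omega> \<in> space M. a * 2 ^ k < W 1 \<omega>}"
  have E [measurable]: "?E k \<in> sets M" for k by measurable
  have pw: "ennreal (W 1 \<omega> powr q) \<le> ennreal (a powr q) + (\<Sum>k. ennreal (?c k) * indicator (?E k) \<omega>)"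
    if \<omega>: "\<omega> \<in> space M" "0 < W 1 \<omega>" for \<omega>
  proof (cases "W 1 \<omega> \<le> a")
    case True
    then have "W 1 \<omega> powr q \<le> a powr q" using \<omega> q by (intro powr_mono2) auto
    then show ?thesis by (simp add: add_increasing2)
  next
    case False
    have "\<exists>j::nat. W 1 \<omega> / a < 2 ^ j" using real_arch_pow[of 2 "W 1 \<omega> / a"] by simp
    then have ex: "\<exists>j::nat. W 1 \<omega> \<le> a * 2 ^ j" using a
      by (metis (no_types) divide_less_eq less_imp_le less_le_trans mult.commute zero_less_one)
    define j where "j = (LEAST j::nat. W 1 \<omega> \<le> a * 2 ^ j)"
    have j: "W 1 \<omega> \<le> a * 2 ^ j" unfolding j_def using ex by (rule LeastI_ex)
    have "j \<noteq> 0" using j False by (metis mult_1_right power_0)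
    then obtain k where k: "j = Suc k" by (cases j) auto
    have "\<not> W 1 \<omega> \<le> a * 2 ^ k" using not_less_Least[of k "\<lambda>j. W 1 \<omega> \<le> a * 2 ^ j"] k j_def by auto
    then have ind: "indicator (?E k) \<omega> = (1::ennreal)" using \<omega> by simp
    define f where "f = (\<lambda>i. ennreal (?c i) * indicator (?E i) \<omega>)"
    have "W 1 \<omega> powr q \<le> ?c k" using j k \<omega> q by (intro powr_mono2) auto
    then have "ennreal (W 1 \<omega> powr q) \<le> f k"
      unfolding f_def by (subst ind) (simp add: ennreal_leI)
    also have "f k = sum f {k}" by simp
    also have "\<dots> \<le> suminf f" by (rule sum_le_suminf) auto
    also have "\<dots> = (\<Sum>i. ennreal (?c i) * indicator (?E i) \<omega>)" by (simp only: f_def)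
    finally show ?thesis by (simp add: add_increasing)
  qed
  have "(\<integral>\<^sup>+\<omega>. ennreal (W 1 \<omega> powr q) \<partial>M)
      \<le> (\<integral>\<^sup>+\<omega>. ennreal (a powr q) + (\<Sum>k. ennreal (?c k) * indicator (?E k) \<omega>) \<partial>M)"
  proof (rule nn_integral_mono_AE)
    have "AE \<omega> in M. 0 < W 1 \<omega>" using W_pos by simp
    with AE_space show "AE \<omega> in M. ennreal (W 1 \<omega> powr q) \<le>
        ennreal (a powr q) + (\<Sum>k. ennreal (?c k) * indicator (?E k) \<omega>)"
      by eventually_elim (rule pw)
  qed
  also have "\<dots> = ennreal (a powr q) + (\<Sum>k. ennreal (?c k) * emeasure M (?E k))"
    by (subst nn_integral_add) (auto simp: nn_integral_suminf nn_integral_cmult emeasure_space_1)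
  also have "(\<Sum>k. ennreal (?c k) * emeasure M (?E k))
      \<le> (\<Sum>k. ennreal ((2 * a) powr q * C * a powr (- s) * (2 powr (q - s)) ^ k))"
  proof (intro suminf_le allI)
    fix k :: nat
    have le: "a * 1 \<le> a * 2 ^ k" using a by (intro mult_left_mono) auto
    have pw2: "(2::real) ^ k = 2 powr real k" by (simp add: powr_realpow)
    have "emeasure M (?E k) = ennreal (tail_prob (a * 2 ^ k))"
      by (simp add: emeasure_eq_measure tail_prob_def)
    moreover have "tail_prob (a * 2 ^ k) \<le> C * (a * 2 ^ k) powr (- s)"
      using a le by (intro tail) linarith
    ultimately have "ennreal (?c k) * emeasure M (?E k) \<le> ennreal (?c k * (C * (a * 2 ^ k) powr (- s)))"
      by (simp add: ennreal_mult' ennreal_leI mult_left_mono)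
    also have "?c k * (C * (a * 2 ^ k) powr (- s)) =
        (2 * a) powr q * (2 powr real k) powr q * (C * (a powr (- s) * (2 powr real k) powr (- s)))"
    proof -
      have "?c k = (2 * a) powr q * (2 powr real k) powr q"
        using a by (simp add: powr_mult[symmetric] powr_realpow mult_ac)
      moreover have "(a * 2 ^ k) powr (- s) = a powr (- s) * (2 powr real k) powr (- s)"
        using a by (simp add: powr_mult powr_realpow)
      ultimately show ?thesis by (simp only:)
    qed
    also have "(2 * a) powr q * (2 powr real k) powr q * (C * (a powr (- s) * (2 powr real k) powr (- s))) =
        (2 * a) powr q * C * a powr (- s) * ((2 powr real k) powr q * (2 powr real k) powr (- s))"
      by (simp add: mult_ac)
    also have "(2 powr real k) powr q * (2 powr real k) powr (- s) = (2 powr (q - s)) ^ k"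
      by (simp add: powr_powr powr_add[symmetric] powr_realpow[symmetric] algebra_simps)
    finally show "ennreal (?c k) * emeasure M (?E k)
        \<le> ennreal ((2 * a) powr q * C * a powr (- s) * (2 powr (q - s)) ^ k)" .
  qed auto
  also have "\<dots> < \<infinity>"
  proof -
    have "(2::real) powr (q - s) < 2 powr 0" using q by (intro powr_less_mono) auto
    then have "summable (\<lambda>k. (2 * a) powr q * C * a powr (- s) * (2 powr (q - s)) ^ k)"
      by (intro summable_mult summable_geometric) simp
    then show ?thesis using C
      by (subst suminf_ennreal2) (auto intro!: mult_nonneg_nonneg)
  qed
  finally have "(\<integral>\<^sup>+\<omega>. ennreal (W 1 \<omega> powr q) \<partial>M) < \<infinity>" by (simp add: ennreal_add_eq_top less_top)
  then show ?thesis by (intro integrableI_bounded) auto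
qed

context
  fixes q :: real
  assumes q: "1 < q" "q \<le> 2" and moment: "integrable M (\<lambda>\<omega>. W 1 \<omega> powr q)"
begin

abbreviation mq :: real where "mq \<equiv> expectation (\<lambda>\<omega>. W 1 \<omega> powr q)"

lemma truncate_integrable: "integrable M (\<lambda>\<omega>. truncate a (W 1 \<omega>))"
  by (rule Bochner_Integration.integrable_bound[OF W_integrable]) (auto simp: truncate_def)

text \<open>Where \<open>W 1\<close> exceeds \<open>a\<close>, it equals
  \<open>W 1 powr (1 - q) * W 1 powr q\<close>, and the first factor is at most
  \<open>a powr (1 - q)\<close> as \<open>q > 1\<close>. The truncation bias thus vanishes as
  \<open>a\<close> grows.\<close>

lemma truncated_mean:
  assumes "a > 0"
  shows "expectation (\<lambda>\<omega>. truncate a (W 1 \<omega>)) \<le> mean"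
    and "mean \<le> expectation (\<lambda>\<omega>. truncate a (W 1 \<omega>)) + a powr (1 - q) * mq"
proof -
  have pos: "AE \<omega> in M. 0 < W 1 \<omega>" using W_pos by simp
  show "expectation (\<lambda>\<omega>. truncate a (W 1 \<omega>)) \<le> mean" unfolding mean_def
    using pos by (intro integral_mono_AE truncate_integrable W_integrable)
      (auto elim!: AE_mp simp: truncate_le_self)
  have "mean \<le> expectation (\<lambda>\<omega>. truncate a (W 1 \<omega>) + a powr (1 - q) * W 1 \<omega> powr q)"
    unfolding mean_def
  proof (intro integral_mono_AE W_integrable Bochner_Integration.integrable_add truncate_integrable
      integrable_mult_right moment)
    show "AE \<omega> in M. W 1 \<omega> \<le> truncate a (W 1 \<omega>) + a powr (1 - q) * W 1 \<omega> powr q"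
      using pos
    proof eventually_elim
      case (elim \<omega>)
      show ?case
      proof (cases "W 1 \<omega> \<le> a")
        case False
        have "W 1 \<omega> = W 1 \<omega> powr (1 - q) * W 1 \<omega> powr q" using elim by (simp add: powr_add[symmetric])
        also have "\<dots> \<le> a powr (1 - q) * W 1 \<omega> powr q"
          using False assms q by (intro mult_right_mono powr_mono2') auto
        finally show ?thesis using False by (simp add: truncate_def)
      qed (simp add: truncate_def)
    qed
  qed
  also have "\<dots> = expectation (\<lambda>\<omega>. truncate a (W 1 \<omega>)) + a powr (1 - q) * mq"
    using truncate_integrable[of a] moment by simp
  finally show "mean \<le> expectation (\<lambda>\<omega>. truncate a (W 1 \<omega>)) + a powr (1 - q) * mq" .
qed

text \<open>The remainder in \<open>exp_le_powr_correction\<close> is at most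
  \<open>\<theta> powr q * W 1 powr q * exp (\<theta> * a)\<close>, since truncation bounds the
  exponent by \<open>\<theta> * a\<close>. Taking expectations and using
  \<open>1 + z \<le> exp z\<close> finishes; \<open>\<sigma>\<close> serves both tails at
  once.\<close>

lemma mgf_truncate:
  assumes \<theta>: "\<theta> > 0" and a: "a > 0" and \<sigma>: "\<sigma> = 1 \<or> \<sigma> = -1"
  shows "(\<integral>\<^sup>+\<omega>. ennreal (exp (\<sigma> * \<theta> * truncate a (W 1 \<omega>))) \<partial>M) \<le>
    ennreal (exp (\<sigma> * \<theta> * expectation (\<lambda>\<omega>. truncate a (W 1 \<omega>)) + \<theta> powr q * mq * exp (\<theta> * a)))"
proof -
  let ?T = "\<lambda>\<omega>. truncate a (W 1 \<omega>)"
  let ?B = "\<lambda>\<omega>. 1 + \<sigma> * \<theta> * ?T \<omega> + \<theta> powr q * exp (\<theta> * a) * W 1 \<omega> powr q"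
  have pos: "AE \<omega> in M. 0 < W 1 \<omega>" using W_pos by simp
  have le: "AE \<omega> in M. exp (\<sigma> * \<theta> * ?T \<omega>) \<le> ?B \<omega>"
    using pos
  proof eventually_elim
    case (elim \<omega>)
    let ?x = "\<theta> * ?T \<omega>"
    have T: "0 \<le> ?T \<omega>" "?T \<omega> \<le> a" "?T \<omega> \<le> W 1 \<omega>"
      using elim a by (auto simp: truncate_def)
    then have x: "0 \<le> ?x" "?x \<le> \<theta> * a" using \<theta> by auto
    have "?x powr q * exp ?x \<le> (\<theta> powr q * W 1 \<omega> powr q) * exp (\<theta> * a)"
      using T x \<theta> q by (intro mult_mono) (auto simp: powr_mult intro!: mult_left_mono powr_mono2)
    moreover have "exp (\<sigma> * ?x) \<le> 1 + \<sigma> * ?x + ?x powr q * exp ?x"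
      using \<sigma> exp_le_powr_correction[OF x(1), of q] q by auto
    ultimately show ?case by (simp add: mult_ac)
  qed
  have int: "integrable M ?B"
    by (intro Bochner_Integration.integrable_add integrable_mult_right truncate_integrable moment) auto
  have "(\<integral>\<^sup>+\<omega>. ennreal (exp (\<sigma> * \<theta> * ?T \<omega>)) \<partial>M) \<le> (\<integral>\<^sup>+\<omega>. ennreal (?B \<omega>) \<partial>M)"
    using le by (intro nn_integral_mono_AE) (auto elim!: AE_mp intro!: ennreal_leI)
  also have "\<dots> = ennreal (expectation ?B)"
    using le by (intro nn_integral_eq_integral int) (auto elim!: AE_mp intro: order_trans[OF exp_ge_zero])
  also have "expectation ?B = 1 + (\<sigma> * \<theta> * expectation ?T + \<theta> powr q * mq * exp (\<theta> * a))"
    using truncate_integrable[of a] moment by (simp add: prob_space mult_ac)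
  also have "\<dots> \<le> exp (\<sigma> * \<theta> * expectation ?T + \<theta> powr q * mq * exp (\<theta> * a))"
    by (rule exp_ge_add_one_self)
  finally show ?thesis by (simp add: ennreal_leI)
qed

text \<open>The exponential moment inequality with independence. Centring at the truncated mean
  cancels the linear terms of the \<open>m\<close> factors and leaves only the corrections of order
  \<open>q\<close>.\<close>

lemma chernoff_trunc_sum:
  assumes \<theta>: "\<theta> > 0" and a: "a > 0" and \<sigma>: "\<sigma> = 1 \<or> \<sigma> = -1"
  shows "prob {\<omega> \<in> space M. \<sigma> * (trunc_sum a m \<omega> - m * expectation (\<lambda>\<omega>. truncate a (W 1 \<omega>))) > s} \<le>
    exp (- \<theta> * s + m * (\<theta> powr q * mq * exp (\<theta> * a)))"
proof -
  let ?T = "\<lambda>k \<omega>. truncate a (W k \<omega>)"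
  let ?\<mu> = "expectation (?T 1)"
  let ?A = "{\<omega> \<in> space M. \<sigma> * (trunc_sum a m \<omega> - m * ?\<mu>) > s}"
  let ?c = "exp (- \<theta> * s - \<sigma> * \<theta> * (m * ?\<mu>))"
  have "emeasure M ?A = (\<integral>\<^sup>+\<omega>. indicator ?A \<omega> \<partial>M)" by (subst nn_integral_indicator) auto
  also have "\<dots> \<le> (\<integral>\<^sup>+\<omega>. ennreal ?c * (\<Prod>k\<in>{1..m}. ennreal (exp (\<sigma> * \<theta> * ?T k \<omega>))) \<partial>M)"
  proof (intro nn_integral_mono)
    fix \<omega> assume \<omega>: "\<omega> \<in> space M"
    have eq: "ennreal ?c * (\<Prod>k\<in>{1..m}. ennreal (exp (\<sigma> * \<theta> * ?T k \<omega>))) =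
        ennreal (exp (\<theta> * (\<sigma> * (trunc_sum a m \<omega> - m * ?\<mu>) - s)))"
      by (subst prod_ennreal) (auto simp: ennreal_mult[symmetric] exp_sum[symmetric] exp_add[symmetric]
          trunc_sum_def sum_distrib_left algebra_simps)
    show "indicator ?A \<omega> \<le> ennreal ?c * (\<Prod>k\<in>{1..m}. ennreal (exp (\<sigma> * \<theta> * ?T k \<omega>)))"
      unfolding eq using \<theta> by (auto simp: indicator_def ennreal_1[symmetric] simp del: ennreal_1 intro!: ennreal_leI)
  qed
  also have "\<dots> = ennreal ?c * (\<integral>\<^sup>+\<omega>. (\<Prod>k\<in>{1..m}. ennreal (exp (\<sigma> * \<theta> * ?T k \<omega>))) \<partial>M)"
    by (intro nn_integral_cmult) (auto intro!: borel_measurable_prod_ennreal)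
  also have "(\<integral>\<^sup>+\<omega>. (\<Prod>k\<in>{1..m}. ennreal (exp (\<sigma> * \<theta> * ?T k \<omega>))) \<partial>M) =
      (\<Prod>k\<in>{1..m}. \<integral>\<^sup>+\<omega>. ennreal (exp (\<sigma> * \<theta> * ?T k \<omega>)) \<partial>M)"
    by (intro indep_vars_nn_integral indep_vars_compose2[OF indep_vars_subset[OF W_indep]]) auto
  also have "\<dots> = (\<Prod>k\<in>{1..m}. \<integral>\<^sup>+\<omega>. ennreal (exp (\<sigma> * \<theta> * ?T 1 \<omega>)) \<partial>M)"
    by (intro prod.cong refl nn_integral_W[where h = "\<lambda>x. ennreal (exp (\<sigma> * \<theta> * truncate a x))"]) auto
  also have "\<dots> \<le> (\<Prod>k\<in>{1..m}. ennreal (exp (\<sigma> * \<theta> * ?\<mu> + \<theta> powr q * mq * exp (\<theta> * a))))"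
    by (intro prod_mono_ennreal mgf_truncate assms)
  also have "\<dots> = ennreal (exp (m * (\<sigma> * \<theta> * ?\<mu> + \<theta> powr q * mq * exp (\<theta> * a))))"
    by (simp add: ennreal_power exp_of_nat_mult[symmetric])
  finally have "emeasure M ?A \<le> ennreal ?c * \<dots>" by (simp add: mult_left_mono)
  also have "\<dots> = ennreal (exp (- \<theta> * s + m * (\<theta> powr q * mq * exp (\<theta> * a))))"
    by (simp add: ennreal_mult[symmetric] exp_add[symmetric] algebra_simps)
  finally show ?thesis by (simp add: emeasure_eq_measure)
qed

end

end

section \<open>Regularly varying tails\<close>

text \<open>Induction over doublings, matched to regular variation: only the ratio of
  \<open>f (2 * x)\<close> to \<open>f x\<close> has to be controlled, and the base interval absorbs
  the constant.\<close>

lemma dyadic_induct: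
  fixes x0 :: real
  assumes x0: "x0 > 0" and base: "\<And>x. x0 \<le> x \<Longrightarrow> x \<le> 2 * x0 \<Longrightarrow> P x"
    and step: "\<And>x. x0 \<le> x \<Longrightarrow> P x \<Longrightarrow> P (2 * x)" and x: "x0 \<le> x"
  shows "P x"
proof -
  have *: "\<forall>x. x0 \<le> x \<longrightarrow> x \<le> 2 ^ Suc k * x0 \<longrightarrow> P x" for k
  proof (induction k)
    case 0
    then show ?case using base by simp
  next
    case (Suc k)
    show ?case
    proof (intro allI impI)
      fix x assume "x0 \<le> x" "x \<le> 2 ^ Suc (Suc k) * x0"
      then show "P x" using base[of x] step[of "x / 2"] Suc.IH
        by (cases "x \<le> 2 * x0") auto
    qed
  qed
  obtain k where "x / x0 < 2 ^ k" using real_arch_pow[of 2 "x / x0"] by auto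
  then have "x < 2 ^ k * x0" using x0 by (simp add: pos_divide_less_eq)
  also have "\<dots> \<le> 2 ^ Suc k * x0" using x0 by simp
  finally show ?thesis using *[of k] x by simp
qed

locale regularly_varying_tail =
  fixes f :: "real \<Rightarrow> real" and \<beta> :: real
  assumes rv: "regularly_varying f (- \<beta>)" and antimono_f: "antimono f" and \<beta>_pos: "\<beta> > 0"
begin

lemma ratio: "c > 0 \<Longrightarrow> ((\<lambda>x. f (c * x) / f x) \<longlongrightarrow> c powr (- \<beta>)) at_top"
  and pos: "\<forall>\<^sub>F x in at_top. 0 < f x"
  using rv unfolding regularly_varying_def by auto

lemma f_le: "x \<le> y \<Longrightarrow> f y \<le> f x" using antimono_f by (rule antimonoD)

lemma f_pos: "0 < f x"
proof -
  obtain y where "0 < f y" "x \<le> y"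
    using eventually_happens[OF eventually_conj[OF pos eventually_ge_at_top[of x]]] by auto
  then show ?thesis using f_le[of x y] by simp
qed

text \<open>The limit \<open>2 powr (- \<beta>)\<close> of the doubling ratio is strictly below
  \<open>2 powr (- s)\<close>, so \<open>f\<close> eventually loses at least this factor at every
  doubling. Monotonicity gives the bound on the base interval, which fixes \<open>C\<close>.\<close>

lemma upper_powr_bound:
  assumes "s < \<beta>" "0 \<le> s"
  obtains x0 C where "x0 > 0" "\<And>x. x0 \<le> x \<Longrightarrow> f x \<le> C * x powr (- s)"
proof -
  have "(2::real) powr (- \<beta>) < 2 powr (- s)" using assms by (intro powr_less_mono) auto
  then have "\<forall>\<^sub>F x in at_top. f (2 * x) / f x < 2 powr (- s)"
    using ratio[of 2] by (intro order_tendstoD) auto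
  then have "\<forall>\<^sub>F x in at_top. f (2 * x) \<le> 2 powr (- s) * f x"
    by (rule eventually_mono) (auto simp: f_pos pos_divide_less_eq)
  then obtain x1 where x1: "\<And>x. x \<ge> x1 \<Longrightarrow> f (2 * x) \<le> 2 powr (- s) * f x"
    by (auto simp: eventually_at_top_linorder)
  define x0 where "x0 = max 1 x1"
  have x0: "x0 > 0" "x0 \<ge> x1" by (auto simp: x0_def)
  define C where "C = f x0 * (2 * x0) powr s"
  have "f x \<le> C * x powr (- s)" if "x0 \<le> x" for x
    using x0(1) _ _ that
  proof (rule dyadic_induct)
    fix x assume x: "x0 \<le> x" "x \<le> 2 * x0"
    have "f x * 1 \<le> f x0 * ((2 * x0) powr s * x powr (- s))"
    proof (intro mult_mono f_le x)
      have "x powr s * x powr (- s) \<le> (2 * x0) powr s * x powr (- s)"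
        using x x0 assms by (intro mult_right_mono powr_mono2) auto
      then show "1 \<le> (2 * x0) powr s * x powr (- s)" using x x0 by (simp add: powr_add[symmetric])
    qed (auto intro: less_imp_le f_pos)
    then show "f x \<le> C * x powr (- s)" by (simp add: C_def mult_ac)
  next
    fix x assume x: "x0 \<le> x" "f x \<le> C * x powr (- s)"
    have "f (2 * x) \<le> 2 powr (- s) * f x" using x x0 by (intro x1) auto
    also have "\<dots> \<le> 2 powr (- s) * (C * x powr (- s))" using x by (intro mult_left_mono) auto
    also have "\<dots> = C * (2 * x) powr (- s)" using x x0 by (simp add: powr_mult)
    finally show "f (2 * x) \<le> C * (2 * x) powr (- s)" .
  qed
  then show thesis using that x0 by blast
qed

text \<open>The mirror image of \<open>upper_powr_bound\<close>: for \<open>s > \<beta>\<close> each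
  doubling eventually costs at most the factor \<open>2 powr (- s)\<close>.\<close>

lemma lower_powr_bound:
  assumes "s > \<beta>"
  obtains x0 c where "x0 > 0" "c > 0" "\<And>x. x0 \<le> x \<Longrightarrow> c * x powr (- s) \<le> f x"
proof -
  have s: "s > 0" using assms \<beta>_pos by simp
  have "(2::real) powr (- s) < 2 powr (- \<beta>)" using assms by (intro powr_less_mono) auto
  then have "\<forall>\<^sub>F x in at_top. 2 powr (- s) < f (2 * x) / f x"
    using ratio[of 2] by (intro order_tendstoD) auto
  then have "\<forall>\<^sub>F x in at_top. 2 powr (- s) * f x \<le> f (2 * x)"
    by (rule eventually_mono) (auto simp: f_pos pos_less_divide_eq)
  then obtain x1 where x1: "\<And>x. x \<ge> x1 \<Longrightarrow> 2 powr (- s) * f x \<le> f (2 * x)"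
    by (auto simp: eventually_at_top_linorder)
  define x0 where "x0 = max 1 x1"
  have x0: "x0 > 0" "x0 \<ge> x1" by (auto simp: x0_def)
  define c where "c = f (2 * x0) * x0 powr s"
  have "c * x powr (- s) \<le> f x" if "x0 \<le> x" for x
    using x0(1) _ _ that
  proof (rule dyadic_induct)
    fix x assume x: "x0 \<le> x" "x \<le> 2 * x0"
    have "f (2 * x0) * (x0 powr s * x powr (- s)) \<le> f x * 1"
    proof (intro mult_mono f_le x)
      have "x0 powr s * x powr (- s) \<le> x powr s * x powr (- s)"
        using x x0 s by (intro mult_right_mono powr_mono2) auto
      then show "x0 powr s * x powr (- s) \<le> 1" using x x0 by (simp add: powr_add[symmetric])
    qed (auto intro: less_imp_le f_pos)
    then show "c * x powr (- s) \<le> f x" by (simp add: c_def mult_ac)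
  next
    fix x assume x: "x0 \<le> x" "c * x powr (- s) \<le> f x"
    have "c * (2 * x) powr (- s) = 2 powr (- s) * (c * x powr (- s))" using x x0 by (simp add: powr_mult)
    also have "\<dots> \<le> 2 powr (- s) * f x" using x by (intro mult_left_mono) auto
    also have "\<dots> \<le> f (2 * x)" using x x0 by (intro x1) auto
    finally show "c * (2 * x) powr (- s) \<le> f (2 * x)" .
  qed
  moreover have "c > 0" using f_pos x0 by (simp add: c_def)
  ultimately show thesis using that x0 by blast
qed

lemma scale_bound:
  assumes "c > 0"
  obtains C where "C > 0" "\<forall>\<^sub>F x in at_top. f (c * x) \<le> C * f x"
proof -
  have "\<forall>\<^sub>F x in at_top. f (c * x) / f x < c powr (- \<beta>) + 1"
    using ratio[OF assms] by (intro order_tendstoD) auto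
  then have "\<forall>\<^sub>F x in at_top. f (c * x) \<le> (c powr (- \<beta>) + 1) * f x"
    by (rule eventually_mono) (auto simp: f_pos pos_divide_less_eq)
  moreover have "c powr (- \<beta>) + 1 > 0" using powr_ge_zero[of c "- \<beta>"] by linarith
  ultimately show thesis using that by blast
qed

text \<open>The limit of the difference divided by \<open>f x\<close> is positive since
  \<open>powr (- \<beta>)\<close> is strictly decreasing; half of it serves as \<open>c\<close>.
  Applied to X(1), this gives a window of values a probability of order \<open>f\<close>.\<close>

lemma difference_bound:
  assumes "0 < a" "a < b"
  obtains c where "c > 0" "\<forall>\<^sub>F x in at_top. c * f x \<le> f (a * x) - f (b * x)"
proof -
  define c where "c = (a powr (- \<beta>) - b powr (- \<beta>)) / 2"
  have "b powr (- \<beta>) < a powr (- \<beta>)" using assms \<beta>_pos by (intro powr_less_mono2_neg) auto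
  then have c: "c > 0" "c < a powr (- \<beta>) - b powr (- \<beta>)" by (auto simp: c_def)
  have "((\<lambda>x. f (a * x) / f x - f (b * x) / f x) \<longlongrightarrow> a powr (- \<beta>) - b powr (- \<beta>)) at_top"
    using assms by (intro tendsto_diff ratio) auto
  then have "\<forall>\<^sub>F x in at_top. c < f (a * x) / f x - f (b * x) / f x"
    using c by (intro order_tendstoD) auto
  then have "\<forall>\<^sub>F x in at_top. c * f x \<le> f (a * x) - f (b * x)"
  proof eventually_elim
    case (elim x)
    then have "c < (f (a * x) - f (b * x)) / f x" by (simp add: diff_divide_distrib)
    then show ?case using f_pos[of x] by (simp add: pos_less_divide_eq)
  qed
  then show thesis using that c by blast
qed

end

section \<open>Concentration of truncated sums\<close>

context iid_positive
begin

text \<open>Apply \<open>chernoff_trunc_sum\<close> with \<open>a = n * \<gamma>\<close> and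
  \<open>\<theta> = L * ln n / n\<close>. The main term is \<open>n powr (- (K + 2))\<close>. The
  correction is at most a constant times
  \<open>n * (ln n / n) powr q * n powr (L * \<gamma>)\<close>, which tends to 0 if
  \<open>L * \<gamma> \<le> (q - 1) / 2\<close>. The two spare powers of \<open>n\<close> pay for
  the union over \<open>m\<close> and both signs.\<close>

lemma trunc_sum_concentration:
  fixes q \<delta> C K :: real
  assumes q: "1 < q" "q \<le> 2" and moment: "integrable M (\<lambda>\<omega>. W 1 \<omega> powr q)"
    and \<delta>: "\<delta> > 0" and C: "C > 0" and K: "K > 0"
  shows "\<exists>\<gamma>0>0. \<forall>\<gamma>. 0 < \<gamma> \<and> \<gamma> \<le> \<gamma>0 \<longrightarrow> (\<forall>\<^sub>F n in sequentially.
    prob {\<omega> \<in> space M. \<exists>m. real m \<le> C * real n \<and> \<bar>trunc_sum (real n * \<gamma>) m \<omega> - m * mean\<bar> > \<delta> * n}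
      \<le> real n powr (- K))"
proof -
  \<comment> \<open>Chosen so that \<open>\<theta> * (\<delta> * n / 2) = (K + 2) * ln n\<close>;
    the other half of \<open>\<delta> * n\<close> is reserved for the truncation bias.\<close>
  define L where "L = 2 * (K + 2) / \<delta>"
  define Q where "Q = expectation (\<lambda>\<omega>. W 1 \<omega> powr q)"
  have L: "L > 0" using K \<delta> by (simp add: L_def)
  have Q: "Q \<ge> 0" by (auto simp: Q_def)
  define \<gamma>0 where "\<gamma>0 = (q - 1) / (2 * L)"
  have "\<gamma>0 > 0" using L q by (simp add: \<gamma>0_def)
  moreover have "\<forall>\<^sub>F n in sequentially.
      prob {\<omega> \<in> space M. \<exists>m. real m \<le> C * real n \<and> \<bar>trunc_sum (real n * \<gamma>) m \<omega> - m * mean\<bar> > \<delta> * n}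
        \<le> real n powr (- K)" if \<gamma>: "0 < \<gamma>" "\<gamma> \<le> \<gamma>0" for \<gamma>
  proof -
    define p where "p = q - 1"
    have p: "p > 0" "q = p + 1" using q by (auto simp: p_def)
    \<comment> \<open>The limits behind \<open>e1\<close>, \<open>e2\<close> and \<open>e3\<close>
      control in turn the truncation bias, the Chernoff correction and the number of events in the
      union bound.\<close>
    have "(\<lambda>n. C * (Q * (real n * \<gamma>) powr (- p))) \<longlonglongrightarrow> 0" using \<gamma> p by real_asymp
    then have e1: "\<forall>\<^sub>F n in sequentially. C * (Q * (real n * \<gamma>) powr (- p)) < \<delta> / 2"
      using \<delta> by (intro order_tendstoD) auto
    have "(\<lambda>n. C * Q * (real n * ((L * ln (real n) / real n) powr (p + 1) * real n powr (p / 2)))) \<longlonglongrightarrow> 0"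
      using p L by real_asymp
    then have e2: "\<forall>\<^sub>F n in sequentially.
        C * Q * (real n * ((L * ln (real n) / real n) powr (p + 1) * real n powr (p / 2))) < 1"
      by (intro order_tendstoD) auto
    have "(\<lambda>n. (C * real n + 1) * 2 * exp 1 / real n powr 2) \<longlonglongrightarrow> 0" using C by real_asymp
    then have e3: "\<forall>\<^sub>F n in sequentially. (C * real n + 1) * 2 * exp 1 / real n powr 2 < 1"
      by (intro order_tendstoD) auto
    show ?thesis using e1 e2 e3 eventually_ge_at_top[of 2]
    proof eventually_elim
      case (elim n)
      then have n: "real n \<ge> 2" "n \<ge> 2" by auto
      define a where "a = real n * \<gamma>"
      define \<theta> where "\<theta> = L * ln (real n) / real n"
      define \<mu> where "\<mu> = expectation (\<lambda>\<omega>. truncate a (W 1 \<omega>))"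
      have a: "a > 0" using n \<gamma> by (simp add: a_def)
      have \<theta>: "\<theta> > 0" using L n by (simp add: \<theta>_def)
      let ?S = "\<lambda>\<sigma> m. {\<omega> \<in> space M. \<sigma> * (trunc_sum a m \<omega> - real m * \<mu>) > \<delta> * n / 2}"
      define D where "D = exp 1 * real n powr (- (K + 2))"
      have S: "prob (?S \<sigma> m) \<le> D" if m: "real m \<le> C * n" and \<sigma>: "\<sigma> = 1 \<or> \<sigma> = -1" for \<sigma> m
      proof -
        have "prob (?S \<sigma> m) \<le> exp (- \<theta> * (\<delta> * n / 2) + m * (\<theta> powr q * Q * exp (\<theta> * a)))"
          unfolding \<mu>_def Q_def by (rule chernoff_trunc_sum[OF q moment \<theta> a \<sigma>])
        also have "\<theta> * a = L * \<gamma> * ln n" using n by (simp add: \<theta>_def a_def)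
        also have "- \<theta> * (\<delta> * n / 2) = - (K + 2) * ln n" using n \<delta> by (simp add: \<theta>_def L_def field_simps)
        also have "exp (- (K + 2) * ln n + m * (\<theta> powr q * Q * exp (L * \<gamma> * ln n)))
            \<le> exp (- (K + 2) * ln n + 1)"
        proof -
          have "L * \<gamma> * ln n \<le> p / 2 * ln n"
            using \<gamma>(2) L n by (intro mult_right_mono) (auto simp: \<gamma>0_def p_def field_simps)
          then have "exp (L * \<gamma> * ln n) \<le> real n powr (p / 2)" using n by (simp add: powr_def)
          then have "m * (\<theta> powr q * Q * exp (L * \<gamma> * ln n)) \<le> (C * n) * (\<theta> powr q * Q * real n powr (p / 2))"
            using m Q C by (intro mult_mono mult_left_mono mult_nonneg_nonneg) auto
          also have "\<dots> = C * Q * (real n * (\<theta> powr (p + 1) * real n powr (p / 2)))" using p by simp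
          also have "\<dots> \<le> 1" using elim(2) by (simp add: \<theta>_def)
          finally show ?thesis by simp
        qed
        also have "\<dots> = D" using n by (simp add: D_def powr_def exp_add)
        finally show ?thesis .
      qed
      let ?J = "{m. real m \<le> C * n}"
      have J_sub: "?J \<subseteq> {..nat \<lfloor>C * n\<rfloor>}" using C n by (auto simp: le_nat_iff le_floor_iff)
      then have J: "finite ?J" by (rule finite_subset) simp
      have "card ?J \<le> card {..nat \<lfloor>C * n\<rfloor>}" using J_sub by (intro card_mono) auto
      then have "real (card ?J) \<le> real (nat \<lfloor>C * n\<rfloor>) + 1" by simp
      also have "\<dots> \<le> C * n + 1" using C n by simp
      finally have cardJ: "real (card ?J) \<le> C * n + 1" .
      let ?B = "{\<omega> \<in> space M. \<exists>m. real m \<le> C * n \<and> \<bar>trunc_sum a m \<omega> - m * mean\<bar> > \<delta> * n}"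
      have "?B \<subseteq> (\<Union>m\<in>?J. ?S 1 m \<union> ?S (-1) m)"
      proof
        fix \<omega> assume "\<omega> \<in> ?B"
        then obtain m where m: "\<omega> \<in> space M" "real m \<le> C * n" "\<bar>trunc_sum a m \<omega> - m * mean\<bar> > \<delta> * n" by auto
        have mu: "\<mu> \<le> mean" "mean \<le> \<mu> + a powr (1 - q) * Q"
          unfolding \<mu>_def Q_def using truncated_mean[OF q moment a] by auto
        have "\<bar>m * \<mu> - m * mean\<bar> = m * (mean - \<mu>)" using mult_left_mono[OF mu(1), of "real m"]
          by (simp add: right_diff_distrib)
        also have "\<dots> \<le> (C * n) * (a powr (1 - q) * Q)"
          using m mu Q C n by (intro mult_mono) auto
        also have "\<dots> = n * (C * (Q * (real n * \<gamma>) powr (- p)))" by (simp add: a_def p_def)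
        also have "\<dots> \<le> n * (\<delta> / 2)" using elim(1) by (intro mult_left_mono) auto
        finally have close: "\<bar>m * \<mu> - m * mean\<bar> \<le> \<delta> * n / 2" by (simp add: mult.commute)
        have tri: "\<bar>y - z\<bar> \<le> D / 2 \<Longrightarrow> D < \<bar>x - z\<bar> \<Longrightarrow> D / 2 < \<bar>x - y\<bar>" for x y z D :: real
          by linarith
        have "\<bar>trunc_sum a m \<omega> - m * \<mu>\<bar> > \<delta> * n / 2" by (rule tri[OF close m(3)])
        then have "\<omega> \<in> ?S 1 m \<union> ?S (-1) m" using m(1) by (auto simp: abs_if split: if_splits)
        then show "\<omega> \<in> (\<Union>m\<in>?J. ?S 1 m \<union> ?S (-1) m)" using m(2) by blast
      qed
      then have "prob ?B \<le> prob (\<Union>m\<in>?J. ?S 1 m \<union> ?S (-1) m)"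
        using J by (intro finite_measure_mono) auto
      also have "\<dots> \<le> (\<Sum>m\<in>?J. prob (?S 1 m \<union> ?S (-1) m))"
        using J by (intro finite_measure_subadditive_finite) auto
      also have "\<dots> \<le> (\<Sum>m\<in>?J. 2 * D)"
      proof (intro sum_mono)
        fix m assume "m \<in> ?J"
        then have "prob (?S 1 m) \<le> D" "prob (?S (-1) m) \<le> D" using S[of m 1] S[of m "-1"] by blast+
        moreover have "prob (?S 1 m \<union> ?S (-1) m) \<le> prob (?S 1 m) + prob (?S (-1) m)"
          by (intro measure_Un_le) auto
        ultimately show "prob (?S 1 m \<union> ?S (-1) m) \<le> 2 * D" by linarith
      qed
      also have "\<dots> = card ?J * (2 * D)" by simp
      also have "\<dots> \<le> (C * n + 1) * (2 * D)" using cardJ by (intro mult_right_mono) (auto simp: D_def)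
      also have "D = exp 1 * (real n powr (- K) / real n powr 2)"
        using powr_diff[of "real n" "- K" 2] by (simp add: D_def)
      also have "(C * n + 1) * (2 * (exp 1 * (real n powr (- K) / real n powr 2))) =
          ((C * n + 1) * 2 * exp 1 / real n powr 2) * real n powr (- K)" by simp
      also have "\<dots> \<le> 1 * real n powr (- K)" using elim(3) by (intro mult_right_mono) auto
      finally show ?case by (simp add: a_def)
    qed
  qed
  ultimately show ?thesis by blast
qed

end

section \<open>The compound Poisson process\<close>

locale compound_poisson = iid_positive M W
  for M :: "'a measure" and W :: "nat \<Rightarrow> 'a \<Rightarrow> real" +
  fixes N :: "real \<Rightarrow> 'a \<Rightarrow> nat" and r :: real
  assumes poisson: "poisson_process M r N"
    and N_W_indep: "indep_set
          (sets (vimage_algebra (space M) (\<lambda>\<omega>. \<lambda>t\<in>{0..}. N t \<omega>) (\<Pi>\<^sub>M t\<in>{0..}. count_space UNIV)))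
          (sets (vimage_algebra (space M) (\<lambda>\<omega>. \<lambda>k\<in>{1..}. W k \<omega>) (\<Pi>\<^sub>M k\<in>{1..}. borel)))"
begin

text \<open>The two \<sigma>-algebras of the independence hypothesis. Probabilities of joint events
  factor once each part is shown to be measurable with respect to one of them.\<close>

definition sigma_N :: "'a measure" where
  "sigma_N = vimage_algebra (space M) (\<lambda>\<omega>. \<lambda>t\<in>{0..}. N t \<omega>) (\<Pi>\<^sub>M t\<in>{0..}. count_space UNIV)"

definition sigma_W :: "'a measure" where
  "sigma_W = vimage_algebra (space M) (\<lambda>\<omega>. \<lambda>k\<in>{1..}. W k \<omega>) (\<Pi>\<^sub>M k\<in>{1..}. borel)"

lemma space_sigma [simp]: "space sigma_N = space M" "space sigma_W = space M"
  by (simp_all add: sigma_N_def sigma_W_def)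

lemma N_sigma_N [measurable]:
  assumes "0 \<le> t"
  shows "N t \<in> measurable sigma_N (count_space UNIV)"
proof -
  have "(\<lambda>\<omega>. \<lambda>t\<in>{0..}. N t \<omega>) \<in> measurable sigma_N (\<Pi>\<^sub>M t\<in>{0..}. count_space UNIV)"
    unfolding sigma_N_def by (intro measurable_vimage_algebra1) (auto simp: space_PiM)
  from measurable_compose[OF this measurable_component_singleton, of t] show ?thesis
    using assms by simp
qed

lemma W_sigma_W [measurable]:
  assumes "1 \<le> k"
  shows "W k \<in> borel_measurable sigma_W"
proof -
  have "(\<lambda>\<omega>. \<lambda>k\<in>{1..}. W k \<omega>) \<in> measurable sigma_W (\<Pi>\<^sub>M k\<in>{1..}. borel)"
    unfolding sigma_W_def by (intro measurable_vimage_algebra1) (auto simp: space_PiM)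
  from measurable_compose[OF this measurable_component_singleton, of k] show ?thesis
    using assms by simp
qed

lemma sets_sigma_subset: "sets sigma_N \<subseteq> sets M" "sets sigma_W \<subseteq> sets M"
  using indep_setD_ev1[OF N_W_indep] indep_setD_ev2[OF N_W_indep] by (simp_all add: sigma_N_def sigma_W_def)

lemma prob_N_W: "E \<in> sets sigma_N \<Longrightarrow> F \<in> sets sigma_W \<Longrightarrow> prob (E \<inter> F) = prob E * prob F"
  using indep_setD[OF N_W_indep] by (simp add: sigma_N_def sigma_W_def)

lemma N_measurable [measurable]: "0 \<le> t \<Longrightarrow> N t \<in> measurable M (count_space UNIV)"
  and r_pos: "0 < r"
  and N_increment: "0 \<le> s \<Longrightarrow> s < t \<Longrightarrow>
    distr M (count_space UNIV) (\<lambda>\<omega>. N t \<omega> - N s \<omega>) = measure_pmf (poisson_pmf (r * (t - s)))"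
  using poisson by (auto simp: poisson_process_def)

lemma counting_path_N: "\<omega> \<in> space M \<Longrightarrow> counting_path (\<lambda>t. N t \<omega>)"
  using poisson by (auto simp: poisson_process_def counting_path_def)

lemma N_mono: "\<omega> \<in> space M \<Longrightarrow> 0 \<le> s \<Longrightarrow> s \<le> t \<Longrightarrow> N s \<omega> \<le> N t \<omega>"
  using counting_path.g_mono[OF counting_path_N] by blast

lemma N_0: "\<omega> \<in> space M \<Longrightarrow> N 0 \<omega> = 0"
  using counting_path.g_0[OF counting_path_N] .

section \<open>Linear growth and simplicity of the arrivals\<close>

lemma mgf_poisson:
  assumes "\<mu> > 0"
  shows "(\<integral>\<^sup>+k. ennreal (exp (s * real k)) \<partial>measure_pmf (poisson_pmf \<mu>)) = ennreal (exp (\<mu> * (exp s - 1)))"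
proof -
  have "(\<lambda>k. (\<mu> * exp s) ^ k /\<^sub>R fact k) sums exp (\<mu> * exp s)" by (rule exp_converges)
  then have "(\<lambda>k. exp (- \<mu>) * ((\<mu> * exp s) ^ k /\<^sub>R fact k)) sums (exp (- \<mu>) * exp (\<mu> * exp s))"
    by (rule sums_mult)
  then have S: "(\<lambda>k. exp (- \<mu>) * ((\<mu> * exp s) ^ k /\<^sub>R fact k)) sums exp (\<mu> * (exp s - 1))"
    by (simp add: exp_add[symmetric] algebra_simps)
  have "(\<integral>\<^sup>+k. ennreal (exp (s * real k)) \<partial>measure_pmf (poisson_pmf \<mu>)) =
      (\<Sum>k. ennreal (exp (- \<mu>) * ((\<mu> * exp s) ^ k /\<^sub>R fact k)))"
    using assms by (simp add: nn_integral_measure_pmf nn_integral_count_space_nat ennreal_mult[symmetric]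
        exp_of_nat2_mult power_mult_distrib field_simps)
  also have "\<dots> = ennreal (exp (\<mu> * (exp s - 1)))"
    using S assms by (intro suminf_ennreal_eq) auto
  finally show ?thesis .
qed

lemma mgf_N:
  assumes "0 \<le> t"
  shows "(\<integral>\<^sup>+\<omega>. ennreal (exp (s * real (N t \<omega>))) \<partial>M) = ennreal (exp (r * t * (exp s - 1)))"
proof (cases "t = 0")
  case True
  have "(\<integral>\<^sup>+\<omega>. ennreal (exp (s * real (N t \<omega>))) \<partial>M) = (\<integral>\<^sup>+\<omega>. 1 \<partial>M)"
    using True by (intro nn_integral_cong) (simp add: N_0)
  then show ?thesis using True by (simp add: emeasure_space_1)
next
  case False
  then have t: "t > 0" using assms by simp
  have "(\<integral>\<^sup>+\<omega>. ennreal (exp (s * real (N t \<omega>))) \<partial>M) = (\<integral>\<^sup>+\<omega>. ennreal (exp (s * real (N t \<omega> - N 0 \<omega>))) \<partial>M)"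
    by (intro nn_integral_cong) (simp add: N_0)
  also have "\<dots> = (\<integral>\<^sup>+k. ennreal (exp (s * real k)) \<partial>distr M (count_space UNIV) (\<lambda>\<omega>. N t \<omega> - N 0 \<omega>))"
    using t by (subst nn_integral_distr) auto
  also have "\<dots> = ennreal (exp (r * t * (exp s - 1)))"
    using N_increment[of 0 t] t r_pos by (simp add: mgf_poisson)
  finally show ?thesis .
qed

lemma N_chernoff:
  assumes "0 \<le> t" "s > 0"
  shows "prob {\<omega> \<in> space M. real (N t \<omega>) \<ge> x} \<le> exp (r * t * (exp s - 1) - s * x)"
    and "prob {\<omega> \<in> space M. real (N t \<omega>) \<le> x} \<le> exp (r * t * (exp (- s) - 1) + s * x)"
proof -
  have *: "prob {\<omega> \<in> space M. \<sigma> * real (N t \<omega>) \<ge> \<sigma> * x} \<le> exp (r * t * (exp \<sigma> - 1) - \<sigma> * x)" for \<sigma>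
  proof -
    let ?A = "{\<omega> \<in> space M. \<sigma> * real (N t \<omega>) \<ge> \<sigma> * x}"
    have [measurable]: "N t \<in> measurable M (count_space UNIV)" using assms by measurable
    have "emeasure M ?A = (\<integral>\<^sup>+\<omega>. indicator ?A \<omega> \<partial>M)" by (subst nn_integral_indicator) auto
    also have "\<dots> \<le> (\<integral>\<^sup>+\<omega>. ennreal (exp (- \<sigma> * x)) * ennreal (exp (\<sigma> * real (N t \<omega>))) \<partial>M)"
    proof (intro nn_integral_mono)
      fix \<omega>
      have "ennreal (exp (- \<sigma> * x)) * ennreal (exp (\<sigma> * real (N t \<omega>))) =
          ennreal (exp (\<sigma> * real (N t \<omega>) - \<sigma> * x))"
        by (simp add: ennreal_mult[symmetric] exp_add[symmetric])
      then show "indicator ?A \<omega> \<le> ennreal (exp (- \<sigma> * x)) * ennreal (exp (\<sigma> * real (N t \<omega>)))"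
        by (auto simp: indicator_def ennreal_1[symmetric] simp del: ennreal_1 intro!: ennreal_leI)
    qed
    also have "\<dots> = ennreal (exp (- \<sigma> * x)) * ennreal (exp (r * t * (exp \<sigma> - 1)))"
      using assms by (subst nn_integral_cmult) (auto simp: mgf_N)
    also have "\<dots> = ennreal (exp (r * t * (exp \<sigma> - 1) - \<sigma> * x))"
      by (simp add: ennreal_mult[symmetric] exp_add[symmetric])
    finally show ?thesis by (simp add: emeasure_eq_measure)
  qed
  show "prob {\<omega> \<in> space M. real (N t \<omega>) \<ge> x} \<le> exp (r * t * (exp s - 1) - s * x)"
    using *[of s] assms by simp
  show "prob {\<omega> \<in> space M. real (N t \<omega>) \<le> x} \<le> exp (r * t * (exp (- s) - 1) + s * x)"
    using *[of "- s"] assms by simp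
qed

lemma N_deviation:
  assumes "\<delta> > 0"
  obtains c where "c > 0" "\<And>t n. 0 \<le> t \<Longrightarrow> t \<le> n \<Longrightarrow>
    prob {\<omega> \<in> space M. \<bar>real (N t \<omega>) - r * t\<bar> > \<delta> * n} \<le> 2 * exp (- c * n)"
proof -
  \<comment> \<open>With this choice the quadratic term \<open>r * t * s\<^sup>2\<close> uses at
    most half of the gain \<open>s * \<delta> * n\<close>; the cap at 1 keeps the quadratic bound
    for \<open>exp s\<close> valid.\<close>
  define s where "s = min 1 (\<delta> / (2 * r))"
  have s: "s > 0" "s \<le> 1" "r * s \<le> \<delta> / 2"
  proof -
    show "s > 0" "s \<le> 1" using assms r_pos by (auto simp: s_def)
    have "r * s \<le> r * (\<delta> / (2 * r))" using r_pos by (intro mult_left_mono) (auto simp: s_def)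
    then show "r * s \<le> \<delta> / 2" using r_pos by simp
  qed
  have e1: "exp s - 1 \<le> s + s\<^sup>2" using exp_bound[of s] s by simp
  have e2: "exp (- s) - 1 \<le> - s + s\<^sup>2" using exp_minus_le_quadratic[of s] s by simp
  have "prob {\<omega> \<in> space M. \<bar>real (N t \<omega>) - r * t\<bar> > \<delta> * n} \<le> 2 * exp (- (s * \<delta> / 2) * n)"
    if t: "0 \<le> t" "t \<le> n" for t n
  proof -
    have [measurable]: "N t \<in> measurable M (count_space UNIV)" using t by measurable
    have key: "r * t * s\<^sup>2 - s * \<delta> * n \<le> - (s * \<delta> / 2) * n"
    proof -
      have "r * t * s\<^sup>2 = (r * s) * (s * t)" by (simp add: power2_eq_square)
      also have "\<dots> \<le> (\<delta> / 2) * (s * n)" using s t r_pos assms by (intro mult_mono) auto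
      finally show ?thesis by (simp add: algebra_simps)
    qed
    have rt: "0 \<le> r * t" using r_pos t by simp
    have "prob {\<omega> \<in> space M. real (N t \<omega>) \<ge> r * t + \<delta> * n} \<le> exp (r * t * (exp s - 1) - s * (r * t + \<delta> * n))"
      using N_chernoff(1)[OF t(1) s(1)] .
    also have "\<dots> \<le> exp (- (s * \<delta> / 2) * n)"
    proof (subst exp_le_cancel_iff)
      have "r * t * (exp s - 1) \<le> r * t * (s + s\<^sup>2)" using e1 rt by (intro mult_left_mono) auto
      then show "r * t * (exp s - 1) - s * (r * t + \<delta> * n) \<le> - (s * \<delta> / 2) * n"
        using key by (simp add: algebra_simps)
    qed
    finally have 1: "prob {\<omega> \<in> space M. real (N t \<omega>) \<ge> r * t + \<delta> * n} \<le> exp (- (s * \<delta> / 2) * n)" .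
    have "prob {\<omega> \<in> space M. real (N t \<omega>) \<le> r * t - \<delta> * n} \<le> exp (r * t * (exp (- s) - 1) + s * (r * t - \<delta> * n))"
      using N_chernoff(2)[OF t(1) s(1)] .
    also have "\<dots> \<le> exp (- (s * \<delta> / 2) * n)"
    proof (subst exp_le_cancel_iff)
      have "r * t * (exp (- s) - 1) \<le> r * t * (- s + s\<^sup>2)" using e2 rt by (intro mult_left_mono) auto
      then show "r * t * (exp (- s) - 1) + s * (r * t - \<delta> * n) \<le> - (s * \<delta> / 2) * n"
        using key by (simp add: algebra_simps)
    qed
    finally have 2: "prob {\<omega> \<in> space M. real (N t \<omega>) \<le> r * t - \<delta> * n} \<le> exp (- (s * \<delta> / 2) * n)" .
    have "prob {\<omega> \<in> space M. \<bar>real (N t \<omega>) - r * t\<bar> > \<delta> * n} \<le>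
        prob ({\<omega> \<in> space M. real (N t \<omega>) \<ge> r * t + \<delta> * n} \<union> {\<omega> \<in> space M. real (N t \<omega>) \<le> r * t - \<delta> * n})"
      by (intro finite_measure_mono) (auto simp: abs_if split: if_splits)
    also have "\<dots> \<le> prob {\<omega> \<in> space M. real (N t \<omega>) \<ge> r * t + \<delta> * n} + prob {\<omega> \<in> space M. real (N t \<omega>) \<le> r * t - \<delta> * n}"
      by (intro measure_Un_le) auto
    finally show ?thesis using 1 2 by linarith
  qed
  then show thesis using that[of "s * \<delta> / 2"] s assms by simp
qed

text \<open>Only integer times are tested, so that a finite union bound applies and the event lies
  in \<open>sigma_N\<close>. Monotonicity of the count extends the estimate to all times at the
  price of \<open>r\<close>, the expected number of arrivals in a unit interval.\<close>

definition N_good :: "real \<Rightarrow> nat \<Rightarrow> 'a set" where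
  "N_good \<delta> n = {\<omega> \<in> space M. \<forall>i\<le>n. \<bar>real (N (real i) \<omega>) - r * real i\<bar> \<le> \<delta> * real n}"

lemma N_good_sets [measurable]: "N_good \<delta> n \<in> sets sigma_N" "N_good \<delta> n \<in> sets M"
proof -
  have eq: "N_good \<delta> n = (\<Inter>i\<in>{..n}. {\<omega> \<in> space M. \<bar>real (N (real i) \<omega>) - r * real i\<bar> \<le> \<delta> * real n})"
    by (auto simp: N_good_def)
  have [measurable]: "N (real i) \<in> measurable sigma_N (count_space UNIV)" for i by auto
  have "{\<omega> \<in> space sigma_N. \<bar>real (N (real i) \<omega>) - r * real i\<bar> \<le> \<delta> * real n} \<in> sets sigma_N" for i
    by measurable
  then show "N_good \<delta> n \<in> sets sigma_N" unfolding eq by (intro sets.finite_INT) auto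
  then show "N_good \<delta> n \<in> sets M" by (rule subsetD[OF sets_sigma_subset(1)])
qed

lemma N_goodD:
  assumes "\<omega> \<in> N_good \<delta> n" "0 \<le> s" "s \<le> real n"
  shows "\<bar>real (N s \<omega>) - r * s\<bar> \<le> \<delta> * n + r"
proof -
  define i where "i = nat \<lfloor>s\<rfloor>"
  have i: "real i \<le> s" "s < real i + 1" "i \<le> n" using assms by (auto simp: i_def) linarith+
  have \<omega>: "\<omega> \<in> space M" and good: "\<And>j. j \<le> n \<Longrightarrow> \<bar>real (N (real j) \<omega>) - r * real j\<bar> \<le> \<delta> * real n"
    using assms by (auto simp: N_good_def)
  have ris: "r * real i \<le> r * s" "r * s \<le> r * real i + r" 
    using i r_pos by (auto simp: distrib_left[symmetric, of r _ 1, simplified])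
  have lo: "real (N s \<omega>) \<ge> r * s - r - \<delta> * n"
  proof -
    have "N (real i) \<omega> \<le> N s \<omega>" using \<omega> i by (intro N_mono) auto
    then have "real (N (real i) \<omega>) \<le> real (N s \<omega>)" by simp
    then show ?thesis using good[OF i(3)] ris by linarith
  qed
  have up: "real (N s \<omega>) \<le> r * s + r + \<delta> * n"
  \<comment> \<open>The upper estimate uses the next integer time, which is not tested when
    \<open>i = n\<close>; then \<open>s\<close> itself is the last tested time.\<close>
  proof (cases "i = n")
    case True
    then have "s = real i" using i assms by simp
    then show ?thesis using good[OF i(3)] r_pos by simp
  next
    case False
    then have "Suc i \<le> n" using i by simp
    moreover have "N s \<omega> \<le> N (real (Suc i)) \<omega>" using \<omega> i assms by (intro N_mono) auto
    then have "real (N s \<omega>) \<le> real (N (real (Suc i)) \<omega>)" by simp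
    moreover have "r * real (Suc i) = r * real i + r" by (simp add: algebra_simps)
    ultimately show ?thesis using good[of "Suc i"] ris by linarith
  qed
  from lo up show ?thesis by linarith
qed

lemma prob_not_N_good:
  assumes "\<delta> > 0" "K > 0"
  shows "\<forall>\<^sub>F n in sequentially. prob (space M - N_good \<delta> n) \<le> real n powr (- K)"
proof -
  obtain c where c: "c > 0" "\<And>t n. 0 \<le> t \<Longrightarrow> t \<le> n \<Longrightarrow>
    prob {\<omega> \<in> space M. \<bar>real (N t \<omega>) - r * t\<bar> > \<delta> * n} \<le> 2 * exp (- c * n)"
    using N_deviation[OF assms(1)] by blast
  have "(\<lambda>n. (real n + 1) * (2 * exp (- c * real n)) / real n powr (- K)) \<longlonglongrightarrow> 0"
    using c(1) assms by real_asymp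
  then have "\<forall>\<^sub>F n in sequentially. (real n + 1) * (2 * exp (- c * real n)) / real n powr (- K) < 1"
    by (intro order_tendstoD) auto
  then show ?thesis using eventually_gt_at_top[of 0]
  proof eventually_elim
    case (elim n)
    have "space M - N_good \<delta> n \<subseteq> (\<Union>i\<in>{..n}. {\<omega> \<in> space M. \<bar>real (N (real i) \<omega>) - r * real i\<bar> > \<delta> * n})"
      by (auto simp: N_good_def not_le)
    then have "prob (space M - N_good \<delta> n) \<le>
        prob (\<Union>i\<in>{..n}. {\<omega> \<in> space M. \<bar>real (N (real i) \<omega>) - r * real i\<bar> > \<delta> * n})"
      by (intro finite_measure_mono) auto
    also have "\<dots> \<le> (\<Sum>i\<in>{..n}. prob {\<omega> \<in> space M. \<bar>real (N (real i) \<omega>) - r * real i\<bar> > \<delta> * n})"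
      by (intro finite_measure_subadditive_finite) auto
    also have "\<dots> \<le> (\<Sum>i\<in>{..n}. 2 * exp (- c * real n))"
      by (intro sum_mono c(2)) auto
    also have "\<dots> = (real n + 1) * (2 * exp (- c * real n))" by simp
    also have "\<dots> \<le> real n powr (- K)" using elim by (simp add: pos_divide_less_eq)
    finally show ?case .
  qed
qed

lemma N_increment_sets:
  assumes "0 \<le> s" "0 \<le> t"
  shows "{\<omega> \<in> space M. N s \<omega> + 2 \<le> N t \<omega>} \<in> sets M"
proof -
  have [measurable]: "N t \<in> measurable M (count_space UNIV)" "N s \<in> measurable M (count_space UNIV)"
    using assms by auto
  have "{\<omega> \<in> space M. real (N s \<omega>) + 2 \<le> real (N t \<omega>)} \<in> sets M" by measurable
  moreover have "N s \<omega> + 2 \<le> N t \<omega> \<longleftrightarrow> real (N s \<omega>) + 2 \<le> real (N t \<omega>)" for \<omega> by linarith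
  ultimately show ?thesis by simp
qed

text \<open>With \<open>\<mu> = r * (t - s)\<close> the probability is
  \<open>1 - exp (- \<mu>) * (1 + \<mu>)\<close>, and \<open>exp (- \<mu>) \<ge> 1 - \<mu>\<close>
  leaves \<open>\<mu>\<^sup>2\<close>.\<close>

lemma prob_N_increment_ge_2:
  assumes "0 \<le> s" "s < t"
  shows "prob {\<omega> \<in> space M. N s \<omega> + 2 \<le> N t \<omega>} \<le> (r * (t - s))\<^sup>2"
proof -
  let ?\<mu> = "r * (t - s)"
  have \<mu>: "?\<mu> > 0" using assms r_pos by simp
  have [measurable]: "N t \<in> measurable M (count_space UNIV)" "N s \<in> measurable M (count_space UNIV)"
    using assms by auto
  have "prob {\<omega> \<in> space M. N s \<omega> + 2 \<le> N t \<omega>} =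
      measure (distr M (count_space UNIV) (\<lambda>\<omega>. N t \<omega> - N s \<omega>)) (- {0, 1})"
    by (subst measure_distr) (auto intro!: arg_cong[where f = prob])
  also have "\<dots> = 1 - (pmf (poisson_pmf ?\<mu>) 0 + pmf (poisson_pmf ?\<mu>) 1)"
    unfolding N_increment[OF assms]
    using measure_pmf.prob_compl[of "{0, 1}" "poisson_pmf ?\<mu>"]
    by (simp add: measure_measure_pmf_finite Compl_eq_Diff_UNIV)
  also have "\<dots> = 1 - exp (- ?\<mu>) * (1 + ?\<mu>)" using \<mu> by (simp add: algebra_simps)
  also have "\<dots> \<le> 1 - (1 - ?\<mu>) * (1 + ?\<mu>)"
    using exp_ge_add_one_self[of "- ?\<mu>"] \<mu> by (intro diff_left_mono mult_right_mono) auto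
  also have "\<dots> = ?\<mu>\<^sup>2" by (simp add: algebra_simps power2_eq_square)
  finally show ?thesis .
qed

text \<open>A multiple arrival produces, on every grid, a cell with an increment of at least 2. With
  \<open>m\<close> cells this has probability at most \<open>m * (r * n / m)\<^sup>2\<close>, which
  tends to 0. The measurable set \<open>Z\<close> covers the exceptional set, whose own
  measurability is not assumed.\<close>

lemma AE_simple_until:
  assumes "n > 0"
  shows "AE \<omega> in M. counting_path.simple_until (\<lambda>t. N t \<omega>) n"
proof -
  define I where "I = (\<lambda>m i::nat. {\<omega> \<in> space M. N (real i * n / m) \<omega> + 2 \<le> N (real (Suc i) * n / m) \<omega>})"
  have I_sets: "I m i \<in> sets M" if "m > 0" for m i
    using that assms unfolding I_def by (intro N_increment_sets) auto
  have I_sets': "I (real (Suc m)) i \<in> sets M" for m i by (rule I_sets) simp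
  define Z where "Z = (\<Inter>m. \<Union>i\<in>{..<Suc m}. I (real (Suc m)) i)"
  have Z_sets: "Z \<in> sets M" unfolding Z_def using I_sets' by (intro sets.countable_INT) auto
  have le: "prob Z \<le> (r * n)\<^sup>2 * inverse (real (Suc m))" for m
  proof -
    have "prob Z \<le> prob (\<Union>i\<in>{..<Suc m}. I (real (Suc m)) i)"
      using I_sets' by (intro finite_measure_mono) (auto simp: Z_def)
    also have "\<dots> \<le> (\<Sum>i\<in>{..<Suc m}. prob (I (real (Suc m)) i))"
      using I_sets' by (intro finite_measure_subadditive_finite) auto
    also have "\<dots> \<le> (\<Sum>i\<in>{..<Suc m}. (r * (n / real (Suc m)))\<^sup>2)"
    proof (intro sum_mono)
      fix i
      have "real (Suc i) * n / real (Suc m) - real i * n / real (Suc m) = n / real (Suc m)"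
        by (simp add: diff_divide_distrib[symmetric] algebra_simps)
      moreover have "real i * n / real (Suc m) < real (Suc i) * n / real (Suc m)"
        using assms by (intro divide_strict_right_mono mult_strict_right_mono) auto
      ultimately show "prob (I (real (Suc m)) i) \<le> (r * (n / real (Suc m)))\<^sup>2"
        unfolding I_def using prob_N_increment_ge_2[of "real i * n / real (Suc m)" "real (Suc i) * n / real (Suc m)"]
          assms by simp
    qed
    also have "\<dots> = real (Suc m) * ((r * n)\<^sup>2 / (real (Suc m))\<^sup>2)"
      by (simp add: power_divide power_mult_distrib del: of_nat_Suc)
    also have "\<dots> = (r * n)\<^sup>2 * inverse (real (Suc m))"
      by (simp add: power2_eq_square inverse_eq_divide del: of_nat_Suc)
    finally show ?thesis .
  qed
  have "(\<lambda>m. (r * n)\<^sup>2 * inverse (real (Suc m))) \<longlonglongrightarrow> (r * n)\<^sup>2 * 0"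
    by (intro tendsto_mult tendsto_const LIMSEQ_inverse_real_of_nat)
  then have "prob Z \<le> (r * n)\<^sup>2 * 0" by (rule LIMSEQ_le_const) (use le in blast)
  then have "prob Z = 0" by (simp add: measure_le_0_iff)
  then have "Z \<in> null_sets M" using Z_sets by (auto simp: null_sets_def emeasure_eq_measure)
  moreover have "{\<omega> \<in> space M. \<not> counting_path.simple_until (\<lambda>t. N t \<omega>) n} \<subseteq> Z"
  proof
    fix \<omega> assume "\<omega> \<in> {\<omega> \<in> space M. \<not> counting_path.simple_until (\<lambda>t. N t \<omega>) n}"
    then have \<omega>: "\<omega> \<in> space M" and "\<not> counting_path.simple_until (\<lambda>t. N t \<omega>) n" by auto
    then obtain s where s: "0 < s" "s \<le> n" "\<And>s'. 0 \<le> s' \<Longrightarrow> s' < s \<Longrightarrow> N s' \<omega> + 2 \<le> N s \<omega>"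
      unfolding counting_path.simple_until_def[OF counting_path_N[OF \<omega>]]
      by (fastforce simp: not_le Suc_le_eq)
    show "\<omega> \<in> Z" unfolding Z_def
    proof (intro INT_I)
      fix m :: nat
      let ?m = "real (Suc m)"
      \<comment> \<open>The cell with \<open>i * n / m < s \<le> (i + 1) * n / m\<close>; rounding
        up and subtracting 1 keeps its left end strictly before \<open>s\<close>.\<close>
      define i where "i = nat (\<lceil>s * ?m / n\<rceil> - 1)"
      have pos: "0 < s * ?m / n" using s assms by (intro divide_pos_pos mult_pos_pos) auto
      then have ri: "real i = of_int \<lceil>s * ?m / n\<rceil> - 1" by (simp add: i_def del: of_nat_Suc)
      have i1: "real i < s * ?m / n" "s * ?m / n \<le> real i + 1" unfolding ri by linarith+
      have "s * ?m / n \<le> 1 * ?m"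
        using s assms by (simp add: pos_divide_le_eq del: of_nat_Suc)
      with i1(1) have "real i < real (Suc m)" by (simp only: mult_1 less_le_trans)
      then have "i < Suc m" by simp
      moreover have "real i * n / ?m < s" using i1(1) assms by (simp add: field_simps del: of_nat_Suc)
      then have "N (real i * n / ?m) \<omega> + 2 \<le> N s \<omega>" using assms by (intro s(3)) auto
      moreover have "s \<le> real (Suc i) * n / ?m" using i1(2) assms by (simp add: field_simps)
      then have "N s \<omega> \<le> N (real (Suc i) * n / ?m) \<omega>" using \<omega> s by (intro N_mono) auto
      ultimately show "\<omega> \<in> (\<Union>i\<in>{..<Suc m}. I ?m i)" using \<omega> unfolding I_def by fastforce
    qed
  qed
  ultimately show ?thesis by (rule AE_I'[rotated, rotated]) 
qed

lemma driven_path_scaled_process: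
  assumes "\<omega> \<in> space M" "n > 0"
  shows "counting_path.driven_path (\<lambda>t. N t \<omega>)
    (scaled_process (compensated_process M r N W) n \<omega>) n (\<lambda>k. W k \<omega>) (r * mean)"
  unfolding counting_path.driven_path_def[OF counting_path_N[OF assms(1)]]
proof (intro conjI ballI)
  fix t :: real assume t: "t \<in> {0..1}"
  show "traj (scaled_process (compensated_process M r N W) n \<omega>) t =
      (\<Sum>k=1..N (real n * t) \<omega>. W k \<omega>) / n - r * mean * t"
    using traj_scaled_process[OF poisson assms t, of W] assms
    by (simp add: compensated_process_def mean_def diff_divide_distrib)
qed (use assms in simp)

lemma random_sum_measurable [measurable]:
  assumes "0 \<le> t" "\<And>k. 1 \<le> k \<Longrightarrow> V k \<in> borel_measurable M"
  shows "(\<lambda>\<omega>. \<Sum>k=1..N t \<omega>. V k \<omega> :: real) \<in> borel_measurable M"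
  by (rule measurable_compose_countable[where f = "\<lambda>m \<omega>. \<Sum>k=1..m. V k \<omega>" and g = "N t"])
    (use assms in auto)

lemma scaled_process_measurable:
  assumes "n > 0"
  shows "scaled_process (compensated_process M r N W) n \<in> borel_measurable M"
proof (rule measurable_skorokhodI)
  fix t :: real assume t: "t \<in> {0..1}"
  have "(\<lambda>\<omega>. (\<Sum>k=1..N (real n * t) \<omega>. W k \<omega>) / n - r * mean * t) \<in> borel_measurable M"
    using t by (intro borel_measurable_diff borel_measurable_divide borel_measurable_const
        random_sum_measurable W_measurable) auto
  then show "(\<lambda>\<omega>. traj (scaled_process (compensated_process M r N W) n \<omega>) t) \<in> borel_measurable M"
    by (subst measurable_cong) (use t assms driven_path_scaled_process counting_path.driven_path_def[OF counting_path_N] in auto)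
qed

end

section \<open>Joint events for jump sizes, with fixed and random numbers of jumps\<close>

context iid_positive
begin

lemma prob_W_box:
  assumes J: "finite J" "J \<subseteq> {1..}" and B: "\<And>j. j \<in> J \<Longrightarrow> B j \<in> sets borel"
  shows "prob {\<omega> \<in> space M. \<forall>j\<in>J. W j \<omega> \<in> B j} = (\<Prod>j\<in>J. prob {\<omega> \<in> space M. W 1 \<omega> \<in> B j})"
proof (cases "J = {}")
  case False
  have "{\<omega> \<in> space M. \<forall>j\<in>J. W j \<omega> \<in> B j} = (\<Inter>j\<in>J. W j -` B j \<inter> space M)" using False by auto
  then have "prob {\<omega> \<in> space M. \<forall>j\<in>J. W j \<omega> \<in> B j} = (\<Prod>j\<in>J. prob (W j -` B j \<inter> space M))"
    using indep_varsD[OF W_indep False J(1,2)] B by simp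
  also have "\<dots> = (\<Prod>j\<in>J. prob {\<omega> \<in> space M. W 1 \<omega> \<in> B j})"
  proof (intro prod.cong refl)
    fix j assume "j \<in> J"
    then show "prob (W j -` B j \<inter> space M) = prob {\<omega> \<in> space M. W 1 \<omega> \<in> B j}"
      using prob_W[of j "B j"] J B by (auto simp: vimage_def Int_def conj_commute)
  qed
  finally show ?thesis .
qed (simp add: prob_space)

lemma prob_W_pair:
  assumes "1 \<le> j" "j < k"
  shows "prob {\<omega> \<in> space M. x < W j \<omega> \<and> x < W k \<omega>} = (tail_prob x)\<^sup>2"
proof -
  have "{\<omega> \<in> space M. x < W j \<omega> \<and> x < W k \<omega>} = {\<omega> \<in> space M. \<forall>i\<in>{j, k}. W i \<omega> \<in> {x<..}}" by auto
  also have "prob \<dots> = (\<Prod>i\<in>{j, k}. prob {\<omega> \<in> space M. W 1 \<omega> \<in> {x<..}})"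
    using assms by (intro prob_W_box) auto
  also have "\<dots> = (tail_prob x)\<^sup>2" using assms by (simp add: tail_prob_def power2_eq_square)
  finally show ?thesis .
qed

lemma prob_many_exceed:
  "prob {\<omega> \<in> space M. l \<le> card {k \<in> {1..m}. x < W k \<omega>}} \<le> (real m * tail_prob x) ^ l"
proof -
  let ?J = "{J. J \<subseteq> {1..m} \<and> card J = l}"
  have fin: "finite ?J" by (rule finite_subset[of _ "Pow {1..m}"]) auto
  have Jf: "finite J" "J \<subseteq> {1..}" if "J \<in> ?J" for J using that finite_subset by auto
  have S: "{\<omega> \<in> space M. \<forall>j\<in>J. W j \<omega> \<in> {x<..}} \<in> sets M" if "J \<in> ?J" for J
  proof -
    have [measurable]: "W j \<in> borel_measurable M" if "j \<in> J" for j
      using Jf[OF \<open>J \<in> ?J\<close>] that by auto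
    show ?thesis using Jf(1)[OF that] by measurable
  qed
  have "{\<omega> \<in> space M. l \<le> card {k \<in> {1..m}. x < W k \<omega>}} \<subseteq>
      (\<Union>J\<in>?J. {\<omega> \<in> space M. \<forall>j\<in>J. W j \<omega> \<in> {x<..}})"
  proof
    fix \<omega> assume \<omega>: "\<omega> \<in> {\<omega> \<in> space M. l \<le> card {k \<in> {1..m}. x < W k \<omega>}}"
    then obtain J where "J \<subseteq> {k \<in> {1..m}. x < W k \<omega>}" "card J = l"
      by (auto elim: obtain_subset_with_card_n)
    then have "J \<in> ?J" "\<omega> \<in> {\<omega> \<in> space M. \<forall>j\<in>J. W j \<omega> \<in> {x<..}}" using \<omega> by auto
    then show "\<omega> \<in> (\<Union>J\<in>?J. {\<omega> \<in> space M. \<forall>j\<in>J. W j \<omega> \<in> {x<..}})" by blast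
  qed
  then have "prob {\<omega> \<in> space M. l \<le> card {k \<in> {1..m}. x < W k \<omega>}} \<le>
      prob (\<Union>J\<in>?J. {\<omega> \<in> space M. \<forall>j\<in>J. W j \<omega> \<in> {x<..}})"
    using fin S by (intro finite_measure_mono sets.finite_UN) auto
  also have "\<dots> \<le> (\<Sum>J\<in>?J. prob {\<omega> \<in> space M. \<forall>j\<in>J. W j \<omega> \<in> {x<..}})"
    using fin S by (intro finite_measure_subadditive_finite) auto
  also have "\<dots> = (\<Sum>J\<in>?J. tail_prob x ^ l)"
  proof (intro sum.cong refl)
    fix J assume J: "J \<in> ?J"
    have "prob {\<omega> \<in> space M. \<forall>j\<in>J. W j \<omega> \<in> {x<..}} = (\<Prod>j\<in>J. prob {\<omega> \<in> space M. W 1 \<omega> \<in> {x<..}})"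
      using Jf[OF J] by (intro prob_W_box) auto
    then show "prob {\<omega> \<in> space M. \<forall>j\<in>J. W j \<omega> \<in> {x<..}} = tail_prob x ^ l"
      using J by (simp add: tail_prob_def)
  qed
  also have "\<dots> = real (m choose l) * tail_prob x ^ l" using n_subsets[of "{1..m}" l] by simp
  also have "\<dots> \<le> real m ^ l * tail_prob x ^ l"
  proof (intro mult_right_mono)
    show "real (m choose l) \<le> real m ^ l"
    proof (cases "l \<le> m")
      case True
      have "m choose l \<le> m ^ l" using True by (rule binomial_le_pow)
      then show ?thesis by (metis of_nat_le_iff of_nat_power)
    qed (simp add: binomial_eq_0)
  qed (simp add: tail_prob_nonneg)
  finally show ?thesis by (simp add: power_mult_distrib)
qed

lemma mean_nonneg: "0 \<le> mean"
  unfolding mean_def using W_pos[rule_format, of 1] by (intro integral_nonneg_AE) (auto elim!: AE_mp)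

end

context compound_poisson
begin

text \<open>Independence factors each term into the probabilities of \<open>k \<le> N 1\<close> and
  of \<open>F k\<close>; the exponential tail of \<open>N 1\<close> makes the series converge even
  with the growth \<open>real k * p\<close>, which is needed for pairs of indices below
  \<open>k\<close>. The constant \<open>G\<close> does not depend on \<open>F\<close> or
  \<open>p\<close>, so it can be used for events varying with \<open>n\<close>.\<close>

lemma prob_random_index:
  obtains G where "G > 0" "\<And>F p. (\<And>k. 1 \<le> k \<Longrightarrow> F k \<in> sets sigma_W) \<Longrightarrow>
    (\<And>k. 1 \<le> k \<Longrightarrow> prob (F k) \<le> real k * p) \<Longrightarrow> 0 \<le> p \<Longrightarrow>
    prob {\<omega> \<in> space M. \<exists>k. 1 \<le> k \<and> k \<le> N 1 \<omega> \<and> \<omega> \<in> F k} \<le> G * p"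
proof -
  define C where "C = exp (r * (exp 1 - 1))"
  \<comment> \<open>The Chernoff bound with parameter 1 gives \<open>C * exp (- k)\<close>, and
    \<open>k \<le> 2 * exp (k / 2)\<close> absorbs the linear growth.\<close>
  define h where "h = (\<lambda>k. 2 * C * exp (- (1/2)) ^ Suc k)"
  have "exp (- (1/2)) < (1::real)" by simp
  then have h: "summable h" unfolding h_def
    by (intro summable_mult) (subst summable_Suc_iff, intro summable_geometric, simp)
  have h_pos: "h k > 0" for k by (simp add: h_def C_def)
  define G where "G = suminf h"
  have "G > 0" unfolding G_def using h h_pos by (intro suminf_pos) auto
  moreover have "prob {\<omega> \<in> space M. \<exists>k. 1 \<le> k \<and> k \<le> N 1 \<omega> \<and> \<omega> \<in> F k} \<le> G * p"
    if F: "\<And>k. 1 \<le> k \<Longrightarrow> F k \<in> sets sigma_W" "\<And>k. 1 \<le> k \<Longrightarrow> prob (F k) \<le> real k * p" and p: "0 \<le> p" for F p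
  proof -
    let ?E = "\<lambda>k. {\<omega> \<in> space M. Suc k \<le> N 1 \<omega>}"
    have E: "?E k \<in> sets sigma_N" for k
    proof -
      have [measurable]: "N 1 \<in> measurable sigma_N (count_space UNIV)" by auto
      have "{\<omega> \<in> space sigma_N. Suc k \<le> N 1 \<omega>} \<in> sets sigma_N" by measurable
      then show ?thesis by simp
    qed
    have EF: "?E k \<inter> F (Suc k) \<in> sets M" for k
      by (intro sets.Int subsetD[OF sets_sigma_subset(1) E] subsetD[OF sets_sigma_subset(2) F(1)]) simp
    have le: "prob (?E k \<inter> F (Suc k)) \<le> h k * p" for k
    proof -
      have "prob (?E k) = prob {\<omega> \<in> space M. real (Suc k) \<le> real (N 1 \<omega>)}" by (simp only: of_nat_le_iff)
      also have "\<dots> \<le> exp (r * 1 * (exp 1 - 1) - 1 * real (Suc k))" by (rule N_chernoff(1)) auto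
      also have "\<dots> = C * exp (- real (Suc k))" by (simp add: C_def exp_add[symmetric] del: of_nat_Suc)
      finally have "prob (?E k) \<le> C * exp (- real (Suc k))" .
      moreover have "prob (?E k \<inter> F (Suc k)) = prob (?E k) * prob (F (Suc k))"
        using E F by (intro prob_N_W) auto
      moreover have "prob (F (Suc k)) \<le> real (Suc k) * p" by (rule F) simp
      ultimately have "prob (?E k \<inter> F (Suc k)) \<le> (C * exp (- real (Suc k))) * (real (Suc k) * p)"
        using p by (auto intro!: mult_mono simp: C_def)
      also have "\<dots> \<le> (C * exp (- real (Suc k))) * ((2 * exp (real (Suc k) / 2)) * p)"
      proof (intro mult_left_mono mult_right_mono p)
        have "x \<le> 2 * exp (x / 2)" for x :: real using exp_ge_add_one_self[of "x / 2"] by linarith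
        then show "real (Suc k) \<le> 2 * exp (real (Suc k) / 2)" .
      qed (auto simp: C_def)
      also have "\<dots> = 2 * C * (exp (- real (Suc k)) * exp (real (Suc k) / 2)) * p" by simp
      also have "exp (- real (Suc k)) * exp (real (Suc k) / 2) = exp (real (Suc k) * (- (1/2)))"
        by (simp add: exp_add[symmetric] field_simps)
      also have "\<dots> = exp (- (1/2)) ^ Suc k" by (rule exp_of_nat_mult)
      finally show ?thesis by (simp only: h_def)
    qed
    have sm: "summable (\<lambda>k. prob (?E k \<inter> F (Suc k)))"
      using le by (intro summable_comparison_test'[OF summable_mult2[OF h, of p], of 0]) auto
    have "{\<omega> \<in> space M. \<exists>k. 1 \<le> k \<and> k \<le> N 1 \<omega> \<and> \<omega> \<in> F k} = (\<Union>k. ?E k \<inter> F (Suc k))"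
    proof (intro equalityI subsetI)
      fix \<omega> assume "\<omega> \<in> {\<omega> \<in> space M. \<exists>k. 1 \<le> k \<and> k \<le> N 1 \<omega> \<and> \<omega> \<in> F k}"
      then obtain k where k: "\<omega> \<in> space M" "1 \<le> k" "k \<le> N 1 \<omega>" "\<omega> \<in> F k" by auto
      then have "\<omega> \<in> ?E (k - 1) \<inter> F (Suc (k - 1))" by auto
      then show "\<omega> \<in> (\<Union>k. ?E k \<inter> F (Suc k))" by blast
    next
      fix \<omega> assume "\<omega> \<in> (\<Union>k. ?E k \<inter> F (Suc k))"
      then obtain k where "\<omega> \<in> space M" "Suc k \<le> N 1 \<omega>" "\<omega> \<in> F (Suc k)" by auto
      then show "\<omega> \<in> {\<omega> \<in> space M. \<exists>k. 1 \<le> k \<and> k \<le> N 1 \<omega> \<and> \<omega> \<in> F k}"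
        by (auto intro!: exI[of _ "Suc k"])
    qed
    also have "prob \<dots> \<le> (\<Sum>k. prob (?E k \<inter> F (Suc k)))"
      using EF sm by (intro finite_measure_subadditive_countably) auto
    also have "\<dots> \<le> (\<Sum>k. h k * p)" using le sm by (intro suminf_le summable_mult2 h)
    also have "\<dots> = G * p" unfolding G_def by (rule suminf_mult2[OF h, symmetric])
    finally show ?thesis .
  qed
  ultimately show thesis using that by blast
qed

lemma prob_N_1_ge_1: "prob {\<omega> \<in> space M. 1 \<le> N 1 \<omega>} > 0"
proof -
  have "prob {\<omega> \<in> space M. N 1 \<omega> = 0} = measure (distr M (count_space UNIV) (\<lambda>\<omega>. N 1 \<omega> - N 0 \<omega>)) {0}"
    by (subst measure_distr) (auto intro!: arg_cong[where f = prob] simp: N_0)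
  also have "\<dots> = exp (- r)"
    using r_pos by (subst N_increment) (auto simp: measure_pmf_single)
  finally have "prob {\<omega> \<in> space M. N 1 \<omega> = 0} = exp (- r)" .
  moreover have "prob {\<omega> \<in> space M. \<not> N 1 \<omega> = 0} = 1 - prob {\<omega> \<in> space M. N 1 \<omega> = 0}"
    by (rule prob_neg) auto
  moreover have "exp (- r) < 1" using r_pos by simp
  moreover have "{\<omega> \<in> space M. \<not> N 1 \<omega> = 0} = {\<omega> \<in> space M. 1 \<le> N 1 \<omega>}" by (auto simp: Suc_le_eq One_nat_def)
  ultimately show ?thesis by simp
qed

end

section \<open>Tail of X(1) against tail of a single jump\<close>

locale heavy_tailed_compound_poisson = compound_poisson M W N r
  for M :: "'a measure" and W N r +
  fixes \<beta> :: real
  assumes rv_tail: "regularly_varying (\<lambda>x. prob {\<omega> \<in> space M. compensated_process M r N W 1 \<omega> > x}) (- \<beta>)"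
    and \<beta>_gt_1: "1 < \<beta>"
begin

definition f :: "real \<Rightarrow> real" where
  "f x = prob {\<omega> \<in> space M. compensated_process M r N W 1 \<omega> > x}"

definition S1 :: "'a \<Rightarrow> real" where "S1 \<omega> = (\<Sum>k=1..N 1 \<omega>. W k \<omega>)"

lemma S1_measurable [measurable]: "S1 \<in> borel_measurable M"
  unfolding S1_def by (rule random_sum_measurable) auto

lemma f_eq: "f x = prob {\<omega> \<in> space M. x + r * mean < S1 \<omega>}"
  unfolding f_def compensated_process_def S1_def mean_def
  by (intro arg_cong[where f = prob]) auto

sublocale regularly_varying_tail f \<beta>
proof
  show "regularly_varying f (- \<beta>)" using rv_tail unfolding f_def .
  show "antimono f" unfolding f_eq by (intro antimonoI finite_measure_mono) auto
qed (use \<beta>_gt_1 in simp)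

lemma filterlim_real_scaled: "c > 0 \<Longrightarrow> filterlim (\<lambda>n. c * real n) at_top sequentially"
  by (intro filterlim_tendsto_pos_mult_at_top[OF tendsto_const] filterlim_real_sequentially)

text \<open>By \<open>lower_powr_bound\<close>, \<open>f\<close> decays no faster than
  \<open>n powr (- s)\<close> for any \<open>s > \<beta>\<close>, so whatever vanishes faster than
  this power is eventually below any multiple of \<open>f\<close>.\<close>

lemma negligible:
  assumes "s > \<beta>" "(\<lambda>n. g n * real n powr s) \<longlonglongrightarrow> 0" "e > 0"
  shows "\<forall>\<^sub>F n in sequentially. g n \<le> e * f (real n)"
proof -
  obtain x0 c where c: "x0 > 0" "c > 0" "\<And>x. x0 \<le> x \<Longrightarrow> c * x powr (- s) \<le> f x"
    using lower_powr_bound[OF assms(1)] by blast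
  have "\<forall>\<^sub>F n in sequentially. g n * real n powr s < e * c"
    using assms(2,3) c(2) by (intro order_tendstoD) auto
  moreover have "\<forall>\<^sub>F n in sequentially. x0 \<le> real n"
    using filterlim_real_sequentially by (auto simp: filterlim_at_top)
  ultimately show ?thesis using eventually_gt_at_top[of 0]
  proof eventually_elim
    case (elim n)
    have "g n = (g n * real n powr s) * real n powr (- s)" using elim(3) by (simp add: powr_add[symmetric])
    also have "\<dots> \<le> (e * c) * real n powr (- s)" using elim(1) by (intro mult_right_mono) auto
    also have "\<dots> \<le> e * f (real n)" using c(3)[OF elim(2)] assms(3) by simp
    finally show ?case .
  qed
qed

lemma f_tendsto_0: "(\<lambda>n. f (real n)) \<longlonglongrightarrow> 0"
proof -
  obtain x0 C where C: "x0 > 0" "\<And>x. x0 \<le> x \<Longrightarrow> f x \<le> C * x powr (- 1)"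
    using upper_powr_bound[of 1] \<beta>_gt_1 by auto
  have "(\<lambda>n. C * real n powr (- 1)) \<longlonglongrightarrow> 0" by real_asymp
  moreover have "\<forall>\<^sub>F n in sequentially. x0 \<le> real n"
    using filterlim_real_sequentially by (auto simp: filterlim_at_top)
  then have "\<forall>\<^sub>F n in sequentially. norm (f (real n)) \<le> C * real n powr (- 1)"
    by eventually_elim (use C f_pos in \<open>auto simp: less_imp_le\<close>)
  ultimately show ?thesis by (rule Lim_null_comparison[rotated])
qed

text \<open>If at least one jump occurs by time 1 and the first exceeds \<open>x\<close>, then so
  does the sum, all jumps being positive almost surely. Independence gives
  \<open>p * tail_prob x \<le> f (x - r * mean)\<close>, and for large \<open>x\<close> the shift is
  absorbed by passing to \<open>f (x / 2)\<close>.\<close>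

lemma tail_prob_bound:
  obtains C where "C > 0" "\<forall>\<^sub>F x in at_top. tail_prob x \<le> C * f x"
proof -
  define p where "p = prob {\<omega> \<in> space M. 1 \<le> N 1 \<omega>}"
  have p: "p > 0" unfolding p_def by (rule prob_N_1_ge_1)
  let ?c = "r * mean"
  have c: "?c \<ge> 0" using r_pos mean_nonneg by simp
  have le: "p * tail_prob x \<le> f (x - ?c)" for x
  proof -
    let ?E = "{\<omega> \<in> space M. 1 \<le> N 1 \<omega>}" and ?F = "{\<omega> \<in> space M. x < W 1 \<omega>}"
    have "?E \<in> sets sigma_N" "?F \<in> sets sigma_W"
    proof -
      have [measurable]: "N 1 \<in> measurable sigma_N (count_space UNIV)" "W 1 \<in> borel_measurable sigma_W" by auto
      have "{\<omega> \<in> space sigma_N. 1 \<le> N 1 \<omega>} \<in> sets sigma_N" by measurable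
      then show "?E \<in> sets sigma_N" by simp
      have "{\<omega> \<in> space sigma_W. x < W 1 \<omega>} \<in> sets sigma_W" by measurable
      then show "?F \<in> sets sigma_W" by simp
    qed
    then have "p * tail_prob x = prob (?E \<inter> ?F)" by (simp add: prob_N_W p_def tail_prob_def)
    also have "\<dots> \<le> prob {\<omega> \<in> space M. x < S1 \<omega>}"
    proof (rule finite_measure_mono_AE)
      show "AE \<omega> in M. \<omega> \<in> ?E \<inter> ?F \<longrightarrow> \<omega> \<in> {\<omega> \<in> space M. x < S1 \<omega>}"
        using W_pos_all
      proof eventually_elim
        case (elim \<omega>)
        show ?case
        proof
          assume \<omega>: "\<omega> \<in> ?E \<inter> ?F"
          have "W 1 \<omega> \<le> S1 \<omega>" unfolding S1_def
            using \<omega> elim by (intro member_le_sum[where f = "\<lambda>k. W k \<omega>"]) (auto intro: less_imp_le)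
          then show "\<omega> \<in> {\<omega> \<in> space M. x < S1 \<omega>}" using \<omega> by auto
        qed
      qed
    qed measurable
    also have "\<dots> = f (x - ?c)" by (simp add: f_eq)
    finally show ?thesis .
  qed
  obtain C where C: "C > 0" "\<forall>\<^sub>F x in at_top. f (1/2 * x) \<le> C * f x" using scale_bound[of "1/2"] by auto
  have "\<forall>\<^sub>F x in at_top. tail_prob x \<le> (C / p) * f x"
    using C(2) eventually_ge_at_top[of "2 * ?c"]
  proof eventually_elim
    case (elim x)
    have "p * tail_prob x \<le> f (x - ?c)" by (rule le)
    also have "\<dots> \<le> f (1/2 * x)" using elim(2) by (intro f_le) simp
    also have "\<dots> \<le> C * f x" by (rule elim)
    finally show ?case using p by (simp add: pos_le_divide_eq mult.commute)
  qed
  then show thesis using that[of "C / p"] C p by simp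
qed

lemma tail_prob_scaled_bound:
  assumes "c > 0"
  obtains C where "C > 0" "\<forall>\<^sub>F n in sequentially. tail_prob (c * real n) \<le> C * f (real n)"
proof -
  obtain C1 where C1: "C1 > 0" "\<forall>\<^sub>F x in at_top. tail_prob x \<le> C1 * f x" using tail_prob_bound by blast
  obtain C2 where C2: "C2 > 0" "\<forall>\<^sub>F x in at_top. f (c * x) \<le> C2 * f x" using scale_bound[OF assms] by blast
  have "\<forall>\<^sub>F n in sequentially. tail_prob (c * real n) \<le> C1 * f (c * real n)"
    by (rule eventually_compose_filterlim[OF C1(2) filterlim_real_scaled[OF assms]])
  moreover have "\<forall>\<^sub>F n in sequentially. f (c * real n) \<le> C2 * f (real n)"
    by (rule eventually_compose_filterlim[OF C2(2) filterlim_real_sequentially])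
  ultimately have "\<forall>\<^sub>F n in sequentially. tail_prob (c * real n) \<le> (C1 * C2) * f (real n)"
  proof eventually_elim
    case (elim n)
    have "C1 * f (c * real n) \<le> C1 * (C2 * f (real n))" using elim(2) C1(1) by (intro mult_left_mono) auto
    with elim(1) show ?case by simp
  qed
  then show thesis using that[of "C1 * C2"] C1 C2 by simp
qed

lemma moment:
  obtains q where "1 < q" "q \<le> 2" "integrable M (\<lambda>\<omega>. W 1 \<omega> powr q)"
proof -
  \<comment> \<open>An exponent strictly between 1 and \<open>\<beta>\<close> for the tail bound;
    then \<open>q\<close> is placed strictly between 1 and \<open>s\<close>, capped at 2.\<close>
  define s where "s = (1 + \<beta>) / 2"
  define q where "q = min 2 ((1 + s) / 2)"
  have s: "1 < s" "s < \<beta>" using \<beta>_gt_1 by (auto simp: s_def)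
  have q: "1 < q" "q \<le> 2" "q < s" using s by (auto simp: q_def min_def)
  obtain C1 where C1: "C1 > 0" "\<forall>\<^sub>F x in at_top. tail_prob x \<le> C1 * f x" using tail_prob_bound by blast
  obtain x1 where x1: "\<And>x. x \<ge> x1 \<Longrightarrow> tail_prob x \<le> C1 * f x"
    using C1(2) by (auto simp: eventually_at_top_linorder)
  obtain x0 C where C: "x0 > 0" "\<And>x. x0 \<le> x \<Longrightarrow> f x \<le> C * x powr (- s)"
    using upper_powr_bound[of s] s by auto
  have "tail_prob x \<le> (C1 * C) * x powr (- s)" if "x \<ge> max x0 x1" for x
  proof -
    have "tail_prob x \<le> C1 * f x" using that by (intro x1) simp
    also have "\<dots> \<le> C1 * (C * x powr (- s))" using that C1 by (intro mult_left_mono C) auto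
    finally show ?thesis by simp
  qed
  then have "integrable M (\<lambda>\<omega>. W 1 \<omega> powr q)"
    by (rule moment_from_tail[where ?x0.0 = "max x0 x1"]) (use q in simp_all)
  with q that show thesis by blast
qed

lemma concentration:
  fixes \<delta> C K :: real
  assumes "\<delta> > 0" "C > 0" "K > 0"
  shows "\<exists>\<gamma>0>0. \<forall>\<gamma>. 0 < \<gamma> \<and> \<gamma> \<le> \<gamma>0 \<longrightarrow> (\<forall>\<^sub>F n in sequentially.
    prob {\<omega> \<in> space M. \<exists>m. real m \<le> C * real n \<and> \<bar>trunc_sum (real n * \<gamma>) m \<omega> - m * mean\<bar> > \<delta> * n}
      \<le> real n powr (- K))"
proof -
  obtain q where "1 < q" "q \<le> 2" "integrable M (\<lambda>\<omega>. W 1 \<omega> powr q)" by (rule moment)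
  from trunc_sum_concentration[OF this assms] show ?thesis .
qed

text \<open>The converse half of the tail equivalence: if \<open>S1\<close> falls into a window although no summand
  does, then two summands are large or the sum of the small ones deviates, both of which are
  negligible.\<close>

lemma window_probability:
  fixes a b :: real
  assumes ab: "0 < a" "a < b"
  obtains c where "c > 0"
    "\<forall>\<^sub>F n in sequentially. c * f (real n) \<le> prob {\<omega> \<in> space M. a * n < W 1 \<omega> \<and> W 1 \<omega> \<le> b * n}"
proof -
  \<comment> \<open>The window is shrunk on both sides: the gap \<open>a' - a\<close> absorbs the
    sum of the small jumps, the gap \<open>b - b'\<close> the compensation
    \<open>r * mean\<close>.\<close>
  define a' b' where "a' = (2 * a + b) / 3" and "b' = (a + 2 * b) / 3"
  have ab': "a < a'" "a' < b'" "b' < b" using ab by (auto simp: a'_def b'_def)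
  define \<delta> where "\<delta> = (a' - a) / 2"
  \<comment> \<open>If \<open>N 1 \<le> \<rho> * n\<close>, the expected size of the truncated sum
    is at most \<open>\<delta> * n\<close>, so a truncated sum above \<open>2 * \<delta> * n\<close>
    deviates by more than \<open>\<delta> * n\<close>.\<close>
  define \<rho> where "\<rho> = \<delta> / (mean + 1)"
  have \<delta>: "\<delta> > 0" using ab' by (simp add: \<delta>_def)
  have \<rho>: "\<rho> > 0" "\<rho> * mean \<le> \<delta>" using \<delta> mean_nonneg by (auto simp: \<rho>_def field_simps)
  obtain c0 where c0: "c0 > 0" "\<forall>\<^sub>F x in at_top. c0 * f x \<le> f (a' * x) - f (b' * x)"
    using difference_bound[of a' b'] ab ab' by auto
  obtain G where G: "G > 0" "\<And>F p. (\<And>k. 1 \<le> k \<Longrightarrow> F k \<in> sets sigma_W) \<Longrightarrow>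
    (\<And>k. 1 \<le> k \<Longrightarrow> prob (F k) \<le> real k * p) \<Longrightarrow> 0 \<le> p \<Longrightarrow>
    prob {\<omega> \<in> space M. \<exists>k. 1 \<le> k \<and> k \<le> N 1 \<omega> \<and> \<omega> \<in> F k} \<le> G * p"
    using prob_random_index by blast
  have "\<beta> + 2 > 0" using \<beta>_gt_1 by simp
  from concentration[OF \<delta> \<rho>(1) this] obtain \<epsilon> where \<epsilon>: "\<epsilon> > 0"
    "\<forall>\<^sub>F n in sequentially. prob {\<omega> \<in> space M. \<exists>m. real m \<le> \<rho> * real n \<and>
      \<bar>trunc_sum (real n * \<epsilon>) m \<omega> - m * mean\<bar> > \<delta> * n} \<le> real n powr (- (\<beta> + 2))" by blast
  obtain C where C: "C > 0" "\<forall>\<^sub>F n in sequentially. tail_prob (\<epsilon> * real n) \<le> C * f (real n)"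
    using tail_prob_scaled_bound[OF \<epsilon>(1)] by blast
  have F1: "\<forall>\<^sub>F n in sequentially. c0 * f (real n) \<le> f (a' * real n) - f (b' * real n)"
    by (rule eventually_compose_filterlim[OF c0(2) filterlim_real_sequentially])
  have F2: "\<forall>\<^sub>F n in sequentially. real n powr (- (\<beta> + 2)) \<le> c0 / 8 * f (real n)"
  proof (rule negligible)
    show "(\<lambda>n. real n powr (- (\<beta> + 2)) * real n powr (\<beta> + 1)) \<longlonglongrightarrow> 0" using \<beta>_gt_1 by real_asymp
  qed (use c0 in auto)
  have F3: "\<forall>\<^sub>F n in sequentially. exp (r * (exp 1 - 1) - \<rho> * real n) \<le> c0 / 8 * f (real n)"
  proof (rule negligible)
    show "(\<lambda>n. exp (r * (exp 1 - 1) - \<rho> * real n) * real n powr (\<beta> + 1)) \<longlonglongrightarrow> 0" using \<beta>_gt_1 \<rho> by real_asymp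
  qed (use c0 in auto)
  have "(\<lambda>n. G * C\<^sup>2 * f (real n)) \<longlonglongrightarrow> G * C\<^sup>2 * 0" by (intro tendsto_mult tendsto_const f_tendsto_0)
  then have F4: "\<forall>\<^sub>F n in sequentially. G * C\<^sup>2 * f (real n) < c0 / 4" using c0 by (intro order_tendstoD) auto
  have F5: "\<forall>\<^sub>F n in sequentially. r * mean / (b - b') \<le> real n"
    using filterlim_real_sequentially by (auto simp: filterlim_at_top)
  \<comment> \<open>Of the mass \<open>c0 * f n\<close>, the events \<open>?E3\<close> and
    \<open>?E4\<close> take at most one eighth each and \<open>?E2\<close> one quarter; half remains
    for \<open>?E1\<close>, whose probability is at most \<open>G * p\<close>.\<close>
  have "\<forall>\<^sub>F n in sequentially. c0 / (2 * G) * f (real n) \<le> prob {\<omega> \<in> space M. a * n < W 1 \<omega> \<and> W 1 \<omega> \<le> b * n}"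
    using F1 F2 F3 F4 F5 \<epsilon>(2) C(2) eventually_gt_at_top[of 0]
  proof eventually_elim
    case (elim n)
    define p where "p = prob {\<omega> \<in> space M. a * n < W 1 \<omega> \<and> W 1 \<omega> \<le> b * n}"
    define t where "t = tail_prob (\<epsilon> * n)"
    let ?c = "r * mean"
    have c: "?c \<ge> 0" "?c \<le> (b - b') * n" using elim(5) r_pos mean_nonneg ab' by (auto simp: pos_divide_le_eq mult.commute)
    let ?F1 = "\<lambda>k. {\<omega> \<in> space M. a * n < W k \<omega> \<and> W k \<omega> \<le> b * n}"
    let ?F2 = "\<lambda>k. \<Union>j\<in>{1..<k}. {\<omega> \<in> space M. \<epsilon> * n < W j \<omega> \<and> \<epsilon> * n < W k \<omega>}"
    let ?E1 = "{\<omega> \<in> space M. \<exists>k. 1 \<le> k \<and> k \<le> N 1 \<omega> \<and> \<omega> \<in> ?F1 k}"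
    let ?E2 = "{\<omega> \<in> space M. \<exists>k. 1 \<le> k \<and> k \<le> N 1 \<omega> \<and> \<omega> \<in> ?F2 k}"
    let ?E3 = "{\<omega> \<in> space M. real (N 1 \<omega>) \<ge> \<rho> * n}"
    let ?E4 = "{\<omega> \<in> space M. \<exists>m. real m \<le> \<rho> * real n \<and> \<bar>trunc_sum (real n * \<epsilon>) m \<omega> - m * mean\<bar> > \<delta> * n}"
    have F1W: "?F1 k \<in> sets sigma_W" if k: "1 \<le> k" for k
    proof -
      have [measurable]: "W k \<in> borel_measurable sigma_W" using k by auto
      have "{\<omega> \<in> space sigma_W. a * n < W k \<omega> \<and> W k \<omega> \<le> b * n} \<in> sets sigma_W" by measurable
      then show ?thesis by simp
    qed
    have F2W: "?F2 k \<in> sets sigma_W" if k: "1 \<le> k" for k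
    proof (rule sets.finite_UN[OF finite_atLeastLessThan])
      fix j assume j: "j \<in> {1..<k}"
      have [measurable]: "W k \<in> borel_measurable sigma_W" "W j \<in> borel_measurable sigma_W" using k j by auto
      have "{\<omega> \<in> space sigma_W. \<epsilon> * n < W j \<omega> \<and> \<epsilon> * n < W k \<omega>} \<in> sets sigma_W" by measurable
      then show "{\<omega> \<in> space M. \<epsilon> * n < W j \<omega> \<and> \<epsilon> * n < W k \<omega>} \<in> sets sigma_W" by simp
    qed
    have E1: "prob ?E1 \<le> G * p"
    proof (rule G(2)[OF F1W])
      fix k :: nat assume k: "1 \<le> k"
      have "prob (?F1 k) = prob {\<omega> \<in> space M. W k \<omega> \<in> {a * n<..b * n}}" by simp
      also have "\<dots> = prob {\<omega> \<in> space M. W 1 \<omega> \<in> {a * n<..b * n}}" using k by (intro prob_W) auto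
      also have "\<dots> = p" by (simp add: p_def)
      also have "\<dots> \<le> real k * p" using k by (simp add: p_def mult_le_cancel_right1)
      finally show "prob (?F1 k) \<le> real k * p" .
    qed (auto simp: p_def)
    have E2: "prob ?E2 \<le> G * t\<^sup>2"
    proof (rule G(2)[OF F2W])
      fix k :: nat assume k: "1 \<le> k"
      have "prob (?F2 k) \<le> (\<Sum>j\<in>{1..<k}. prob {\<omega> \<in> space M. \<epsilon> * n < W j \<omega> \<and> \<epsilon> * n < W k \<omega>})"
        using k by (intro finite_measure_subadditive_finite) auto
      also have "\<dots> = (\<Sum>j\<in>{1..<k}. t\<^sup>2)" by (intro sum.cong) (auto simp: t_def prob_W_pair)
      also have "\<dots> \<le> real k * t\<^sup>2" by (auto intro!: mult_right_mono)
      finally show "prob (?F2 k) \<le> real k * t\<^sup>2" .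
    qed auto
    have E3: "prob ?E3 \<le> exp (r * (exp 1 - 1) - \<rho> * real n)"
      using N_chernoff(1)[of 1 1 "\<rho> * n"] by simp
    have sets: "?E1 \<in> sets M" "?E2 \<in> sets M" "?E3 \<in> sets M" "?E4 \<in> sets M"
    proof -
      have [measurable]: "N 1 \<in> measurable M (count_space UNIV)" by auto
      have "?E1 = (\<Union>k\<in>{1..}. {\<omega> \<in> space M. k \<le> N 1 \<omega>} \<inter> ?F1 k)" by auto
      also have "\<dots> \<in> sets M" by (intro sets.countable_UN' sets.Int subsetD[OF sets_sigma_subset(2) F1W]) auto
      finally show "?E1 \<in> sets M" .
      have "?E2 = (\<Union>k\<in>{1..}. {\<omega> \<in> space M. k \<le> N 1 \<omega>} \<inter> ?F2 k)" by auto
      also have "\<dots> \<in> sets M" by (intro sets.countable_UN' sets.Int subsetD[OF sets_sigma_subset(2) F2W]) auto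
      finally show "?E2 \<in> sets M" .
      show "?E3 \<in> sets M" "?E4 \<in> sets M" by measurable
    qed
    have "c0 * f n \<le> f (a' * n) - f (b' * n)" by (rule elim(1))
    also have "\<dots> = prob ({\<omega> \<in> space M. a' * n + ?c < S1 \<omega>} - {\<omega> \<in> space M. b' * n + ?c < S1 \<omega>})"
      unfolding f_eq using ab' by (subst finite_measure_Diff) (auto simp: mult_right_mono elim!: le_less_trans[rotated])
    also have "\<dots> \<le> prob ((?E1 \<union> ?E2) \<union> (?E3 \<union> ?E4))"
    proof (rule finite_measure_mono_AE)
      show "AE \<omega> in M. \<omega> \<in> {\<omega> \<in> space M. a' * n + ?c < S1 \<omega>} - {\<omega> \<in> space M. b' * n + ?c < S1 \<omega>} \<longrightarrow>
          \<omega> \<in> (?E1 \<union> ?E2) \<union> (?E3 \<union> ?E4)"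
        using W_pos_all
      proof eventually_elim
        case (elim \<omega>)
        show ?case
        proof
          assume asm: "\<omega> \<in> {\<omega> \<in> space M. a' * n + ?c < S1 \<omega>} - {\<omega> \<in> space M. b' * n + ?c < S1 \<omega>}"
          then have \<omega>: "\<omega> \<in> space M" "a' * n < S1 \<omega>" "S1 \<omega> \<le> b' * n + ?c" using c by auto
          then have Sb: "S1 \<omega> \<le> b * n" using c by (simp add: algebra_simps)
          show "\<omega> \<in> (?E1 \<union> ?E2) \<union> (?E3 \<union> ?E4)"
          proof (rule ccontr)
            assume no: "\<not> ?thesis"
            let ?I = "{1..N 1 \<omega>}"
            have pos: "0 < W k \<omega>" if "k \<in> ?I" for k using elim that by auto
            \<comment> \<open>A summand is at most the whole sum, hence at most
              \<open>b * n\<close>; not lying in the window, it is at most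
              \<open>a * n\<close>.\<close>
            have small: "W k \<omega> \<le> a * n" if k: "k \<in> ?I" for k
            proof -
              have "W k \<omega> \<le> S1 \<omega>" unfolding S1_def using k pos
                by (intro member_le_sum[where f = "\<lambda>k. W k \<omega>"]) (auto intro: less_imp_le)
              then show ?thesis using no k Sb \<omega>(1) by fastforce
            qed
            let ?big = "{k \<in> ?I. \<epsilon> * n < W k \<omega>}"
            have uniq: "j = k" if "j \<in> ?big" "k \<in> ?big" for j k
            proof (rule ccontr)
              assume "j \<noteq> k"
              then consider "j < k" | "k < j" by linarith
              then show False
              proof cases
                case 1
                then have "\<omega> \<in> ?F2 k" using that \<omega>(1) by auto
                then show False using no that \<omega>(1) by auto
              next
                case 2
                then have "\<omega> \<in> ?F2 j" using that \<omega>(1) by auto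
                then show False using no that \<omega>(1) by auto
              qed
            qed
            have "(\<Sum>k\<in>?big. W k \<omega>) \<le> a * n"
            proof (cases "?big = {}")
              case True
              then show ?thesis using ab by (simp only:) simp
            next
              case False
              then obtain k where k: "k \<in> ?big" by blast
              then have "?big = {k}" using uniq by blast
              then have "(\<Sum>k\<in>?big. W k \<omega>) = W k \<omega>" by (simp only:) simp
              then show ?thesis using small[of k] k by simp
            qed
            moreover have "S1 \<omega> = trunc_sum (real n * \<epsilon>) (N 1 \<omega>) \<omega> + (\<Sum>k\<in>?big. W k \<omega>)"
              unfolding S1_def trunc_sum_def
              by (subst sum.inter_filter) (auto simp: sum.distrib[symmetric] truncate_def mult.commute intro!: sum.cong)
            ultimately have big: "trunc_sum (real n * \<epsilon>) (N 1 \<omega>) \<omega> > (2 * \<delta>) * n"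
              using \<omega>(2) by (simp add: \<delta>_def algebra_simps)
            have N\<rho>: "real (N 1 \<omega>) \<le> \<rho> * n" using no \<omega>(1) by auto
            have "real (N 1 \<omega>) * mean \<le> (\<rho> * n) * mean" using N\<rho> mean_nonneg by (intro mult_right_mono)
            also have "\<dots> = (\<rho> * mean) * n" by simp
            also have "\<dots> \<le> \<delta> * n" using \<rho> by (intro mult_right_mono) auto
            finally have "\<bar>trunc_sum (real n * \<epsilon>) (N 1 \<omega>) \<omega> - N 1 \<omega> * mean\<bar> > \<delta> * n" using big by simp
            then have "\<omega> \<in> ?E4" using N\<rho> \<omega>(1) by blast
            then show False using no by blast
          qed
        qed
      qed
    qed (use sets in auto)
    also have "\<dots> \<le> (prob ?E1 + prob ?E2) + (prob ?E3 + prob ?E4)"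
      using sets by (intro order_trans[OF measure_Un_le] add_mono measure_Un_le) auto
    also have "\<dots> \<le> (G * p + G * t\<^sup>2) + (c0 / 8 * f n + c0 / 8 * f n)"
      using E1 E2 E3 elim(2,3,6) by linarith
    also have "G * t\<^sup>2 \<le> c0 / 4 * f n"
    proof -
      have "t\<^sup>2 \<le> (C * f n)\<^sup>2" using elim(7) by (intro power_mono) (auto simp: t_def tail_prob_nonneg)
      then have "G * t\<^sup>2 \<le> G * (C * f n)\<^sup>2" using G(1) by (intro mult_left_mono) auto
      also have "\<dots> = (G * C\<^sup>2 * f n) * f n" by (simp add: power2_eq_square)
      also have "\<dots> \<le> c0 / 4 * f n" using elim(4) f_pos[of n] by (intro mult_right_mono) auto
      finally show ?thesis .
    qed
    finally have "c0 / 2 * f n \<le> G * p" by (simp add: algebra_simps)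
    then have "c0 / (2 * G) * f n \<le> p" using G(1) by (simp add: field_simps)
    then show ?case by (simp add: p_def)
  qed
  then show thesis using that[of "c0 / (2 * G)"] c0 G by simp
qed

end

lemma (in iid_positive) many_exceed_sets:
  "{\<omega> \<in> space M. l \<le> card {k \<in> {1..m}. x < W k \<omega>}} \<in> sets M"
proof -
  have eq: "real (card {k \<in> {1..m}. x < W k \<omega>}) = (\<Sum>k\<in>{1..m}. indicator {x<..} (W k \<omega>))" for \<omega>
  proof -
    have "(\<Sum>k\<in>{1..m}. indicator {x<..} (W k \<omega>)) = (\<Sum>k\<in>{1..m}. if x < W k \<omega> then 1 else (0::real))"
      by (intro sum.cong) (auto simp: indicator_def)
    also have "\<dots> = (\<Sum>k\<in>{k \<in> {1..m}. x < W k \<omega>}. 1)" by (rule sum.inter_filter[symmetric]) simp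
    finally show ?thesis by simp
  qed
  have "{\<omega> \<in> space M. l \<le> card {k \<in> {1..m}. x < W k \<omega>}} =
      {\<omega> \<in> space M. real l \<le> real (card {k \<in> {1..m}. x < W k \<omega>})}" by simp
  also have "\<dots> \<in> sets M" unfolding eq by measurable
  finally show ?thesis .
qed

section \<open>Upper bounds for the scaled process\<close>

context compound_poisson
begin

definition X :: "nat \<Rightarrow> 'a \<Rightarrow> skorokhod" where
  "X n = scaled_process (compensated_process M r N W) n"

lemma X_sets:
  assumes "n > 0" "S \<in> sets borel"
  shows "{\<omega> \<in> space M. X n \<omega> \<in> S} \<in> sets M"
  using measurable_sets[OF scaled_process_measurable[OF assms(1)] assms(2)]
  by (simp add: X_def vimage_def Int_def conj_commute)

lemma driven_path_X:
  "\<omega> \<in> space M \<Longrightarrow> n > 0 \<Longrightarrow> counting_path.driven_path (\<lambda>t. N t \<omega>) (X n \<omega>) n (\<lambda>k. W k \<omega>) (r * mean)"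
  unfolding X_def by (rule driven_path_scaled_process)

lemma X_many_large_jumps_iff:
  assumes "n > 0" "\<gamma> > 0"
  shows "AE \<omega> in M. X n \<omega> \<in> many_large_jumps \<gamma> l \<longleftrightarrow> l \<le> card {k \<in> {1..N (real n) \<omega>}. W k \<omega> > n * \<gamma>}"
proof -
  have "AE \<omega> in M. counting_path.simple_until (\<lambda>t. N t \<omega>) (real n)"
    using assms by (intro AE_simple_until) simp
  with AE_space show ?thesis
  proof eventually_elim
    case (elim \<omega>)
    then show ?case unfolding many_large_jumps_def
      using counting_path.card_large_jumps[OF counting_path_N[OF elim(1)] driven_path_X[OF elim(1) assms(1)] elim(2) assms(2)]
      by simp
  qed
qed

lemma N_good_linear:
  assumes "\<delta> > 0"
  shows "\<forall>\<^sub>F n in sequentially. \<forall>\<omega>\<in>N_good \<delta> n. \<forall>s\<in>{0..real n}. \<bar>real (N s \<omega>) - r * s\<bar> \<le> 2 * \<delta> * n"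
proof -
  have "\<forall>\<^sub>F n in sequentially. r / \<delta> \<le> real n"
    using filterlim_real_sequentially by (auto simp: filterlim_at_top)
  then show ?thesis
  proof eventually_elim
    case (elim n)
    then have "r \<le> \<delta> * n" using assms by (simp add: pos_divide_le_eq mult.commute)
    then show ?case using N_goodD[of _ \<delta> n] by fastforce
  qed
qed

end

context heavy_tailed_compound_poisson
begin

text \<open>Eventually \<open>f n\<close> is at least \<open>n powr (- (\<beta> + 2))\<close>, so
  \<open>n * f n\<close> is at least \<open>n powr (- (\<beta> + 1))\<close>; the power
  \<open>l\<close> gives the condition on \<open>K\<close>.\<close>

lemma powr_negligible:
  assumes "K \<ge> real l * (\<beta> + 1)"
  shows "\<forall>\<^sub>F n in sequentially. real n powr (- K) \<le> (real n * f (real n)) ^ l"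
proof -
  have "\<forall>\<^sub>F n in sequentially. real n powr (- (\<beta> + 2)) \<le> 1 * f (real n)"
  proof (rule negligible)
    show "(\<lambda>n. real n powr (- (\<beta> + 2)) * real n powr (\<beta> + 1)) \<longlonglongrightarrow> 0" using \<beta>_gt_1 by real_asymp
  qed auto
  then show ?thesis using eventually_ge_at_top[of 1]
  proof eventually_elim
    case (elim n)
    have "real n powr (- K) \<le> real n powr (- (real l * (\<beta> + 1)))"
      using assms elim(2) by (intro powr_mono) auto
    also have "- (real l * (\<beta> + 1)) = - (\<beta> + 1) * real l" by (simp add: algebra_simps)
    also have "real n powr \<dots> = (real n powr (- (\<beta> + 1))) powr real l" by (simp only: powr_powr)
    also have "\<dots> = (real n powr (- (\<beta> + 1))) ^ l" using elim(2) by (intro powr_realpow) auto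
    also have "\<dots> \<le> (real n * f (real n)) ^ l"
    proof (rule power_mono)
      have "real n powr (- (\<beta> + 1)) = real n powr 1 * real n powr (- (\<beta> + 2))"
        unfolding powr_add[symmetric] by (simp add: algebra_simps)
      also have "\<dots> \<le> real n * f (real n)" using elim by (intro mult_mono) auto
      finally show "real n powr (- (\<beta> + 1)) \<le> real n * f (real n)" .
    qed auto
    finally show ?case .
  qed
qed

lemma prob_many_large_jumps_bound:
  assumes "\<gamma> > 0"
  obtains C where "C > 0"
    "\<forall>\<^sub>F n in sequentially. prob {\<omega> \<in> space M. X n \<omega> \<in> many_large_jumps \<gamma> l} \<le> C * (real n * f (real n)) ^ l"
proof -
  obtain C0 where C0: "C0 > 0" "\<forall>\<^sub>F n in sequentially. tail_prob (\<gamma> * real n) \<le> C0 * f (real n)"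
    using tail_prob_scaled_bound[OF assms] by blast
  \<comment> \<open>On \<open>N_good 1 n\<close> the number of arrivals up to time \<open>n\<close>
    is eventually at most \<open>r * n + 2 * n\<close>.\<close>
  define c where "c = r + 2"
  have c: "c > 0" using r_pos by (simp add: c_def)
  define K where "K = real l * (\<beta> + 1) + 1"
  have K: "K > 0" "K \<ge> real l * (\<beta> + 1)" using \<beta>_gt_1 by (simp_all add: K_def add_nonneg_pos)
  have "\<forall>\<^sub>F n in sequentially. prob {\<omega> \<in> space M. X n \<omega> \<in> many_large_jumps \<gamma> l} \<le>
      (1 + (c * C0) ^ l) * (real n * f (real n)) ^ l"
    using C0(2) N_good_linear[OF zero_less_one] prob_not_N_good[OF zero_less_one K(1)] powr_negligible[OF K(2)]
      eventually_gt_at_top[of 0]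
  proof eventually_elim
    case outer: (elim n)
    define m where "m = nat \<lfloor>c * real n\<rfloor>"
    have m: "real m \<le> c * n" using c by (simp add: m_def)
    let ?B = "{\<omega> \<in> space M. X n \<omega> \<in> many_large_jumps \<gamma> l}"
    let ?D = "{\<omega> \<in> space M. l \<le> card {k \<in> {1..m}. n * \<gamma> < W k \<omega>}}"
    have D_sets: "?D \<in> sets M"
      by (rule many_exceed_sets)
    have "prob ?B \<le> prob ((space M - N_good 1 n) \<union> ?D)"
    proof (rule finite_measure_mono_AE)
      show "AE \<omega> in M. \<omega> \<in> ?B \<longrightarrow> \<omega> \<in> (space M - N_good 1 n) \<union> ?D"
        using X_many_large_jumps_iff[OF outer(5) assms, of l]
      proof eventually_elim
        case (elim \<omega>)
        show ?case
        proof (cases "\<omega> \<in> N_good 1 n")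
          case True
          have "\<bar>real (N (real n) \<omega>) - r * real n\<bar> \<le> 2 * 1 * n"
            using outer(2) True by auto
          then have "real (N (real n) \<omega>) \<le> c * n" by (simp add: c_def algebra_simps)
          then have "N (real n) \<omega> \<le> m" by (simp add: m_def le_nat_iff le_floor_iff)
          then have "{k \<in> {1..N (real n) \<omega>}. W k \<omega> > n * \<gamma>} \<subseteq> {k \<in> {1..m}. n * \<gamma> < W k \<omega>}" by auto
          then have "card {k \<in> {1..N (real n) \<omega>}. W k \<omega> > n * \<gamma>} \<le> card {k \<in> {1..m}. n * \<gamma> < W k \<omega>}"
            by (intro card_mono) auto
          then show ?thesis using elim by auto
        qed auto
      qed
    qed (use D_sets in auto)
    also have "\<dots> \<le> prob (space M - N_good 1 n) + prob ?D" using D_sets by (intro measure_Un_le) auto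
    also have "prob ?D \<le> (real m * tail_prob (n * \<gamma>)) ^ l" by (rule prob_many_exceed)
    also have "\<dots> \<le> ((c * n) * (C0 * f n)) ^ l"
      using outer(1) m tail_prob_nonneg by (intro power_mono mult_mono) (auto simp: mult.commute)
    also have "\<dots> = (c * C0) ^ l * (real n * f n) ^ l" by (simp add: power_mult_distrib mult_ac)
    finally show ?case using outer(3,4) by (simp add: algebra_simps)
  qed
  then show thesis using that[of "1 + (c * C0) ^ l"] c C0 by (simp add: add_pos_nonneg)
qed

lemma prob_without_large_jumps_bound:
  fixes \<delta> K :: real
  assumes \<delta>: "\<delta> > 0" and K: "K > 0"
    and far: "\<And>x z. x \<in> A \<Longrightarrow> z \<in> (\<Union>k<l. step_paths k) \<Longrightarrow> \<delta> \<le> dist x z"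
  obtains \<gamma> where "\<gamma> > 0" "\<forall>\<^sub>F n in sequentially.
    prob {\<omega> \<in> space M. X n \<omega> \<in> A \<and> X n \<omega> \<notin> many_large_jumps \<gamma> l} \<le> real n powr (- K)"
proof -
  \<comment> \<open>The admissible deviation \<open>\<delta> / 2 * n\<close> is split equally: one
    quarter of \<open>\<delta> * n\<close> for the truncated sum around \<open>m * mean\<close>, one
    for \<open>m * mean\<close> around its linear drift. The \<open>mean + 1\<close> avoids a zero
    denominator.\<close>
  define \<delta>1 where "\<delta>1 = \<delta> / (8 * (mean + 1))"
  define C where "C = r + 2 * \<delta>1"
  have \<delta>1: "\<delta>1 > 0" "2 * \<delta>1 * mean \<le> \<delta> / 4"
    using \<delta> mean_nonneg by (auto simp: \<delta>1_def field_simps)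
  have C: "C > 0" using \<delta>1 r_pos by (simp add: C_def)
  \<comment> \<open>The exponent \<open>K + 1\<close> leaves one spare power of \<open>n\<close> to
    pay for adding two error probabilities.\<close>
  have \<delta>4: "\<delta> / 4 > 0" and K1: "K + 1 > 0" using \<delta> K by auto
  obtain \<gamma> where \<gamma>: "\<gamma> > 0" "\<forall>\<^sub>F n in sequentially.
      prob {\<omega> \<in> space M. \<exists>m. real m \<le> C * real n \<and> \<bar>trunc_sum (real n * \<gamma>) m \<omega> - m * mean\<bar> > \<delta> / 4 * n}
        \<le> real n powr (- (K + 1))"
    using concentration[OF \<delta>4 C K1] by blast
  have "(\<lambda>n. 2 * real n powr (- 1)) \<longlonglongrightarrow> 0" by real_asymp
  then have "\<forall>\<^sub>F n in sequentially. 2 * real n powr (- 1) < 1" by (intro order_tendstoD) auto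
  then have "\<forall>\<^sub>F n in sequentially.
      prob {\<omega> \<in> space M. X n \<omega> \<in> A \<and> X n \<omega> \<notin> many_large_jumps \<gamma> l} \<le> real n powr (- K)"
    using \<gamma>(2) prob_not_N_good[OF \<delta>1(1) K1] N_good_linear[OF \<delta>1(1)] eventually_gt_at_top[of 0]
  proof eventually_elim
    case (elim n)
    let ?G = "space M - N_good \<delta>1 n"
    let ?D = "{\<omega> \<in> space M. \<exists>m. real m \<le> C * real n \<and> \<bar>trunc_sum (real n * \<gamma>) m \<omega> - m * mean\<bar> > \<delta> / 4 * n}"
    have D_sets: "?D \<in> sets M" by measurable
    have "prob {\<omega> \<in> space M. X n \<omega> \<in> A \<and> X n \<omega> \<notin> many_large_jumps \<gamma> l} \<le> prob (?G \<union> ?D)"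
    proof (rule finite_measure_mono_AE)
      show "AE \<omega> in M. \<omega> \<in> {\<omega> \<in> space M. X n \<omega> \<in> A \<and> X n \<omega> \<notin> many_large_jumps \<gamma> l} \<longrightarrow> \<omega> \<in> ?G \<union> ?D"
        using X_many_large_jumps_iff[OF elim(5) \<gamma>(1), of l]
      proof eventually_elim
        case iff: (elim \<omega>)
        show ?case
        proof (intro impI, rule ccontr)
          assume "\<omega> \<in> {\<omega> \<in> space M. X n \<omega> \<in> A \<and> X n \<omega> \<notin> many_large_jumps \<gamma> l}" and no: "\<omega> \<notin> ?G \<union> ?D"
          then have \<omega>: "\<omega> \<in> space M" "X n \<omega> \<in> A" "X n \<omega> \<notin> many_large_jumps \<gamma> l" and good: "\<omega> \<in> N_good \<delta>1 n" by auto
          interpret counting_path "\<lambda>t. N t \<omega>" by (rule counting_path_N[OF \<omega>(1)])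
          have "card {k \<in> {1..N (real n) \<omega>}. W k \<omega> > n * \<gamma>} < l" using iff \<omega> by auto
          from driven_path_far_from_steps[OF driven_path_X[OF \<omega>(1) elim(5)] \<gamma>(1) \<delta> this] far[OF \<omega>(2)]
          obtain t :: real where t: "t \<in> {0..1}" and dev:
            "\<bar>(\<Sum>k=1..N (real n * t) \<omega>. truncate (n * \<gamma>) (W k \<omega>)) - n * (r * mean) * t\<bar> > n * (\<delta> / 2)" by blast
          define m where "m = N (real n * t) \<omega>"
          have nt: "real n * t \<in> {0..real n}" using t by (auto simp: mult_left_le)
          have Nm: "\<bar>real m - r * (n * t)\<bar> \<le> 2 * \<delta>1 * n" unfolding m_def using elim(4) good nt by blast
          have "r * (n * t) \<le> r * n" using nt r_pos by (intro mult_left_mono) auto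
          with Nm have "real m \<le> C * n" by (simp add: C_def algebra_simps)
          then have tr: "\<bar>trunc_sum (n * \<gamma>) m \<omega> - m * mean\<bar> \<le> \<delta> / 4 * n" using no \<omega>(1) by force
          have "\<bar>m * mean - n * (r * mean) * t\<bar> = \<bar>real m - r * (n * t)\<bar> * mean"
          proof -
            have "m * mean - n * (r * mean) * t = (real m - r * (n * t)) * mean" by (simp add: algebra_simps)
            then show ?thesis using mean_nonneg by (simp add: abs_mult)
          qed
          also have "\<dots> \<le> (2 * \<delta>1 * n) * mean" using Nm mean_nonneg by (intro mult_right_mono)
          also have "\<dots> = (2 * \<delta>1 * mean) * n" by simp
          also have "\<dots> \<le> \<delta> / 4 * n" using \<delta>1 by (intro mult_right_mono) auto
          finally have me: "\<bar>m * mean - n * (r * mean) * t\<bar> \<le> \<delta> / 4 * n" .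
          have tri: "\<bar>x - y\<bar> \<le> d \<Longrightarrow> \<bar>y - z\<bar> \<le> d \<Longrightarrow> \<bar>x - z\<bar> \<le> 2 * d" for x y z d :: real
            by linarith
          from tri[OF tr me] dev show False by (simp add: trunc_sum_def m_def mult.commute)
        qed
      qed
    qed (use D_sets in auto)
    also have "\<dots> \<le> prob ?G + prob ?D" using D_sets by (intro measure_Un_le) auto
    also have "\<dots> \<le> 2 * real n powr (- (K + 1))" using elim(2,3) by simp
    also have "\<dots> = (2 * real n powr (- 1)) * real n powr (- K)"
      using powr_add[of "real n" "- K" "- 1"] by simp
    also have "\<dots> \<le> 1 * real n powr (- K)" using elim(1) by (intro mult_right_mono) auto
    finally show ?case by simp
  qed
  with \<gamma>(1) that show thesis by blast
qed

end

section \<open>The lower bound\<close>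

definition in_windows :: "'i set \<Rightarrow> ('i \<Rightarrow> nat) \<Rightarrow> ('i \<Rightarrow> real) \<Rightarrow> ('i \<Rightarrow> real) \<Rightarrow> (nat \<Rightarrow> real) \<Rightarrow> bool" where
  "in_windows I \<kappa> lo hi w \<longleftrightarrow> (\<forall>i\<in>I. lo i < w (\<kappa> i) \<and> w (\<kappa> i) \<le> hi i)"

text \<open>Values at positions in \<open>R\<close> are never read, which makes this event
  independent of \<open>in_windows\<close> at \<open>R\<close>. The centring is still
  \<open>real m * \<mu>\<close>; the few missing terms are charged to \<open>d\<close>.\<close>

definition regular_outside :: "nat set \<Rightarrow> nat \<Rightarrow> real \<Rightarrow> real \<Rightarrow> real \<Rightarrow> (nat \<Rightarrow> real) \<Rightarrow> bool" where
  "regular_outside R m0 a \<mu> d w \<longleftrightarrow> (\<forall>j\<in>{1..m0} - R. w j \<le> a) \<and>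
     (\<forall>m\<in>{..m0}. \<bar>(\<Sum>j\<in>{1..m} - R. w j) - real m * \<mu>\<bar> \<le> d)"

lemma in_windows_restrict: "\<kappa> ` I \<subseteq> A \<Longrightarrow> in_windows I \<kappa> lo hi (restrict w A) = in_windows I \<kappa> lo hi w"
  by (auto simp: in_windows_def)

lemma regular_outside_restrict:
  "regular_outside R m0 a \<mu> d (restrict w ({1..m0} - R)) = regular_outside R m0 a \<mu> d w"
proof -
  have "(\<Sum>j\<in>{1..m} - R. restrict w ({1..m0} - R) j) = (\<Sum>j\<in>{1..m} - R. w j)" if "m \<le> m0" for m
    using that by (intro sum.cong) auto
  then show ?thesis by (auto simp: regular_outside_def)
qed

lemma sets_in_windows:
  assumes "finite I" "\<And>i. i \<in> I \<Longrightarrow> (\<lambda>\<omega>. V (\<kappa> i) \<omega>) \<in> borel_measurable M"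
  shows "{\<omega> \<in> space M. in_windows I \<kappa> lo hi (\<lambda>k. V k \<omega>)} \<in> sets M"
proof -
  have "{\<omega> \<in> space M. lo i < V (\<kappa> i) \<omega> \<and> V (\<kappa> i) \<omega> \<le> hi i} \<in> sets M" if "i \<in> I" for i
  proof -
    note [measurable] = assms(2)[OF that]
    show ?thesis by measurable
  qed
  then show ?thesis unfolding in_windows_def using assms(1) by (intro sets.sets_Collect_finite_All) auto
qed

lemma sets_regular_outside:
  assumes V: "\<And>k. k \<in> {1..m0} - R \<Longrightarrow> (\<lambda>\<omega>. V k \<omega>) \<in> borel_measurable M"
  shows "{\<omega> \<in> space M. regular_outside R m0 a \<mu> d (\<lambda>k. V k \<omega>)} \<in> sets M"
proof -
  have "{\<omega> \<in> space M. V j \<omega> \<le> a} \<in> sets M" if "j \<in> {1..m0} - R" for j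
  proof -
    note [measurable] = V[OF that]
    show ?thesis by measurable
  qed
  then have 1: "{\<omega> \<in> space M. \<forall>j\<in>{1..m0} - R. V j \<omega> \<le> a} \<in> sets M"
    by (intro sets.sets_Collect_finite_All) auto
  have "{\<omega> \<in> space M. \<bar>(\<Sum>j\<in>{1..m} - R. V j \<omega>) - real m * \<mu>\<bar> \<le> d} \<in> sets M" if "m \<in> {..m0}" for m
  proof -
    have [measurable]: "(\<lambda>\<omega>. \<Sum>j\<in>{1..m} - R. V j \<omega>) \<in> borel_measurable M"
      using that by (intro borel_measurable_sum V) auto
    show ?thesis by measurable
  qed
  then have 2: "{\<omega> \<in> space M. \<forall>m\<in>{..m0}. \<bar>(\<Sum>j\<in>{1..m} - R. V j \<omega>) - real m * \<mu>\<bar> \<le> d} \<in> sets M"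
    by (intro sets.sets_Collect_finite_All) auto
  from sets.sets_Collect_conj[OF 2 1] show ?thesis by (simp only: regular_outside_def)
qed

context iid_positive
begin

abbreviation WW :: "'a \<Rightarrow> nat \<Rightarrow> real" where "WW \<omega> \<equiv> \<lambda>k. W k \<omega>"

text \<open>The two predicates read disjoint blocks of coordinates, and the restrictions of
  \<open>W\<close> to disjoint blocks are independent. Injectivity of \<open>\<kappa>\<close> turns
  the product over positions into one over \<open>I\<close>.\<close>

lemma prob_windows_regular:
  assumes I: "finite I" "inj_on \<kappa> I" "\<kappa> ` I \<subseteq> {1..}"
  shows "prob {\<omega> \<in> space M. in_windows I \<kappa> lo hi (WW \<omega>) \<and> regular_outside (\<kappa> ` I) m0 a \<mu> d (WW \<omega>)} =
    (\<Prod>i\<in>I. prob {\<omega> \<in> space M. lo i < W 1 \<omega> \<and> W 1 \<omega> \<le> hi i}) *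
    prob {\<omega> \<in> space M. regular_outside (\<kappa> ` I) m0 a \<mu> d (WW \<omega>)}"
proof -
  let ?A = "\<kappa> ` I" and ?B = "{1..m0} - \<kappa> ` I"
  let ?P = "\<lambda>A. Pi\<^sub>M A (\<lambda>_. borel :: real measure)"
  let ?S = "{x \<in> space (?P ?A). in_windows I \<kappa> lo hi (\<lambda>k. x k)}"
  let ?T = "{x \<in> space (?P ?B). regular_outside ?A m0 a \<mu> d (\<lambda>k. x k)}"
  have S: "?S \<in> sets (?P ?A)"
    using I by (intro sets_in_windows) auto
  have T: "?T \<in> sets (?P ?B)" by (intro sets_regular_outside) auto
  have ind: "indep_var (?P ?A) (\<lambda>\<omega>. restrict (\<lambda>i. W i \<omega>) ?A) (?P ?B) (\<lambda>\<omega>. restrict (\<lambda>i. W i \<omega>) ?B)"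
    using I by (intro indep_var_restrict[OF W_indep]) auto
  have 1: "(\<lambda>\<omega>. (restrict (\<lambda>i. W i \<omega>) ?A, restrict (\<lambda>i. W i \<omega>) ?B)) -` (?S \<times> ?T) \<inter> space M =
      {\<omega> \<in> space M. in_windows I \<kappa> lo hi (WW \<omega>) \<and> regular_outside ?A m0 a \<mu> d (WW \<omega>)}"
    by (auto simp: space_PiM in_windows_restrict[OF order_refl] regular_outside_restrict)
  have 2: "(\<lambda>\<omega>. restrict (\<lambda>i. W i \<omega>) ?A) -` ?S \<inter> space M = {\<omega> \<in> space M. in_windows I \<kappa> lo hi (WW \<omega>)}"
    by (auto simp: space_PiM in_windows_restrict[OF order_refl])
  have 3: "(\<lambda>\<omega>. restrict (\<lambda>i. W i \<omega>) ?B) -` ?T \<inter> space M = {\<omega> \<in> space M. regular_outside ?A m0 a \<mu> d (WW \<omega>)}"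
    by (auto simp: space_PiM regular_outside_restrict)
  have "prob {\<omega> \<in> space M. in_windows I \<kappa> lo hi (WW \<omega>)} =
      prob {\<omega> \<in> space M. \<forall>j\<in>?A. W j \<omega> \<in> {lo (the_inv_into I \<kappa> j)<..hi (the_inv_into I \<kappa> j)}}"
    using I by (intro arg_cong[where f = prob]) (auto simp: in_windows_def the_inv_into_f_f)
  also have "\<dots> = (\<Prod>j\<in>?A. prob {\<omega> \<in> space M. W 1 \<omega> \<in> {lo (the_inv_into I \<kappa> j)<..hi (the_inv_into I \<kappa> j)}})"
    using I by (intro prob_W_box) auto
  also have "\<dots> = (\<Prod>i\<in>I. prob {\<omega> \<in> space M. lo i < W 1 \<omega> \<and> W 1 \<omega> \<le> hi i})"
    using I by (subst prod.reindex) (auto simp: the_inv_into_f_f intro!: prod.cong)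
  finally show ?thesis using indep_varD[OF ind S T] unfolding 1 2 3 by simp
qed

text \<open>The positions of the large variables can be read off a configuration, so the events for
  different choices of positions are disjoint and their probabilities add up.\<close>

lemma prob_scattered_windows:
  assumes I: "finite I" and K: "\<And>i. i \<in> I \<Longrightarrow> K i \<subseteq> {1..m0}" "disjoint_family_on K I"
    and lo: "\<And>i. i \<in> I \<Longrightarrow> a \<le> lo i"
    and h: "\<And>\<kappa>. \<kappa> \<in> Pi\<^sub>E I K \<Longrightarrow> h \<le> prob {\<omega> \<in> space M. regular_outside (\<kappa> ` I) m0 a \<mu> d (WW \<omega>)}"
  shows "h * (\<Prod>i\<in>I. real (card (K i)) * prob {\<omega> \<in> space M. lo i < W 1 \<omega> \<and> W 1 \<omega> \<le> hi i}) \<le>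
    prob {\<omega> \<in> space M. \<exists>\<kappa>\<in>Pi\<^sub>E I K. in_windows I \<kappa> lo hi (WW \<omega>) \<and> regular_outside (\<kappa> ` I) m0 a \<mu> d (WW \<omega>)}"
proof -
  define E where "E = (\<lambda>\<kappa>. {\<omega> \<in> space M. in_windows I \<kappa> lo hi (WW \<omega>) \<and> regular_outside (\<kappa> ` I) m0 a \<mu> d (WW \<omega>)})"
  define P where "P = (\<Prod>i\<in>I. prob {\<omega> \<in> space M. lo i < W 1 \<omega> \<and> W 1 \<omega> \<le> hi i})"
  have P0: "P \<ge> 0" by (auto simp: P_def intro!: prod_nonneg)
  have finK: "finite (K i)" if "i \<in> I" for i using K(1)[OF that] finite_subset by blast
  have mem: "\<kappa> i \<in> K i" "\<kappa> i \<in> {1..m0}" if "\<kappa> \<in> Pi\<^sub>E I K" "i \<in> I" for \<kappa> i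
  proof -
    show "\<kappa> i \<in> K i" using that by (auto simp: PiE_iff)
    then show "\<kappa> i \<in> {1..m0}" using K(1)[OF that(2)] by blast
  qed
  have disjK: "i = j" if "i \<in> I" "j \<in> I" "k \<in> K i" "k \<in> K j" for i j k
    using K(2) that by (auto simp: disjoint_family_on_def)
  have inj: "inj_on \<kappa> I" if "\<kappa> \<in> Pi\<^sub>E I K" for \<kappa>
    using mem[OF that] disjK by (metis inj_onI)
  have E_sets: "E \<kappa> \<in> sets M" if "\<kappa> \<in> Pi\<^sub>E I K" for \<kappa>
    unfolding E_def using I mem[OF that]
    by (intro sets.sets_Collect_conj sets_in_windows sets_regular_outside) auto
  have E_prob: "h * P \<le> prob (E \<kappa>)" if \<kappa>: "\<kappa> \<in> Pi\<^sub>E I K" for \<kappa>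
  proof -
    have "prob (E \<kappa>) = P * prob {\<omega> \<in> space M. regular_outside (\<kappa> ` I) m0 a \<mu> d (WW \<omega>)}"
      unfolding E_def P_def using I inj[OF \<kappa>] mem[OF \<kappa>] by (intro prob_windows_regular) auto
    then show ?thesis using h[OF \<kappa>] P0 by (simp add: mult.commute mult_left_mono)
  qed
  have img: "\<kappa> ` I = {j \<in> {1..m0}. W j \<omega> > a}" if \<kappa>: "\<kappa> \<in> Pi\<^sub>E I K" and \<omega>: "\<omega> \<in> E \<kappa>" for \<kappa> \<omega>
  proof
    show "\<kappa> ` I \<subseteq> {j \<in> {1..m0}. W j \<omega> > a}"
      using \<omega> mem[OF \<kappa>] lo by (fastforce simp: E_def in_windows_def)
    show "{j \<in> {1..m0}. W j \<omega> > a} \<subseteq> \<kappa> ` I"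
      using \<omega> by (force simp: E_def regular_outside_def)
  qed
  have disj: "disjoint_family_on E (Pi\<^sub>E I K)"
    unfolding disjoint_family_on_def
  proof (intro ballI impI)
    fix \<kappa> \<kappa>' assume k: "\<kappa> \<in> Pi\<^sub>E I K" "\<kappa>' \<in> Pi\<^sub>E I K" "\<kappa> \<noteq> \<kappa>'"
    show "E \<kappa> \<inter> E \<kappa>' = {}"
    proof (rule ccontr)
      assume "\<not> ?thesis"
      then obtain \<omega> where \<omega>: "\<omega> \<in> E \<kappa>" "\<omega> \<in> E \<kappa>'" by blast
      \<comment> \<open>Both images consist of the positions where the threshold \<open>a\<close> is
        exceeded. Since the sets \<open>K i\<close> are disjoint, each contains exactly one of these
        positions, and the image determines \<open>\<kappa>\<close>.\<close>
      have eq: "\<kappa> ` I = \<kappa>' ` I" unfolding img[OF k(1) \<omega>(1)] img[OF k(2) \<omega>(2)] ..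
      have "\<kappa> i = \<kappa>' i" if i: "i \<in> I" for i
      proof -
        obtain j where j: "j \<in> I" "\<kappa> i = \<kappa>' j" using eq i by blast
        then have "i = j" using mem(1)[OF k(1) i] mem(1)[OF k(2) j(1)] i by (intro disjK) auto
        then show ?thesis using j by simp
      qed
      then have "\<kappa> = \<kappa>'" using k by (intro PiE_ext) auto
      then show False using k by simp
    qed
  qed
  have fin: "finite (Pi\<^sub>E I K)" using I finK by (intro finite_PiE) auto
  have "h * (\<Prod>i\<in>I. real (card (K i)) * prob {\<omega> \<in> space M. lo i < W 1 \<omega> \<and> W 1 \<omega> \<le> hi i}) =
      real (card (Pi\<^sub>E I K)) * (h * P)"
    using I by (simp add: P_def prod.distrib card_PiE)
  also have "\<dots> = (\<Sum>\<kappa>\<in>Pi\<^sub>E I K. h * P)" by simp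
  also have "\<dots> \<le> (\<Sum>\<kappa>\<in>Pi\<^sub>E I K. prob (E \<kappa>))" by (intro sum_mono E_prob)
  also have "\<dots> = prob (\<Union>\<kappa>\<in>Pi\<^sub>E I K. E \<kappa>)"
    using fin E_sets disj by (intro finite_measure_finite_Union[symmetric]) auto
  also have "(\<Union>\<kappa>\<in>Pi\<^sub>E I K. E \<kappa>) = {\<omega> \<in> space M. \<exists>\<kappa>\<in>Pi\<^sub>E I K.
      in_windows I \<kappa> lo hi (WW \<omega>) \<and> regular_outside (\<kappa> ` I) m0 a \<mu> d (WW \<omega>)}"
    by (auto simp: E_def)
  finally show ?thesis .
qed

text \<open>If no variable up to \<open>m0\<close> exceeds \<open>a\<close>, truncated and full sums
  agree, and omitting at most \<open>l\<close> terms from \<open>[0, a]\<close> changes a sum by at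
  most \<open>l * a\<close>. Asking smallness also at \<open>R\<close> merely strengthens the
  sufficient event, whose complement is bounded by the two subtracted terms.\<close>

lemma prob_regular_outside:
  assumes R: "finite R" "card R \<le> l" "R \<subseteq> {1..}" and a: "a > 0" and d: "d' + real l * a \<le> d"
  shows "1 - (real m0 * tail_prob a + prob {\<omega> \<in> space M. \<exists>m. m \<le> m0 \<and> \<bar>trunc_sum a m \<omega> - m * mean\<bar> > d'}) \<le>
    prob {\<omega> \<in> space M. regular_outside R m0 a mean d (WW \<omega>)}"
proof -
  let ?G = "{\<omega> \<in> space M. regular_outside R m0 a mean d (WW \<omega>)}"
  let ?X = "{\<omega> \<in> space M. 1 \<le> card {k \<in> {1..m0}. a < W k \<omega>}}"
  let ?Y = "{\<omega> \<in> space M. \<exists>m. m \<le> m0 \<and> \<bar>trunc_sum a m \<omega> - m * mean\<bar> > d'}"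
  have X: "?X \<in> sets M" by (rule many_exceed_sets)
  have Y: "?Y \<in> sets M" by measurable
  have G: "?G \<in> sets M" using R by (intro sets_regular_outside) auto
  have "1 - prob ?G = prob (space M - ?G)" using G by (simp add: prob_compl)
  also have "\<dots> \<le> prob (?X \<union> ?Y)"
  proof (rule finite_measure_mono_AE)
    show "AE \<omega> in M. \<omega> \<in> space M - ?G \<longrightarrow> \<omega> \<in> ?X \<union> ?Y"
      using W_pos_all
    proof eventually_elim
      case (elim \<omega>)
      show ?case
      proof (rule impI, rule ccontr)
        assume \<omega>: "\<omega> \<in> space M - ?G" and no: "\<omega> \<notin> ?X \<union> ?Y"
        have "card {k \<in> {1..m0}. a < W k \<omega>} = 0"
        proof (rule ccontr)
          assume "\<not> ?thesis"
          then have "1 \<le> card {k \<in> {1..m0}. a < W k \<omega>}" by linarith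
          then show False using no \<omega> by blast
        qed
        then have "{k \<in> {1..m0}. a < W k \<omega>} = {}" by simp
        then have le: "W j \<omega> \<le> a" if "j \<in> {1..m0}" for j using that by force
        have "\<bar>(\<Sum>j\<in>{1..m} - R. W j \<omega>) - real m * mean\<bar> \<le> d" if m: "m \<le> m0" for m
        proof -
          have tr: "\<bar>trunc_sum a m \<omega> - m * mean\<bar> \<le> d'" using no \<omega> m by force
          have tW: "truncate a (W j \<omega>) = W j \<omega>" if "j \<in> {1..m}" for j
            using le[of j] that m by (simp add: truncate_def)
          have "trunc_sum a m \<omega> = (\<Sum>j\<in>{1..m}. W j \<omega>)" unfolding trunc_sum_def using tW by (intro sum.cong) auto
          also have "\<dots> = (\<Sum>j\<in>{1..m} \<inter> R. W j \<omega>) + (\<Sum>j\<in>{1..m} - R. W j \<omega>)"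
            by (rule sum.Int_Diff) simp
          finally have eq: "(\<Sum>j\<in>{1..m} - R. W j \<omega>) = trunc_sum a m \<omega> - (\<Sum>j\<in>{1..m} \<inter> R. W j \<omega>)" by simp
          have lo: "0 \<le> (\<Sum>j\<in>{1..m} \<inter> R. W j \<omega>)" using elim by (intro sum_nonneg) (auto intro: less_imp_le)
          have "(\<Sum>j\<in>{1..m} \<inter> R. W j \<omega>) \<le> (\<Sum>j\<in>{1..m} \<inter> R. a)" using le m by (intro sum_mono) auto
          also have "\<dots> = real (card ({1..m} \<inter> R)) * a" by simp
          also have "card ({1..m} \<inter> R) \<le> l" using R(1,2) card_mono[of R "{1..m} \<inter> R"] by simp
          then have "real (card ({1..m} \<inter> R)) * a \<le> real l * a" using a by (intro mult_right_mono) auto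
          finally have up: "(\<Sum>j\<in>{1..m} \<inter> R. W j \<omega>) \<le> real l * a" .
          show ?thesis using tr lo up d unfolding eq by (simp add: abs_le_iff) 
        qed
        then show False using \<omega> le by (auto simp: regular_outside_def)
      qed
    qed
  qed (use X Y in auto)
  also have "\<dots> \<le> prob ?X + prob ?Y" using X Y by (intro measure_Un_le) auto
  also have "prob ?X \<le> (real m0 * tail_prob a) ^ 1" by (rule prob_many_exceed)
  finally show ?thesis by simp
qed

end

lemma card_nat_between:
  fixes a b :: real
  assumes "0 \<le> a" "a < b"
  shows "b - a - 1 \<le> real (card {k::nat. a < real k \<and> real k < b})"
proof -
  have "{nat \<lfloor>a\<rfloor> + 1..<nat \<lceil>b\<rceil>} \<subseteq> {k::nat. a < real k \<and> real k < b}"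
  proof
    fix k assume "k \<in> {nat \<lfloor>a\<rfloor> + 1..<nat \<lceil>b\<rceil>}"
    then have "\<lfloor>a\<rfloor> < int k" "int k < \<lceil>b\<rceil>" using assms by auto
    then show "k \<in> {k::nat. a < real k \<and> real k < b}" by (auto simp: floor_less_iff less_ceiling_iff)
  qed
  moreover have "finite {k::nat. a < real k \<and> real k < b}"
  proof (rule finite_subset)
    show "{k::nat. a < real k \<and> real k < b} \<subseteq> {..nat \<lceil>b\<rceil>}" by (auto, linarith)
  qed simp
  ultimately have "card {nat \<lfloor>a\<rfloor> + 1..<nat \<lceil>b\<rceil>} \<le> card {k::nat. a < real k \<and> real k < b}" by (rule card_mono[rotated])
  moreover have "b - a - 1 \<le> real (nat \<lceil>b\<rceil> - (nat \<lfloor>a\<rfloor> + 1))" using assms by linarith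
  ultimately show ?thesis by simp
qed

section \<open>Assembling the lower bound\<close>

context heavy_tailed_compound_poisson
begin

lemma n_f_tendsto_0: "(\<lambda>n. real n * f (real n)) \<longlonglongrightarrow> 0"
proof -
  define s where "s = (1 + \<beta>) / 2"
  have s: "1 < s" "s < \<beta>" using \<beta>_gt_1 by (auto simp: s_def)
  obtain x0 C where C: "x0 > 0" "\<And>x. x0 \<le> x \<Longrightarrow> f x \<le> C * x powr (- s)"
    using upper_powr_bound[of s] s by auto
  have "(\<lambda>n. real n * (C * real n powr (- s))) \<longlonglongrightarrow> 0" using s by real_asymp
  moreover have "\<forall>\<^sub>F n in sequentially. x0 \<le> real n"
    using filterlim_real_sequentially by (auto simp: filterlim_at_top)
  then have "\<forall>\<^sub>F n in sequentially. norm (real n * f (real n)) \<le> real n * (C * real n powr (- s))"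
  proof eventually_elim
    case (elim n)
    have "norm (real n * f (real n)) = real n * f (real n)" using f_pos[of "real n"] by (simp add: abs_mult)
    also have "\<dots> \<le> real n * (C * real n powr (- s))" using C(2)[OF elim] by (intro mult_left_mono) auto
    finally show ?case .
  qed
  ultimately show ?thesis by (rule Lim_null_comparison[rotated])
qed

lemma prob_near_step_sum:
  fixes y u :: "nat \<Rightarrow> real"
  assumes \<eta>0: "\<eta>0 > 0" and inj: "inj_on u {1..l}" and u: "\<And>i. i \<in> {1..l} \<Longrightarrow> u i \<in> {0<..<1}"
    and y: "\<And>i. i \<in> {1..l} \<Longrightarrow> 0 < y i"
  obtains c where "c > 0" "\<forall>\<^sub>F n in sequentially.
    c * (real n * f (real n)) ^ l \<le> prob {\<omega> \<in> space M. dist (X n \<omega>) (step_sum l y u) < \<eta>0}"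
proof -
  let ?I = "{1..l}"
  define \<eta> where "\<eta> = \<eta>0 / 2"
  have \<eta>: "\<eta> > 0" "\<eta> < \<eta>0" using \<eta>0 by (auto simp: \<eta>_def)
  obtain \<rho> where \<rho>: "\<rho> > 0" "\<And>s t. s \<in> u ` ?I \<Longrightarrow> t \<in> u ` ?I \<Longrightarrow> s \<noteq> t \<Longrightarrow> \<rho> \<le> \<bar>s - t\<bar>"
    "\<And>s. s \<in> u ` ?I \<Longrightarrow> \<rho> \<le> s \<and> s \<le> 1 - \<rho>"
    by (rule finite_separation[of "u ` ?I"]) (use u in auto)
  \<comment> \<open>The time tolerance: \<open>l\<close> times it fits both the separation and the
    distance. The summand 2 makes \<open>e < \<rho>\<close> strict even for
    \<open>l = 0\<close>.\<close>
  define e where "e = min \<rho> \<eta> / (real l + 2)"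
  have e: "e > 0" "real l * e < \<rho>" "real l * e \<le> \<eta>" "e < \<rho>"
  proof -
    have m: "min \<rho> \<eta> > 0" using \<rho> \<eta> by simp
    then show "e > 0" unfolding e_def by (intro divide_pos_pos) auto
    have eq: "(real l + 2) * e = min \<rho> \<eta>" by (simp add: e_def)
    have "real l * e < (real l + 2) * e" "e < (real l + 2) * e"
      using \<open>e > 0\<close> by (auto simp: distrib_right add_pos_nonneg)
    then show "real l * e < \<rho>" "real l * e \<le> \<eta>" "e < \<rho>" unfolding eq by auto
  qed
  \<comment> \<open>Index windows use half of the time tolerance; the other half absorbs the
    fluctuation of the arrival count.\<close>
  define \<epsilon> where "\<epsilon> = e / 2"
  have \<epsilon>: "\<epsilon> > 0" "\<epsilon> < \<rho>" "2 * \<epsilon> < \<rho>" using e by (auto simp: \<epsilon>_def)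
  define ymin where "ymin = Min (insert 1 (y ` ?I))"
  have ymin: "ymin > 0" "\<And>i. i \<in> ?I \<Longrightarrow> ymin \<le> y i"
  proof -
    show "ymin > 0" unfolding ymin_def using y by (subst Min_gr_iff) auto
    show "\<And>i. i \<in> ?I \<Longrightarrow> ymin \<le> y i" unfolding ymin_def by (intro Min_le) auto
  qed
  \<comment> \<open>The size tolerance: the \<open>l\<close> errors sum to at most
    \<open>\<eta> / 2\<close>, and \<open>ymin / 4\<close> keeps the size windows above the
    threshold \<open>\<gamma> \<le> ymin / 2\<close>.\<close>
  define e' where "e' = min (\<eta> / (2 * (real l + 1))) (ymin / 4)"
  have e': "e' > 0" "real l * e' \<le> \<eta> / 2" "e' \<le> ymin / 4"
  proof -
    show "e' > 0" using \<eta> ymin by (auto simp: e'_def add_nonneg_pos)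
    show "e' \<le> ymin / 4" unfolding e'_def by (rule min.cobounded2)
    have "(real l + 1) * e' \<le> (real l + 1) * (\<eta> / (2 * (real l + 1)))"
      by (intro mult_left_mono) (auto simp: e'_def)
    also have "\<dots> = \<eta> / 2" by (simp add: field_simps)
    finally show "real l * e' \<le> \<eta> / 2" using \<open>e' > 0\<close> by (simp add: distrib_right)
  qed
  define \<delta>2 where "\<delta>2 = \<eta> / 4"
  \<comment> \<open>The first bound keeps arrival times within the tolerance \<open>e\<close>; the
    second keeps the error in the drift within \<open>\<eta> / 4\<close>.\<close>
  define \<delta>1 where "\<delta>1 = min (r * e / 8) (\<eta> / (8 * (mean + 1)))"
  have \<delta>2: "\<delta>2 > 0" using \<eta> by (simp add: \<delta>2_def)
  have \<delta>1: "\<delta>1 > 0" "2 * \<delta>1 \<le> r * \<epsilon> / 2" "2 * \<delta>1 * mean \<le> \<eta> / 4"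
  proof -
    show "\<delta>1 > 0" using r_pos e \<eta> mean_nonneg by (auto simp: \<delta>1_def intro!: divide_pos_pos)
    show "2 * \<delta>1 \<le> r * \<epsilon> / 2" unfolding \<delta>1_def \<epsilon>_def by simp
    have "\<delta>1 * (mean + 1) \<le> (\<eta> / (8 * (mean + 1))) * (mean + 1)"
      using mean_nonneg by (intro mult_right_mono) (auto simp: \<delta>1_def)
    also have "\<dots> = \<eta> / 8" using mean_nonneg by (simp add: field_simps)
    finally show "2 * \<delta>1 * mean \<le> \<eta> / 4" using \<open>\<delta>1 > 0\<close> by (simp add: distrib_left)
  qed
  define C where "C = r + 2 * \<delta>1"
  have C: "C > 0" using r_pos \<delta>1 by (simp add: C_def)
  have \<delta>22: "\<delta>2 / 2 > 0" and one: "(1::real) > 0" using \<delta>2 by auto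
  obtain \<gamma>0 where \<gamma>0: "\<gamma>0 > 0" "\<And>\<gamma>. 0 < \<gamma> \<Longrightarrow> \<gamma> \<le> \<gamma>0 \<Longrightarrow> \<forall>\<^sub>F n in sequentially.
      prob {\<omega> \<in> space M. \<exists>m. real m \<le> C * real n \<and> \<bar>trunc_sum (real n * \<gamma>) m \<omega> - m * mean\<bar> > \<delta>2 / 2 * n}
        \<le> real n powr (- 1)"
    using concentration[OF \<delta>22 C one] by blast
  \<comment> \<open>The threshold separating selected from ordinary jumps: small enough for
    concentration, below all size windows, and with \<open>l * \<gamma>\<close> covering the terms
    omitted in \<open>regular_outside\<close>.\<close>
  define \<gamma> where "\<gamma> = min \<gamma>0 (min (ymin / 2) (\<delta>2 / (2 * (real l + 1))))"
  have \<gamma>: "\<gamma> > 0" "\<gamma> \<le> \<gamma>0" "\<gamma> \<le> ymin / 2" "real l * \<gamma> \<le> \<delta>2 / 2"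
  proof -
    show "\<gamma> > 0" "\<gamma> \<le> \<gamma>0"
      using \<gamma>0(1) ymin(1) \<delta>2 by (auto simp: \<gamma>_def add_nonneg_pos)
    show "\<gamma> \<le> ymin / 2" unfolding \<gamma>_def by (rule min.coboundedI2[OF min.cobounded1])
    have "(real l + 1) * \<gamma> \<le> (real l + 1) * (\<delta>2 / (2 * (real l + 1)))"
      by (intro mult_left_mono) (auto simp: \<gamma>_def)
    also have "\<dots> = \<delta>2 / 2" by (simp add: field_simps)
    finally show "real l * \<gamma> \<le> \<delta>2 / 2" using \<open>\<gamma> > 0\<close> by (simp add: distrib_right)
  qed
  have "\<exists>c. \<forall>i\<in>?I. c i > 0 \<and> (\<forall>\<^sub>F n in sequentially. c i * f (real n) \<le>
      prob {\<omega> \<in> space M. (y i - e') * n < W 1 \<omega> \<and> W 1 \<omega> \<le> (y i + e') * n})"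
  proof (rule bchoice, rule ballI)
    fix i assume "i \<in> ?I"
    then have "0 < y i - e'" "y i - e' < y i + e'" using ymin(2)[of i] ymin(1) e' by auto
    then show "\<exists>c. c > 0 \<and> (\<forall>\<^sub>F n in sequentially. c * f (real n) \<le>
      prob {\<omega> \<in> space M. (y i - e') * n < W 1 \<omega> \<and> W 1 \<omega> \<le> (y i + e') * n})"
      by (rule window_probability) blast
  qed
  then obtain cw where cw: "\<And>i. i \<in> ?I \<Longrightarrow> cw i > 0"
    "\<And>i. i \<in> ?I \<Longrightarrow> \<forall>\<^sub>F n in sequentially. cw i * f (real n) \<le>
      prob {\<omega> \<in> space M. (y i - e') * n < W 1 \<omega> \<and> W 1 \<omega> \<le> (y i + e') * n}" by blast
  have F1: "\<forall>\<^sub>F n in sequentially. \<forall>i\<in>?I. cw i * f (real n) \<le>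
      prob {\<omega> \<in> space M. (y i - e') * n < W 1 \<omega> \<and> W 1 \<omega> \<le> (y i + e') * n}"
    using cw(2) by (intro eventually_ball_finite) auto
  obtain Ct where Ct: "Ct > 0" "\<forall>\<^sub>F n in sequentially. tail_prob (\<gamma> * real n) \<le> Ct * f (real n)"
    using tail_prob_scaled_bound[OF \<gamma>(1)] by blast
  have "(\<lambda>n. C * Ct * (real n * f (real n))) \<longlonglongrightarrow> C * Ct * 0" by (intro tendsto_mult tendsto_const n_f_tendsto_0)
  then have F2: "\<forall>\<^sub>F n in sequentially. C * Ct * (real n * f (real n)) < 1 / 4" by (intro order_tendstoD) auto
  \<comment> \<open>From 4 on, \<open>n powr (- 1)\<close> is at most one quarter; the second bound
    lets the rounding loss 1 in the count of an index window be absorbed by half of its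
    size.\<close>
  have F3: "\<forall>\<^sub>F n in sequentially. 4 \<le> real n \<and> 2 / (r * \<epsilon>) \<le> real n"
    using filterlim_real_sequentially by (auto simp: filterlim_at_top eventually_conj_iff)
  \<comment> \<open>One half comes from the good arrival count and one half from the regularity of
    the other jumps; each factor combines about \<open>r * \<epsilon> * n\<close> positions with the
    window constant \<open>cw i\<close>.\<close>
  define c where "c = 1 / 4 * (\<Prod>i\<in>?I. r * \<epsilon> * cw i)"
  have c: "c > 0" unfolding c_def using cw(1) r_pos \<epsilon>(1) by (auto intro!: prod_pos)
  have "\<forall>\<^sub>F n in sequentially.
    c * (real n * f (real n)) ^ l \<le> prob {\<omega> \<in> space M. dist (X n \<omega>) (step_sum l y u) < \<eta>0}"
    using F1 F2 F3 Ct(2) \<gamma>0(2)[OF \<gamma>(1,2)] prob_not_N_good[OF \<delta>1(1) one] N_good_linear[OF \<delta>1(1)]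
  proof eventually_elim
    case (elim n)
    have n: "real n \<ge> 4" "real n > 0" "n > 0" "real n * (r * \<epsilon>) \<ge> 2"
      using elim(3) r_pos \<epsilon>(1) by (auto simp: pos_divide_le_eq)
    define a where "a = real n * \<gamma>"
    define m0 where "m0 = nat \<lfloor>C * real n\<rfloor>"
    have m0_iff: "m \<le> m0 \<longleftrightarrow> real m \<le> C * n" for m
      unfolding m0_def using C n by (simp add: le_nat_iff le_floor_iff)
    \<comment> \<open>Indices of jumps expected near scaled time \<open>u i\<close>, as arrivals
      grow like \<open>r\<close> times time. The windows are disjoint because
      \<open>2 * \<epsilon> < \<rho>\<close>.\<close>
    define K where "K = (\<lambda>i. {k::nat. r * (u i - \<epsilon>) * n < real k \<and> real k < r * (u i + \<epsilon>) * n})"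
    define lo hi where "lo = (\<lambda>i. (y i - e') * n)" and "hi = (\<lambda>i. (y i + e') * n)"
    have uI: "\<rho> \<le> u i" "u i \<le> 1 - \<rho>" if "i \<in> ?I" for i using \<rho>(3)[of "u i"] that by auto
    have KD: "r * (u i - \<epsilon>) * n < real k" "real k < r * (u i + \<epsilon>) * n" if "k \<in> K i" for i k
      using that by (auto simp: K_def)
    have pos_lo: "0 \<le> r * (u i - \<epsilon>) * n" if "i \<in> ?I" for i
      using uI[OF that] \<epsilon> r_pos by simp
    have K_sub: "K i \<subseteq> {1..m0}" if i: "i \<in> ?I" for i
    proof
      fix k assume k: "k \<in> K i"
      have "0 < real k" using KD(1)[OF k] pos_lo[OF i] by linarith
      moreover have "r * (u i + \<epsilon>) * n \<le> C * n"
      proof (intro mult_right_mono)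
        have "r * (u i + \<epsilon>) \<le> r * 1" using uI[OF i] \<epsilon> r_pos by (intro mult_left_mono) auto
        then show "r * (u i + \<epsilon>) \<le> C" using \<delta>1 by (simp add: C_def)
      qed simp
      then have "k \<le> m0" unfolding m0_iff using KD(2)[OF k] by linarith
      ultimately show "k \<in> {1..m0}" by auto
    qed
    have K_disj: "i = j" if ij: "i \<in> ?I" "j \<in> ?I" and k: "k \<in> K i" "k \<in> K j" for i j k
    proof (rule ccontr)
      assume "i \<noteq> j"
      then have "u i \<noteq> u j" using inj ij by (auto dest: inj_onD)
      then have sep: "\<rho> \<le> \<bar>u i - u j\<bar>" using ij by (intro \<rho>(2)) auto
      have "r * n * (u i - \<epsilon>) < r * n * (u j + \<epsilon>)" "r * n * (u j - \<epsilon>) < r * n * (u i + \<epsilon>)"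
        using KD[OF k(1)] KD[OF k(2)] by (simp_all add: mult_ac)
      then have "u i - \<epsilon> < u j + \<epsilon>" "u j - \<epsilon> < u i + \<epsilon>"
        using r_pos n by (simp_all add: mult_less_cancel_left_pos)
      then show False using sep \<epsilon> by linarith
    qed
    have K_card: "r * \<epsilon> * n \<le> real (card (K i))" if i: "i \<in> ?I" for i
    proof -
      have eq: "r * (u i + \<epsilon>) * n - r * (u i - \<epsilon>) * n = 2 * (r * \<epsilon> * n)" by (simp add: algebra_simps)
      have "r * (u i - \<epsilon>) * n < r * (u i + \<epsilon>) * n"
        using r_pos n \<epsilon> by (intro mult_strict_right_mono mult_strict_left_mono) auto
      then have "r * (u i + \<epsilon>) * n - r * (u i - \<epsilon>) * n - 1 \<le> real (card (K i))"
        unfolding K_def by (rule card_nat_between[OF pos_lo[OF i]])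
      then have "2 * (r * \<epsilon> * n) - 1 \<le> real (card (K i))" unfolding eq .
      moreover have "2 \<le> r * \<epsilon> * n" using n(4) by (simp add: mult.commute)
      ultimately show ?thesis by linarith
    qed
    have lo_a: "a \<le> lo i" if "i \<in> ?I" for i
      unfolding a_def lo_def using ymin(2)[OF that] e' \<gamma>(3) ymin(1) n by (simp add: mult.commute)
    have bad: "real m0 * tail_prob a + prob {\<omega> \<in> space M. \<exists>m. m \<le> m0 \<and>
        \<bar>trunc_sum a m \<omega> - m * mean\<bar> > \<delta>2 / 2 * n} \<le> 1 / 2"
    proof -
      have "real m0 \<le> C * n" using m0_iff by blast
      then have "real m0 * tail_prob a \<le> (C * n) * (Ct * f n)"
        using elim(4) tail_prob_nonneg by (intro mult_mono) (auto simp: a_def mult.commute)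
      also have "\<dots> \<le> 1 / 4" using elim(2) by (simp add: mult_ac)
      finally have 1: "real m0 * tail_prob a \<le> 1 / 4" .
      have "real n powr (- 1) \<le> 1 / 4" using n by (simp add: powr_minus divide_simps)
      then show ?thesis using 1 elim(5) unfolding a_def m0_iff by linarith
    qed
    have half: "1 / 2 \<le> prob {\<omega> \<in> space M. regular_outside (\<kappa> ` ?I) m0 a mean (\<delta>2 * n) (WW \<omega>)}"
      if \<kappa>: "\<kappa> \<in> Pi\<^sub>E ?I K" for \<kappa>
    proof -
      have "\<kappa> ` ?I \<subseteq> {1..}" using \<kappa> K_sub by (fastforce simp: PiE_iff)
      moreover have "card (\<kappa> ` ?I) \<le> l" using card_image_le[of ?I \<kappa>] by simp
      moreover have "\<delta>2 / 2 * n + real l * a \<le> \<delta>2 * n"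
      proof -
        have "real l * a = (real l * \<gamma>) * n" by (simp add: a_def)
        also have "\<dots> \<le> \<delta>2 / 2 * n" using \<gamma>(4) by (intro mult_right_mono) auto
        finally show ?thesis by simp
      qed
      moreover have "a > 0" using n \<gamma> by (simp add: a_def)
      ultimately have "1 - (real m0 * tail_prob a + prob {\<omega> \<in> space M. \<exists>m. m \<le> m0 \<and>
          \<bar>trunc_sum a m \<omega> - m * mean\<bar> > \<delta>2 / 2 * n}) \<le>
          prob {\<omega> \<in> space M. regular_outside (\<kappa> ` ?I) m0 a mean (\<delta>2 * n) (WW \<omega>)}"
        by (intro prob_regular_outside) auto
      then show ?thesis using bad by linarith
    qed
    define E where "E = {\<omega> \<in> space M. \<exists>\<kappa>\<in>Pi\<^sub>E ?I K. in_windows ?I \<kappa> lo hi (WW \<omega>) \<and>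
        regular_outside (\<kappa> ` ?I) m0 a mean (\<delta>2 * n) (WW \<omega>)}"
    have E_sets: "E \<in> sets sigma_W"
    proof -
      have "finite (Pi\<^sub>E ?I K)" using K_sub finite_subset by (intro finite_PiE) blast+
      moreover have "{\<omega> \<in> space sigma_W. in_windows ?I \<kappa> lo hi (WW \<omega>) \<and>
          regular_outside (\<kappa> ` ?I) m0 a mean (\<delta>2 * n) (WW \<omega>)} \<in> sets sigma_W" if \<kappa>: "\<kappa> \<in> Pi\<^sub>E ?I K" for \<kappa>
      proof (intro sets.sets_Collect_conj sets_in_windows sets_regular_outside W_sigma_W)
        fix i assume i: "i \<in> ?I"
        then have "\<kappa> i \<in> K i" using \<kappa> by (auto simp: PiE_iff)
        then show "1 \<le> \<kappa> i" using K_sub[OF i] by auto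
      qed auto
      ultimately have "{\<omega> \<in> space sigma_W. \<exists>\<kappa>\<in>Pi\<^sub>E ?I K. in_windows ?I \<kappa> lo hi (WW \<omega>) \<and>
          regular_outside (\<kappa> ` ?I) m0 a mean (\<delta>2 * n) (WW \<omega>)} \<in> sets sigma_W"
        by (intro sets.sets_Collect_finite_Ex) auto
      then show ?thesis by (simp add: E_def)
    qed
    have E_prob: "1 / 2 * (\<Prod>i\<in>?I. (r * \<epsilon> * n) * (cw i * f n)) \<le> prob E"
    proof -
      have "1 / 2 * (\<Prod>i\<in>?I. (r * \<epsilon> * n) * (cw i * f n)) \<le>
          1 / 2 * (\<Prod>i\<in>?I. real (card (K i)) * prob {\<omega> \<in> space M. lo i < W 1 \<omega> \<and> W 1 \<omega> \<le> hi i})"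
      proof (intro mult_left_mono prod_mono conjI)
        fix i assume i: "i \<in> ?I"
        show "0 \<le> (r * \<epsilon> * n) * (cw i * f n)"
          using r_pos \<epsilon>(1) cw(1)[OF i] f_pos[of n] by (intro mult_nonneg_nonneg) auto
        show "(r * \<epsilon> * n) * (cw i * f n) \<le> real (card (K i)) * prob {\<omega> \<in> space M. lo i < W 1 \<omega> \<and> W 1 \<omega> \<le> hi i}"
          using K_card[OF i] elim(1) i cw(1)[OF i] f_pos[of n]
          by (intro mult_mono) (auto simp: lo_def hi_def)
      qed auto
      also have "\<dots> \<le> prob E" unfolding E_def
      proof (rule prob_scattered_windows)
        show "disjoint_family_on K ?I" unfolding disjoint_family_on_def using K_disj by blast
      qed (fact K_sub lo_a half finite_atLeastAtMost)+
      finally show ?thesis .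
    qed
    have N_prob: "1 / 2 \<le> prob (N_good \<delta>1 n)"
    proof -
      have "real n powr (- 1) \<le> 1 / 4" using n by (simp add: powr_minus divide_simps)
      moreover have "prob (space M - N_good \<delta>1 n) = 1 - prob (N_good \<delta>1 n)" by (rule prob_compl) simp
      ultimately show ?thesis using elim(6) by linarith
    qed
    have near: "dist (X n \<omega>) (step_sum l y u) \<le> \<eta>" if \<omega>N: "\<omega> \<in> N_good \<delta>1 n" and \<omega>E: "\<omega> \<in> E" for \<omega>
    proof -
      obtain \<kappa> where \<kappa>: "\<kappa> \<in> Pi\<^sub>E ?I K" "in_windows ?I \<kappa> lo hi (WW \<omega>)"
        "regular_outside (\<kappa> ` ?I) m0 a mean (\<delta>2 * n) (WW \<omega>)" and \<omega>: "\<omega> \<in> space M"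
        using \<omega>E by (auto simp: E_def)
      interpret counting_path "\<lambda>t. N t \<omega>" by (rule counting_path_N[OF \<omega>])
      have N_lin: "\<bar>real (N s \<omega>) - r * s\<bar> \<le> 2 * \<delta>1 * n" if "0 \<le> s" "s \<le> real n" for s
        using elim(7) \<omega>N that by auto
      have \<kappa>K: "\<kappa> i \<in> K i" if "i \<in> ?I" for i using \<kappa>(1) that by (auto simp: PiE_iff)
      have \<kappa>1: "1 \<le> \<kappa> i" if "i \<in> ?I" for i using \<kappa>K[OF that] K_sub[OF that] by auto
      have small: "2 * \<delta>1 * n \<le> r * \<epsilon> * n / 2" using \<delta>1(2) mult_right_mono[OF \<delta>1(2), of "real n"] by simp
      \<comment> \<open>An index in \<open>K i\<close> is below the count at time
        \<open>n * (u i + e)\<close> and above that at \<open>n * (u i - e)\<close>: the margin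
        \<open>r * \<epsilon> * n\<close> exceeds the fluctuation
        \<open>2 * \<delta>1 * n\<close>.\<close>
      have arr: "\<kappa> i \<le> N (n * (u i + e)) \<omega>" "\<not> \<kappa> i \<le> N (n * (u i - e)) \<omega>"
        "0 \<le> n * (u i - e)" "n * (u i + e) \<le> real n" if i: "i \<in> ?I" for i
      proof -
        have b: "0 \<le> u i - e" "u i + e \<le> 1" using uI[OF i] e by auto
        then show r1: "0 \<le> n * (u i - e)" and r2: "n * (u i + e) \<le> real n"
          using n by (auto simp: mult_left_le)
        have r1': "n * (u i - e) \<le> real n" "0 \<le> n * (u i + e)"
          using b e n by (auto simp: mult_left_le)
        have ex: "r * (n * (u i + e)) = r * (u i + \<epsilon>) * n + r * \<epsilon> * n"
          "r * (n * (u i - e)) = r * (u i - \<epsilon>) * n - r * \<epsilon> * n"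
          by (simp_all add: \<epsilon>_def algebra_simps)
        have sm: "0 < r * \<epsilon> * n" using r_pos \<epsilon>(1) n by simp
        have "real (\<kappa> i) < real (N (n * (u i + e)) \<omega>)"
          using N_lin[OF r1'(2) r2] KD(2)[OF \<kappa>K[OF i]] small sm unfolding ex abs_le_iff by linarith
        then show "\<kappa> i \<le> N (n * (u i + e)) \<omega>" by simp
        have "real (N (n * (u i - e)) \<omega>) < real (\<kappa> i)"
          using N_lin[OF r1 r1'(1)] KD(1)[OF \<kappa>K[OF i]] small sm unfolding ex abs_le_iff by linarith
        then show "\<not> \<kappa> i \<le> N (n * (u i - e)) \<omega>" by simp
      qed
      have \<kappa>N: "\<kappa> i \<le> N (real n) \<omega>" if i: "i \<in> ?I" for i
      proof -
        have "0 \<le> n * (u i + e)" using uI[OF i] \<rho>(1) e(1) by simp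
        then have "N (n * (u i + e)) \<omega> \<le> N (real n) \<omega>" using arr(4)[OF i] by (intro g_mono)
        then show ?thesis using arr(1)[OF i] by simp
      qed
      have near_t: "\<bar>arrival (\<lambda>t. N t \<omega>) (\<kappa> i) / n - u i\<bar> \<le> e" if i: "i \<in> ?I" for i
      proof -
        let ?T = "arrival (\<lambda>t. N t \<omega>) (\<kappa> i)"
        have iff: "\<kappa> i \<le> N t \<omega> \<longleftrightarrow> ?T \<le> t" if "0 \<le> t" for t
          using arrival_le_iff[OF \<kappa>1[OF i] \<kappa>N[OF i] _ that] by simp
        have "0 \<le> n * (u i + e)" using uI[OF i] \<rho>(1) e(1) by simp
        then have "?T \<le> n * (u i + e)" "n * (u i - e) \<le> ?T"
          using arr[OF i] iff by (auto simp: not_le less_imp_le)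
        then have "?T / n \<le> u i + e" "u i - e \<le> ?T / n"
          using n by (simp_all add: pos_divide_le_eq pos_le_divide_eq mult.commute)
        then show ?thesis by linarith
      qed
      have near_y: "\<bar>W (\<kappa> i) \<omega> / n - y i\<bar> \<le> e'" if i: "i \<in> ?I" for i
      proof -
        have "(y i - e') * n < W (\<kappa> i) \<omega>" "W (\<kappa> i) \<omega> \<le> (y i + e') * n"
          using \<kappa>(2) i by (auto simp: in_windows_def lo_def hi_def)
        then have "y i - e' \<le> W (\<kappa> i) \<omega> / n" "W (\<kappa> i) \<omega> / n \<le> y i + e'"
          using n by (simp_all add: pos_divide_le_eq pos_le_divide_eq)
        then show ?thesis by linarith
      qed
      have rest: "\<bar>(\<Sum>k\<in>{1..N (real n * t) \<omega>} - \<kappa> ` ?I. W k \<omega>) - n * (r * mean) * t\<bar> \<le> n * (\<eta> / 2)"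
        if t: "t \<in> {0..1}" for t :: real
      proof -
        define m where "m = N (real n * t) \<omega>"
        have nt: "0 \<le> real n * t" "real n * t \<le> real n" using t by (auto simp: mult_left_le)
        have Nm: "\<bar>real m - r * (n * t)\<bar> \<le> 2 * \<delta>1 * n" unfolding m_def by (rule N_lin[OF nt])
        have "r * (n * t) \<le> r * n" using nt r_pos by (intro mult_left_mono) auto
        with Nm have "m \<le> m0" unfolding m0_iff by (simp add: C_def algebra_simps abs_le_iff)
        then have 1: "\<bar>(\<Sum>k\<in>{1..m} - \<kappa> ` ?I. W k \<omega>) - real m * mean\<bar> \<le> \<delta>2 * n"
          using \<kappa>(3) by (auto simp: regular_outside_def)
        have "m * mean - n * (r * mean) * t = (real m - r * (n * t)) * mean" by (simp add: algebra_simps)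
        then have "\<bar>m * mean - n * (r * mean) * t\<bar> = \<bar>real m - r * (n * t)\<bar> * mean"
          using mean_nonneg by (simp add: abs_mult)
        also have "\<dots> \<le> (2 * \<delta>1 * n) * mean" using Nm mean_nonneg by (intro mult_right_mono)
        also have "\<dots> = (2 * \<delta>1 * mean) * n" by simp
        also have "\<dots> \<le> \<eta> / 4 * n" using \<delta>1 by (intro mult_right_mono) auto
        finally have 2: "\<bar>m * mean - n * (r * mean) * t\<bar> \<le> \<delta>2 * n" by (simp add: \<delta>2_def)
        have tri: "\<bar>x - y\<bar> \<le> d \<Longrightarrow> \<bar>y - z\<bar> \<le> d \<Longrightarrow> \<bar>x - z\<bar> \<le> 2 * d" for x y z d :: real
          by linarith
        from tri[OF 1 2] show ?thesis by (simp add: m_def \<delta>2_def mult.commute)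
      qed
      have inj_\<kappa>: "inj_on \<kappa> ?I"
      proof (rule inj_onI)
        fix i j assume ij: "i \<in> ?I" "j \<in> ?I" "\<kappa> i = \<kappa> j"
        then show "i = j" using K_disj[OF ij(1,2) \<kappa>K[OF ij(1)]] \<kappa>K[OF ij(2)] by simp
      qed
      show ?thesis
        by (rule driven_path_near_step_sum[OF driven_path_X[OF \<omega> n(3)] inj u \<rho> e(2,3) inj_\<kappa> _ near_t near_y e'(2) rest])
          (use \<kappa>1 \<kappa>N in auto)
    qed
    have "c * (real n * f (real n)) ^ l = 1 / 2 * (1 / 2 * (\<Prod>i\<in>?I. (r * \<epsilon> * n) * (cw i * f n)))"
      by (simp add: c_def prod.distrib power_mult_distrib)
    also have "\<dots> \<le> prob (N_good \<delta>1 n) * prob E"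
    proof (rule mult_mono[OF N_prob E_prob])
      show "0 \<le> 1 / 2 * (\<Prod>i\<in>?I. (r * \<epsilon> * n) * (cw i * f n))"
        using r_pos \<epsilon>(1) cw(1) f_pos[of n]
        by (intro mult_nonneg_nonneg prod_nonneg) (auto simp: less_imp_le)
    qed auto
    also have "\<dots> = prob (N_good \<delta>1 n \<inter> E)" using E_sets by (simp add: prob_N_W)
    also have "\<dots> \<le> prob {\<omega> \<in> space M. dist (X n \<omega>) (step_sum l y u) < \<eta>0}"
    proof (rule finite_measure_mono)
      show "N_good \<delta>1 n \<inter> E \<subseteq> {\<omega> \<in> space M. dist (X n \<omega>) (step_sum l y u) < \<eta>0}"
        using near \<eta>(2) by (auto simp: E_def intro: le_less_trans)
      have "{x. dist x (step_sum l y u) < \<eta>0} = ball (step_sum l y u) \<eta>0" by (auto simp: dist_commute)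
      then have "{x. dist x (step_sum l y u) < \<eta>0} \<in> sets borel" by simp
      from X_sets[OF n(3) this] show "{\<omega> \<in> space M. dist (X n \<omega>) (step_sum l y u) < \<eta>0} \<in> sets M" by simp
    qed
    finally show ?case .
  qed
  with c that show thesis by blast
qed

end

section \<open>Strong efficiency\<close>

lemma sets_mixture [simp, measurable_cong]: "sets (mixture w P Q) = sets P"
  by (simp add: mixture_def)

lemma space_mixture [simp]: "space (mixture w P Q) = space P"
  by (simp add: mixture_def space_measure_of_conv)

text \<open>On \<open>A - B\<close> the estimator is \<open>1 / w\<close> and the mixture has mass
  \<open>w\<close> times that of \<open>M\<close>, giving the first term. On
  \<open>A \<inter> B\<close> the estimator is at most \<open>prob B / (1 - w)\<close> and the mass
  at most 1. The statement includes the case of a null set \<open>B\<close>.\<close>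

lemma second_moment_estimator:
  assumes "prob_space M" and A: "A \<in> sets M" and B: "B \<in> sets M" and w: "0 < w" "w < 1"
  shows "(\<integral>\<omega>. (is_estimator w M A B \<omega>)\<^sup>2 \<partial>mixture w M (uniform_measure M B)) \<le>
    measure M (A - B) / w + (measure M B)\<^sup>2 / (1 - w)\<^sup>2"
proof -
  interpret prob_space M by fact
  let ?U = "uniform_measure M B"
  let ?Q = "mixture w M ?U"
  \<comment> \<open>The value of the estimator on \<open>A \<inter> B\<close>. For
    \<open>prob B = 0\<close> division by zero turns it into \<open>1 / w\<close>, but then the
    mixture gives \<open>A \<inter> B\<close> no mass.\<close>
  define \<kappa> where "\<kappa> = 1 / (w + (1 - w) / prob B)"
  have Q: "emeasure ?Q E = ennreal w * emeasure M E + ennreal (1 - w) * emeasure ?U E" if "E \<in> sets M" for E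
    using that by (intro emeasure_mixture) auto
  have U: "emeasure ?U E = emeasure M (B \<inter> E) / emeasure M B" if "E \<in> sets M" for E
    using B that by (rule emeasure_uniform_measure)
  have U1: "emeasure ?U E \<le> 1" if "E \<in> sets M" for E
  proof (cases "emeasure M B = 0")
    case True
    then have "emeasure M (B \<inter> E) = 0" using B that emeasure_mono[of "B \<inter> E" B M] by auto
    then show ?thesis using U[OF that] by simp
  next
    case False
    have "emeasure M (B \<inter> E) / emeasure M B \<le> emeasure M B / emeasure M B"
      using B that by (intro divide_right_mono_ennreal emeasure_mono) auto
    also have "\<dots> = 1" using False by (intro ennreal_divide_self) (auto simp: emeasure_eq_measure)
    finally show ?thesis using U[OF that] by simp
  qed
  have Q1: "emeasure ?Q E \<le> 1" if "E \<in> sets M" for E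
  proof -
    have "emeasure ?Q E \<le> ennreal w * 1 + ennreal (1 - w) * 1"
      unfolding Q[OF that] using U1[OF that] emeasure_le_1 by (intro add_mono mult_left_mono) auto
    also have "\<dots> = 1" using w by (simp add: ennreal_plus[symmetric] del: ennreal_plus)
    finally show ?thesis .
  qed
  interpret Q: finite_measure ?Q
  proof
    show "emeasure ?Q (space ?Q) \<noteq> \<infinity>" using Q1[of "space M"] by (auto simp: top_unique)
  qed
  have AB: "measure ?Q (A - B) = w * prob (A - B)"
  proof -
    have "emeasure ?U (A - B) = 0" using U[of "A - B"] A B by (simp add: Int_Diff Diff_Int)
    then have "emeasure ?Q (A - B) = ennreal w * emeasure M (A - B)" using Q[of "A - B"] A B by simp
    then show ?thesis using w by (simp add: measure_def enn2real_mult)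
  qed
  have "(is_estimator w M A B \<omega>)\<^sup>2 = (1 / w\<^sup>2) * indicator (A - B) \<omega> + \<kappa>\<^sup>2 * indicator (A \<inter> B) \<omega>" for \<omega>
    by (auto simp: is_estimator_def \<kappa>_def indicator_def power_divide)
  then have "(\<integral>\<omega>. (is_estimator w M A B \<omega>)\<^sup>2 \<partial>?Q) =
      (\<integral>\<omega>. (1 / w\<^sup>2) * indicator (A - B) \<omega> + \<kappa>\<^sup>2 * indicator (A \<inter> B) \<omega> \<partial>?Q)" by simp
  also have "\<dots> = (1 / w\<^sup>2) * measure ?Q (A - B) + \<kappa>\<^sup>2 * measure ?Q (A \<inter> B)"
    using A B by (subst Bochner_Integration.integral_add) (auto simp: Q.emeasure_eq_measure)
  also have "(1 / w\<^sup>2) * measure ?Q (A - B) = prob (A - B) / w"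
    using w by (simp add: AB power2_eq_square)
  also have "\<kappa>\<^sup>2 * measure ?Q (A \<inter> B) \<le> (prob B)\<^sup>2 / (1 - w)\<^sup>2"
  proof (cases "prob B = 0")
    case True
    then have "emeasure M B = 0" by (simp add: emeasure_eq_measure)
    then have "emeasure M (A \<inter> B) = 0" "emeasure M (B \<inter> (A \<inter> B)) = 0"
      using B emeasure_mono[of "A \<inter> B" B M] emeasure_mono[of "B \<inter> (A \<inter> B)" B M] by auto
    then have "emeasure ?Q (A \<inter> B) = 0" using Q[of "A \<inter> B"] U[of "A \<inter> B"] A B by simp
    then show ?thesis using True by (simp add: measure_def)
  next
    case False
    then have pB: "prob B > 0" by (simp add: zero_less_measure_iff)
    define z where "z = (1 - w) / prob B"
    have z: "z > 0" using pB w by (simp add: z_def)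
    have "\<kappa> \<le> 1 / z" unfolding \<kappa>_def z_def[symmetric]
      using w z by (intro divide_left_mono mult_pos_pos) auto
    then have "\<kappa> \<le> prob B / (1 - w)" by (simp add: z_def)
    moreover have "0 \<le> \<kappa>" unfolding \<kappa>_def z_def[symmetric] using w z by simp
    ultimately have "\<kappa>\<^sup>2 \<le> (prob B / (1 - w))\<^sup>2" by (intro power_mono)
    moreover have "measure ?Q (A \<inter> B) \<le> 1" using Q1[of "A \<inter> B"] A B by (simp add: Q.emeasure_eq_measure)
    ultimately have "\<kappa>\<^sup>2 * measure ?Q (A \<inter> B) \<le> (prob B / (1 - w))\<^sup>2 * 1" by (intro mult_mono) auto
    then show ?thesis by (simp add: power_divide)
  qed
  finally show ?thesis by simp
qed

theorem theorem3p2: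
  fixes M :: "'a measure" and N :: "real \<Rightarrow> 'a \<Rightarrow> nat" and W :: "nat \<Rightarrow> 'a \<Rightarrow> real"
    and X :: "real \<Rightarrow> 'a \<Rightarrow> real" and r \<beta> w :: real
    and A :: "skorokhod set" and lstar :: nat and An :: "nat \<Rightarrow> 'a set"
  assumes prob: "prob_space M"
    and poisson: "poisson_process M r N"
    and W_indep: "prob_space.indep_vars M (\<lambda>_. borel) W {1..}"
    and W_ident: "\<forall>k\<ge>1. distr M borel (W k) = distr M borel (W 1)"
    and W_pos: "\<forall>k\<ge>1. AE \<omega> in M. 0 < W k \<omega>"
    and W_integrable: "integrable M (W 1)"
    and N_W_indep: "prob_space.indep_set M
          (sets (vimage_algebra (space M) (\<lambda>\<omega>. \<lambda>t\<in>{0..}. N t \<omega>) (\<Pi>\<^sub>M t\<in>{0..}. count_space UNIV)))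
          (sets (vimage_algebra (space M) (\<lambda>\<omega>. \<lambda>k\<in>{1..}. W k \<omega>) (\<Pi>\<^sub>M k\<in>{1..}. borel)))"
    and X: "X = compensated_process M r N W"
    and tail: "regularly_varying (\<lambda>x. measure M {\<omega> \<in> space M. X 1 \<omega> > x}) (- \<beta>)"
    and beta: "- \<beta> < - 1"
    and A_borel: "A \<in> sets borel"
    and lstar_exists: "\<exists>l. step_paths l \<inter> A \<noteq> {}"
    and lstar: "lstar = (LEAST l. step_paths l \<inter> A \<noteq> {})"
    and A_away: "bounded_away A (\<Union>l<lstar. step_paths l)"
    and A_interior: "limit_measure \<beta> lstar (interior A) > 0"
    and w: "0 < w" "w < 1"
    and An: "\<And>n. An n = {\<omega> \<in> space M. scaled_process X n \<omega> \<in> A}"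
  shows "\<exists>\<gamma>>0.
    let Bn = (\<lambda>n. {\<omega> \<in> space M. scaled_process X n \<omega> \<in> many_large_jumps \<gamma> lstar});
        Q = (\<lambda>n. mixture w M (uniform_measure M (Bn n)));
        Z = (\<lambda>n. is_estimator w M (An n) (Bn n))
    in (\<lambda>n. \<integral>\<omega>. (Z n \<omega>)\<^sup>2 \<partial>Q n) \<in> O(\<lambda>n. (measure M (An n))\<^sup>2)"
proof -
  have beta': "1 < \<beta>" using beta by simp
  interpret P: heavy_tailed_compound_poisson M W N r \<beta>
  proof -
    interpret prob_space M by (rule prob)
    show "heavy_tailed_compound_poisson M W N r \<beta>"
      by unfold_locales (fact W_indep W_ident W_pos W_integrable poisson N_W_indep tail[unfolded X] beta')+
  qed
  have X_eq: "scaled_process X n = P.X n" for n by (simp add: X P.X_def)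
  let ?l = lstar
  obtain y u \<eta> where yu: "\<eta> > 0" "inj_on u {1..?l}" "\<And>i. i \<in> {1..?l} \<Longrightarrow> u i \<in> {0<..<1}"
    "\<And>i. i \<in> {1..?l} \<Longrightarrow> 0 < y i" "\<And>x. dist x (step_sum ?l y u) < \<eta> \<Longrightarrow> x \<in> A"
    by (rule step_sum_in_interior[OF A_interior A_away]) blast
  obtain c where c: "c > 0" "\<forall>\<^sub>F n in sequentially.
    c * (real n * P.f (real n)) ^ ?l \<le> measure M {\<omega> \<in> space M. dist (P.X n \<omega>) (step_sum ?l y u) < \<eta>}"
    by (rule P.prob_near_step_sum[OF yu(1-4)]) blast
  obtain \<delta> where \<delta>: "\<delta> > 0" "\<And>x z. x \<in> A \<Longrightarrow> z \<in> (\<Union>k<?l. step_paths k) \<Longrightarrow> \<delta> \<le> dist x z"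
    by (rule bounded_away_dist[OF A_away]) blast
  \<comment> \<open>The factor 2 reflects that the missed probability must compare with the square
    of the target probability, of order \<open>(n * f n) ^ (2 * l)\<close>; the final 1 keeps
    \<open>K\<close> positive when \<open>l = 0\<close>.\<close>
  define K where "K = real (2 * ?l) * (\<beta> + 1) + 1"
  have K: "K > 0" "K \<ge> real (2 * ?l) * (\<beta> + 1)" using beta by (simp_all add: K_def add_nonneg_pos)
  obtain \<gamma> where \<gamma>: "\<gamma> > 0" "\<forall>\<^sub>F n in sequentially.
    measure M {\<omega> \<in> space M. P.X n \<omega> \<in> A \<and> P.X n \<omega> \<notin> many_large_jumps \<gamma> ?l} \<le> real n powr (- K)"
    by (rule P.prob_without_large_jumps_bound[OF \<delta>(1) K(1) \<delta>(2)]) blast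
  obtain C where C: "C > 0" "\<forall>\<^sub>F n in sequentially.
    measure M {\<omega> \<in> space M. P.X n \<omega> \<in> many_large_jumps \<gamma> ?l} \<le> C * (real n * P.f (real n)) ^ ?l"
    by (rule P.prob_many_large_jumps_bound[OF \<gamma>(1)]) blast
  define B where "B = (\<lambda>n. {\<omega> \<in> space M. P.X n \<omega> \<in> many_large_jumps \<gamma> ?l})"
  define D where "D = (1 / w + C\<^sup>2 / (1 - w)\<^sup>2) / c\<^sup>2"
  have "(\<lambda>n. \<integral>\<omega>. (is_estimator w M (An n) (B n) \<omega>)\<^sup>2 \<partial>mixture w M (uniform_measure M (B n)))
      \<in> O(\<lambda>n. (measure M (An n))\<^sup>2)"
  proof (rule bigoI)
    show "\<forall>\<^sub>F n in sequentially. norm (\<integral>\<omega>. (is_estimator w M (An n) (B n) \<omega>)\<^sup>2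
        \<partial>mixture w M (uniform_measure M (B n))) \<le> D * norm ((measure M (An n))\<^sup>2)"
      using c(2) \<gamma>(2) C(2) P.powr_negligible[OF K(2)] eventually_gt_at_top[of 0]
    proof eventually_elim
      case (elim n)
      define q where "q = (real n * P.f (real n)) ^ ?l"
      have q: "q \<ge> 0" using P.f_pos[of "real n"] by (simp add: q_def)
      have A_sets: "An n \<in> sets M" unfolding An X_eq by (rule P.X_sets[OF elim(5) A_borel])
      have B_sets: "B n \<in> sets M" unfolding B_def
        by (rule P.X_sets[OF elim(5)]) (intro borel_open open_many_large_jumps \<gamma>)
      have "c * q \<le> measure M {\<omega> \<in> space M. dist (P.X n \<omega>) (step_sum ?l y u) < \<eta>}"
        using elim(1) by (simp add: q_def)
      also have "\<dots> \<le> measure M (An n)"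
        using A_sets yu(5) by (intro P.finite_measure_mono) (auto simp: An X_eq)
      finally have "(c * q)\<^sup>2 \<le> (measure M (An n))\<^sup>2" using c q by (intro power_mono) auto
      \<comment> \<open>The lower bound for the target probability lets \<open>q\<^sup>2\<close> be
        replaced by its square; this is where positivity of \<open>c\<close> is used.\<close>
      then have qA: "q\<^sup>2 \<le> (measure M (An n))\<^sup>2 / c\<^sup>2"
        using c by (simp add: power_mult_distrib pos_le_divide_eq mult.commute)
      have "An n - B n = {\<omega> \<in> space M. P.X n \<omega> \<in> A \<and> P.X n \<omega> \<notin> many_large_jumps \<gamma> ?l}"
        by (auto simp: An X_eq B_def)
      then have AB: "measure M (An n - B n) \<le> q\<^sup>2"
        using elim(2,4) by (simp add: q_def power_mult[symmetric] mult.commute)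
      have "measure M (B n) \<le> C * q" using elim(3) by (simp add: B_def q_def)
      then have B2: "(measure M (B n))\<^sup>2 \<le> C\<^sup>2 * q\<^sup>2"
        using power_mono[of "measure M (B n)" "C * q" 2] by (simp add: power_mult_distrib)
      have "(\<integral>\<omega>. (is_estimator w M (An n) (B n) \<omega>)\<^sup>2 \<partial>mixture w M (uniform_measure M (B n))) \<le>
          measure M (An n - B n) / w + (measure M (B n))\<^sup>2 / (1 - w)\<^sup>2"
        by (rule second_moment_estimator[OF prob A_sets B_sets w])
      also have "\<dots> \<le> q\<^sup>2 / w + (C\<^sup>2 * q\<^sup>2) / (1 - w)\<^sup>2"
        using AB B2 w by (intro add_mono divide_right_mono) auto
      also have "\<dots> = (1 / w + C\<^sup>2 / (1 - w)\<^sup>2) * q\<^sup>2" by (simp add: distrib_right)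
      also have "\<dots> \<le> (1 / w + C\<^sup>2 / (1 - w)\<^sup>2) * ((measure M (An n))\<^sup>2 / c\<^sup>2)"
        using qA w by (intro mult_left_mono) auto
      also have "\<dots> = D * (measure M (An n))\<^sup>2" by (simp add: D_def)
      finally show ?case by (simp add: integral_nonneg_AE)
    qed
  qed
  then show ?thesis using \<gamma>(1) unfolding Let_def X_eq B_def by blast
qed

end
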